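(* Let $n\ge2$, $1<p<\infty$, let $\Omega\subset\mathbb{R}^n$ be a bounded domain, and let the inclusion $D\subset\Omega$ be a nonempty open set with Lipschitz boundary. Let $\sigma_D\in L^\infty_+(D)$ and $\sigma(x)=1+\sigma_D(x)\chi_D(x)$ for $x\in\Omega$, where $\chi_D$ is the characteristic function of $D$. Then from the knowledge of the DN map $\Lambda_\sigma$ we can recover the convex hull of the inclusion $D$.
   Context: All functions are real valued. For an open set $U$, $L^\infty_+(U)=\{\gamma\in L^\infty(U):\gamma>\varepsilon \text{ a.e. for some } \varepsilon>0\}$. Dirichlet-to-Neumann (DN) map: let $X=W^{1,p}(\Omega)/W^{1,p}_0(\Omega)$ with dual $X'$. For $\gamma\in L^\infty_+(\Omega)$ and $f\in W^{1,p}(\Omega)$ there is a unique weak solution $u\in W^{1,p}(\Omega)$ of $\mathrm{div}(\gamma|\nabla u|^{p-2}\nabla u)=0$ in $\Omega$ with $u-f\in W^{1,p}_0(\Omega)$. The nonlinear map $\Lambda_\gamma:X\to X'$ is defined by $$(\Lambda_\gamma f,g)=\int_\Omega\gamma|\nabla u|^{p-2}\nabla u\cdot\nabla v\,dx,$$ where $u$ is this solution and $v\in W^{1,p}(\Omega)$ is any function with $v-g\in W_0^{1,p}(\Omega)$. The inclusion $D$ and the function $\sigma_D$ are unknown; $\Omega$, $p$ and the background conductivity $1$ are known. *)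

theory Defs
  imports "HOL-Analysis.Analysis"
begin

text \<open>
  Functions on an open set \<open>U\<close> are represented by total functions whose values outside \<open>U\<close>
  are irrelevant.  They are not identified almost everywhere; this identification happens
  when passing to the quotient \<open>boundary_space\<close> below.
\<close>

subsection \<open>Test functions and weak gradients\<close>

definition partial_deriv :: "'n \<Rightarrow> (real^'n::finite \<Rightarrow> real) \<Rightarrow> real^'n \<Rightarrow> real" where
  "partial_deriv i f x = frechet_derivative f (at x) (axis i 1)"

primrec Ck :: "nat \<Rightarrow> (real^'n::finite \<Rightarrow> real) \<Rightarrow> bool" where
  "Ck 0 f \<longleftrightarrow> continuous_on UNIV f"
| "Ck (Suc k) f \<longleftrightarrow> f differentiable_on UNIV \<and> (\<forall>i. Ck k (partial_deriv i f))"

definition test_functions :: "(real^'n::finite) set \<Rightarrow> (real^'n \<Rightarrow> real) set" where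
  "test_functions U =
     {\<phi>. (\<forall>k. Ck k \<phi>) \<and> compact (closure {x. \<phi> x \<noteq> 0}) \<and> closure {x. \<phi> x \<noteq> 0} \<subseteq> U}"

definition locally_integrable ::
    "(real^'n::finite) set \<Rightarrow> (real^'n \<Rightarrow> 'b::euclidean_space) \<Rightarrow> bool" where
  "locally_integrable U f \<longleftrightarrow> (\<forall>K. compact K \<and> K \<subseteq> U \<longrightarrow> f absolutely_integrable_on K)"

definition has_weak_gradient ::
    "(real^'n::finite) set \<Rightarrow> (real^'n \<Rightarrow> real) \<Rightarrow> (real^'n \<Rightarrow> real^'n) \<Rightarrow> bool" where
  "has_weak_gradient U u G \<longleftrightarrow>
     locally_integrable U u \<and> locally_integrable U G \<and>
     (\<forall>\<phi>\<in>test_functions U. \<forall>i.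
        (LINT x|lebesgue_on U. u x * partial_deriv i \<phi> x) =
        - (LINT x|lebesgue_on U. G x $ i * \<phi> x))"

text \<open>The weak gradient is determined only up to a null set; an arbitrary version is chosen.\<close>

definition weak_gradient ::
    "(real^'n::finite) set \<Rightarrow> (real^'n \<Rightarrow> real) \<Rightarrow> real^'n \<Rightarrow> real^'n" where
  "weak_gradient U u = (SOME G. has_weak_gradient U u G)"


subsection \<open>Lebesgue and Sobolev spaces\<close>

definition Lp_space ::
    "(real^'n::finite) set \<Rightarrow> real \<Rightarrow> (real^'n \<Rightarrow> 'b::euclidean_space) set" where
  "Lp_space U p =
     {f. f \<in> borel_measurable (lebesgue_on U) \<and>
         integrable (lebesgue_on U) (\<lambda>x. norm (f x) powr p)}"

definition Linf_plus :: "(real^'n::finite) set \<Rightarrow> (real^'n \<Rightarrow> real) set" where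
  "Linf_plus U =
     {\<gamma>. \<gamma> \<in> borel_measurable (lebesgue_on U) \<and>
         (\<exists>M. AE x in lebesgue_on U. \<bar>\<gamma> x\<bar> \<le> M) \<and>
         (\<exists>\<epsilon>>0. AE x in lebesgue_on U. \<gamma> x > \<epsilon>)}"

definition W1p :: "(real^'n::finite) set \<Rightarrow> real \<Rightarrow> (real^'n \<Rightarrow> real) set" where
  "W1p U p = {u \<in> Lp_space U p. \<exists>G \<in> Lp_space U p. has_weak_gradient U u G}"

definition W1p_norm :: "(real^'n::finite) set \<Rightarrow> real \<Rightarrow> (real^'n \<Rightarrow> real) \<Rightarrow> real" where
  "W1p_norm U p u =
     ((LINT x|lebesgue_on U. \<bar>u x\<bar> powr p) +
      (LINT x|lebesgue_on U. norm (weak_gradient U u x) powr p)) powr (1 / p)"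

text \<open>The closure of the test functions in \<open>W1p U p\<close>.\<close>

definition W1p_0 :: "(real^'n::finite) set \<Rightarrow> real \<Rightarrow> (real^'n \<Rightarrow> real) set" where
  "W1p_0 U p =
     {u \<in> W1p U p. \<forall>e>0. \<exists>\<phi>\<in>test_functions U. W1p_norm U p (\<lambda>x. u x - \<phi> x) < e}"


subsection \<open>The weighted p-Laplace equation and the Dirichlet-to-Neumann map\<close>

definition p_energy_form ::
    "(real^'n::finite) set \<Rightarrow> real \<Rightarrow> (real^'n \<Rightarrow> real) \<Rightarrow> (real^'n \<Rightarrow> real) \<Rightarrow>
     (real^'n \<Rightarrow> real) \<Rightarrow> real" where
  "p_energy_form U p \<gamma> u v =
     (LINT x|lebesgue_on U. \<gamma> x * norm (weak_gradient U u x) powr (p - 2) *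
        (weak_gradient U u x \<bullet> weak_gradient U v x))"

definition weak_solution ::
    "(real^'n::finite) set \<Rightarrow> real \<Rightarrow> (real^'n \<Rightarrow> real) \<Rightarrow> (real^'n \<Rightarrow> real) \<Rightarrow> bool" where
  "weak_solution U p \<gamma> u \<longleftrightarrow>
     u \<in> W1p U p \<and> (\<forall>\<phi>\<in>W1p_0 U p. p_energy_form U p \<gamma> u \<phi> = 0)"

text \<open>
  The space \<open>X\<close> of boundary values, \<open>W1p\<close> modulo \<open>W1p_0\<close>.  As \<open>W1p_0\<close> contains every
  function vanishing almost everywhere in \<open>U\<close>, this agrees with the quotient of the
  spaces of almost-everywhere classes.
\<close>

definition boundary_space ::
    "(real^'n::finite) set \<Rightarrow> real \<Rightarrow> (real^'n \<Rightarrow> real) set set" where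
  "boundary_space U p =
     W1p U p // {(f, g). f \<in> W1p U p \<and> g \<in> W1p U p \<and> (\<lambda>x. f x - g x) \<in> W1p_0 U p}"

text \<open>
  For \<open>f \<in> W1p U p\<close> with class \<open>F\<close>, a function \<open>u\<close> satisfies \<open>u \<in> F\<close> iff \<open>u \<in> W1p U p\<close>
  and \<open>u - f \<in> W1p_0 U p\<close>.  So \<open>u\<close> below is the weak solution with boundary data \<open>F\<close> (unique
  up to a null set), and \<open>v\<close> is any function with boundary values \<open>G\<close>.  The functional
  \<open>dn_map U p \<gamma> F\<close> on \<open>X\<close> is given by its values; both arguments are restricted to \<open>X\<close>, so
  that \<open>dn_map U p \<gamma>\<close> carries no information beyond the map from \<open>X\<close> to its dual.
\<close>

definition dn_map ::
    "(real^'n::finite) set \<Rightarrow> real \<Rightarrow> (real^'n \<Rightarrow> real) \<Rightarrow>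
     (real^'n \<Rightarrow> real) set \<Rightarrow> (real^'n \<Rightarrow> real) set \<Rightarrow> real" where
  "dn_map U p \<gamma> =
     (\<lambda>F\<in>boundary_space U p. \<lambda>G\<in>boundary_space U p.
        let u = (SOME u. u \<in> F \<and> weak_solution U p \<gamma> u);
            v = (SOME v. v \<in> G)
        in p_energy_form U p \<gamma> u v)"


subsection \<open>Lipschitz boundary\<close>

text \<open>
  Near each boundary point, \<open>D\<close> is the strict epigraph of a Lipschitz function \<open>\<psi>\<close> in
  suitably rotated coordinates: \<open>e\<close> is the last coordinate direction, and \<open>\<psi>\<close> is a function
  of the remaining coordinates, i.e. of the orthogonal projection to the complement of \<open>e\<close>.
\<close>

definition lipschitz_boundary :: "(real^'n::finite) set \<Rightarrow> bool" where
  "lipschitz_boundary D \<longleftrightarrow>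
     (\<forall>x0\<in>frontier D. \<exists>r>0. \<exists>e L. \<exists>\<psi> :: real^'n \<Rightarrow> real.
        norm e = 1 \<and> L-lipschitz_on {y. y \<bullet> e = 0} \<psi> \<and>
        D \<inter> ball x0 r = {x \<in> ball x0 r. x \<bullet> e > \<psi> (x - (x \<bullet> e) *\<^sub>R e)})"

end

theory Submission
  imports Defs
begin

text \<open>
  Among all functions with given boundary values \<open>f\<close>, the weak solution \<open>u\<close> minimizes the
  energy \<open>\<integral>\<sigma>|\<nabla>u|\<^sup>p\<close>, and the minimum is the number that the Dirichlet-to-Neumann map assigns
  to the pair \<open>(f, f)\<close>. A recovery function exists as soon as two inclusions with the same
  Dirichlet-to-Neumann map have the same convex hull. The hulls are open, so by symmetry it is
  enough to show that \<open>D\<^sub>1\<close> is contained in the closure of the convex hull of \<open>D\<^sub>2\<close>.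

  Otherwise a hyperplane separates some ball \<open>B \<subseteq> D\<^sub>1\<close> from \<open>D\<^sub>2\<close>: there are a unit vector \<open>\<rho>\<close>
  and \<open>\<gamma> > 0\<close> with \<open>\<rho> \<bullet> x > t + \<gamma>\<close> on \<open>B\<close> and \<open>\<rho> \<bullet> x < t\<close> on \<open>D\<^sub>2\<close>. Take the boundary values
  of a function \<open>v\<close> that is \<open>p\<close>-harmonic for the background conductivity. Two monotonicity
  inequalities compare the minimal energies with the background energy \<open>\<integral>|\<nabla>v|\<^sup>p\<close>: inserting
  \<open>v\<close> as a competitor shows that the energy for \<open>\<sigma>\<^sub>2\<close> exceeds it by at most a constant times
  \<open>\<integral>|\<nabla>v|\<^sup>p\<close> over \<open>D\<^sub>2\<close>, and duality with the divergence-free field \<open>|\<nabla>v|\<^sup>p\<^sup>-\<^sup>2\<nabla>v\<close> shows that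
  the energy for \<open>\<sigma>\<^sub>1\<close> exceeds it by at least a constant times \<open>\<integral>|\<nabla>v|\<^sup>p\<close> over \<open>B\<close>
  (\<open>energy_weak_solution_le\<close>, \<open>energy_lower_bound_p_harmonic\<close>). Both inequalities are
  integrated forms of the convexity of \<open>|a|\<^sup>p\<close>. If the energies agree, the integral over \<open>B\<close>
  is bounded by a fixed multiple of the integral over \<open>D\<^sub>2\<close>. The explicit \<open>p\<close>-harmonic
  functions of \<open>wolff_solution\<close>, which oscillate in a direction orthogonal to \<open>\<rho>\<close>, satisfy
  \<open>c exp (\<tau> \<rho> \<bullet> x) \<le> |\<nabla>v| \<le> C exp (\<tau> \<rho> \<bullet> x)\<close> with \<open>c\<close> and \<open>C\<close> independent of \<open>\<tau>\<close>, so the ratio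
  of the two integrals grows like \<open>exp (p \<tau> \<gamma>)\<close>, a contradiction for large \<open>\<tau>\<close>.

  The map \<open>dn_map\<close> selects a weak solution by choice, so its values mean something only
  because weak solutions exist (\<open>weak_solution_exists\<close>). They are obtained by the direct
  method. Uniform convexity of \<open>|a|\<^sup>p\<close>, which comes from strict convexity and compactness for
  all \<open>p > 1\<close> alike, makes the gradients of a minimizing sequence a Cauchy sequence in \<open>L\<^sup>p\<close>;
  completeness of \<open>L\<^sup>p\<close> and Poincare's inequality provide a limit in the Sobolev space.
  Similarly, \<open>weak_gradient\<close> is a choice that is harmless because weak gradients are unique up
  to null sets, which rests on smooth bump functions approximating indicator functions of
  boxes.
\<close>

section \<open>Pointwise inequalities for powers of the norm\<close>

text \<open>
  For \<open>x = t / s\<close> this is Bernoulli's inequality \<open>1 + p (x - 1) \<le> x\<^sup>p\<close>. Since \<open>x\<close> is the mean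
  of \<open>1\<close> and \<open>u = 1 + p (x - 1)\<close> with weights \<open>1 - 1/p\<close> and \<open>1/p\<close>, it expresses strict
  concavity of the logarithm, which in turn follows from \<open>ln y < y - 1\<close> for \<open>y \<noteq> 1\<close>.
\<close>

lemma real_tangent_powr:
  fixes s t p :: real
  assumes "1 < p" "0 \<le> s" "0 \<le> t"
  shows "p * (s powr (p - 1) * t) - (p - 1) * s powr p \<le> t powr p"
    and "s \<noteq> t \<Longrightarrow> p * (s powr (p - 1) * t) - (p - 1) * s powr p < t powr p"
proof -
  have strict: "p * (s powr (p - 1) * t) - (p - 1) * s powr p < t powr p" if "s \<noteq> t"
  proof (cases "s = 0 \<or> t = 0")
    case True
    then show ?thesis
      using that assms by auto
  next
    case False
    then have st: "s > 0" "t > 0" using assms by auto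
    define x where "x = t / s"
    have x: "x > 0" "x \<noteq> 1" using st that by (auto simp: x_def)
    define u where "u = 1 + p * (x - 1)"
    have "u < x powr p"
    proof (cases "u \<le> 0")
      case True
      moreover have "0 < x powr p" using x by simp
      ultimately show ?thesis by linarith
    next
      case False
      have a: "ln (1 / x) < 1 / x - 1"
      proof -
        have "1 / x > 0" "1 / x \<noteq> 1" using x by (auto simp: field_simps)
        then show ?thesis
          using ln_le_minus_one[of "1/x"] ln_eq_minus_one[of "1/x"] by fastforce
      qed
      have b: "ln (u / x) \<le> u / x - 1"
        using False x by (intro ln_le_minus_one) auto
      have "(p - 1) * ln (1 / x) + ln (u / x) < (p - 1) * (1 / x - 1) + (u / x - 1)"
        using a b assms(1) by (intro add_less_le_mono mult_strict_left_mono) auto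
      also have "\<dots> = 0"
        using x(1) by (simp add: u_def field_simps)
      finally have "ln u < p * ln x"
        using x(1) False by (simp add: ln_div algebra_simps)
      then have "exp (ln u) < exp (p * ln x)" by simp
      then show ?thesis using x False by (simp add: powr_def)
    qed
    then have "s powr p * u < s powr p * x powr p"
      using st by simp
    moreover have "s powr p * x powr p = t powr p"
      using st by (simp add: x_def powr_divide)
    moreover have "s powr p * u = p * (s powr (p - 1) * t) - (p - 1) * s powr p"
      using st by (simp add: u_def x_def powr_diff field_simps)
    ultimately show ?thesis by simp
  qed
  then show "s \<noteq> t \<Longrightarrow> p * (s powr (p - 1) * t) - (p - 1) * s powr p < t powr p" .
  show "p * (s powr (p - 1) * t) - (p - 1) * s powr p \<le> t powr p"
  proof (cases "s = t")
    case True
    have "s powr (p - 1) * s = s powr p"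
      using assms powr_mult_base[of s "p - 1"] by (simp add: mult.commute)
    then show ?thesis using True by (simp add: algebra_simps)
  qed (use strict in simp)
qed

text \<open>
  The graph of \<open>|a|\<^sup>p\<close> lies above its tangent at \<open>c\<close>, where the gradient is \<open>p |c|\<^sup>p\<^sup>-\<^sup>2 c\<close>.
  The Cauchy-Schwarz inequality reduces this to real numbers. All energy comparisons below
  come from this inequality.
\<close>

lemma norm_powr_tangent:
  fixes a c :: "'b::real_inner"
  assumes "1 < p"
  shows "p * (norm c powr (p - 2) * (c \<bullet> a)) - (p - 1) * norm c powr p \<le> norm a powr p"
    and "a \<noteq> c \<Longrightarrow> p * (norm c powr (p - 2) * (c \<bullet> a)) - (p - 1) * norm c powr p < norm a powr p"
proof -
  have eq: "norm c powr (p - 2) * (norm c * norm a) = norm c powr (p - 1) * norm a"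
  proof (cases "c = 0")
    case False
    have "norm c * norm c powr (p - 2) = norm c powr (p - 1)"
      using powr_mult_base[of "norm c" "p - 2"] by simp
    moreover have "norm c powr (p - 2) * (norm c * norm a) = (norm c * norm c powr (p - 2)) * norm a"
      by (simp only: mult_ac)
    ultimately show ?thesis by simp
  qed auto
  have le: "p * (norm c powr (p - 2) * (c \<bullet> a)) \<le> p * (norm c powr (p - 1) * norm a)"
    unfolding eq[symmetric]
    using assms norm_cauchy_schwarz[of c a] by (intro mult_left_mono) auto
  show "p * (norm c powr (p - 2) * (c \<bullet> a)) - (p - 1) * norm c powr p \<le> norm a powr p"
    using le real_tangent_powr(1)[OF assms, of "norm c" "norm a"] by simp
  assume "a \<noteq> c"
  show "p * (norm c powr (p - 2) * (c \<bullet> a)) - (p - 1) * norm c powr p < norm a powr p"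
  proof (cases "norm a = norm c")
    case False
    then show ?thesis
      using le real_tangent_powr(2)[OF assms, of "norm c" "norm a"] by simp
  next
    case True
    then have "c \<noteq> 0" using \<open>a \<noteq> c\<close> by auto
    have "c \<bullet> a \<noteq> norm c * norm a"
    proof
      assume "c \<bullet> a = norm c * norm a"
      then have "norm c *\<^sub>R a = norm a *\<^sub>R c" by (simp only: norm_cauchy_schwarz_eq)
      then have "norm c *\<^sub>R a = norm c *\<^sub>R c" by (simp only: True)
      then show False using \<open>a \<noteq> c\<close> \<open>c \<noteq> 0\<close> by simp
    qed
    then have "c \<bullet> a < norm c * norm a"
      using norm_cauchy_schwarz[of c a] by simp
    then have "p * (norm c powr (p - 2) * (c \<bullet> a)) < p * (norm c powr (p - 2) * (norm c * norm a))"
      using assms \<open>c \<noteq> 0\<close> by simp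
    then show ?thesis
      using real_tangent_powr(1)[OF assms, of "norm c" "norm a"] unfolding eq by simp
  qed
qed

lemma norm_powr_p_flux:
  fixes c :: "'b::real_inner"
  assumes "1 < p"
  shows "norm c powr (p - 2) * (c \<bullet> c) = norm c powr p"
    and "norm (norm c powr (p - 2) *\<^sub>R c) = norm c powr (p - 1)"
proof -
  have "norm c powr p = norm c powr (p - 2) * norm c powr 2" if "c \<noteq> 0"
    using powr_add[of "norm c" "p - 2" 2] by simp
  then show "norm c powr (p - 2) * (c \<bullet> c) = norm c powr p"
    using assms by (cases "c = 0") (auto simp: dot_square_norm)
  show "norm (norm c powr (p - 2) *\<^sub>R c) = norm c powr (p - 1)"
    using powr_mult_base[of "norm c" "p - 2"] by (simp add: mult.commute)
qed

text \<open>
  The tangent inequality at the point \<open>s powr (- 1 / (p - 1)) b\<close>, multiplied by \<open>s\<close>. The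
  scaling is chosen so that the weight \<open>s\<close> disappears from the term that is linear in \<open>a\<close>;
  after integration that term then depends on the boundary values of a solution only.
\<close>

lemma norm_powr_weighted_tangent:
  fixes a b :: "'b::real_inner"
  assumes "1 < p" "0 < s"
  shows "p * (norm b powr (p - 2) * (b \<bullet> a)) - (p - 1) * (s powr (- 1 / (p - 1)) * norm b powr p)
           \<le> s * norm a powr p"
proof -
  define k where "k = s powr (- 1 / (p - 1))"
  have k: "k > 0" using assms by (simp add: k_def)
  have kp: "s * k powr (p - 1) = 1"
  proof -
    have "k powr (p - 1) = s powr (- 1)"
      unfolding k_def powr_powr using assms(1) by (simp add: field_simps)
    then show ?thesis using assms by (simp add: powr_minus)
  qed
  have k2: "s * (k powr (p - 2) * k) = 1"
    using kp k powr_mult_base[of k "p - 2"] by (simp add: mult.commute)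
  have k3: "s * k powr p = k"
  proof -
    have "s * k powr p = s * (k * k powr (p - 1))"
      using k powr_mult_base[of k "p - 1"] by simp
    also have "\<dots> = k * (s * k powr (p - 1))" by (simp only: mult_ac)
    finally show ?thesis using kp by simp
  qed
  have "s * (p * (norm (k *\<^sub>R b) powr (p - 2) * ((k *\<^sub>R b) \<bullet> a)) - (p - 1) * norm (k *\<^sub>R b) powr p)
          \<le> s * norm a powr p"
    using norm_powr_tangent(1)[OF assms(1), of "k *\<^sub>R b" a] assms by (intro mult_left_mono) auto
  also have "s * (p * (norm (k *\<^sub>R b) powr (p - 2) * ((k *\<^sub>R b) \<bullet> a)) - (p - 1) * norm (k *\<^sub>R b) powr p)
     = (s * (k powr (p - 2) * k)) * (p * (norm b powr (p - 2) * (b \<bullet> a)))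
       - (p - 1) * ((s * k powr p) * norm b powr p)"
    using k by (simp add: powr_mult algebra_simps)
  finally show ?thesis unfolding k2 k3 k_def[symmetric] by simp
qed

lemma norm_add_powr_le:
  fixes a b :: "'b::real_normed_vector"
  assumes "0 \<le> p"
  shows "norm (a + b) powr p \<le> 2 powr p * (norm a powr p + norm b powr p)"
proof -
  define m where "m = max (norm a) (norm b)"
  have "norm (a + b) \<le> 2 * m" using norm_triangle_ineq[of a b] by (auto simp: m_def)
  then have "norm (a + b) powr p \<le> (2 * m) powr p" using assms by (intro powr_mono2) auto
  also have "\<dots> = 2 powr p * m powr p" by (simp add: powr_mult m_def)
  also have "m powr p \<le> norm a powr p + norm b powr p" by (auto simp: m_def max_def)
  finally show ?thesis by simp
qed

text \<open>
  Convexity applied to \<open>a + b = (1 - s) (a / (1 - s)) + s (b / s)\<close>. The first coefficient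
  tends to \<open>1\<close> as \<open>s\<close> tends to \<open>0\<close>, so this inequality replaces the triangle inequality of
  \<open>L\<^sup>p\<close> in passages to the limit.
\<close>

lemma norm_add_powr_le_convex:
  fixes a b :: "'b::real_inner"
  assumes "1 < p" "0 < s" "s < 1"
  shows "norm (a + b) powr p \<le> (1 - s) powr (1 - p) * norm a powr p + s powr (1 - p) * norm b powr p"
proof -
  let ?c = "a + b"
  have A: "p * (norm ?c powr (p - 2) * (?c \<bullet> ((1 / r) *\<^sub>R x))) - (p - 1) * norm ?c powr p
      \<le> (1 / r) powr p * norm x powr p" if "0 < r" for r and x :: 'b
    using norm_powr_tangent(1)[OF assms(1), of ?c "(1 / r) *\<^sub>R x"] that by (simp add: powr_mult powr_divide)
  have rp: "r * (1 / r) powr p = r powr (1 - p)" if "0 < r" for r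
    using that by (simp add: powr_divide powr_diff)
  have B: "p * (norm ?c powr (p - 2) * (?c \<bullet> x)) - r * ((p - 1) * norm ?c powr p)
      \<le> r powr (1 - p) * norm x powr p" if "0 < r" for r and x :: 'b
  proof -
    have "r * (p * (norm ?c powr (p - 2) * (?c \<bullet> ((1 / r) *\<^sub>R x))) - (p - 1) * norm ?c powr p)
      \<le> r * ((1 / r) powr p * norm x powr p)"
      using A[OF that] that by (intro mult_left_mono) auto
    moreover have "r * (p * (norm ?c powr (p - 2) * (?c \<bullet> ((1 / r) *\<^sub>R x))) - (p - 1) * norm ?c powr p)
      = p * (norm ?c powr (p - 2) * (?c \<bullet> x)) - r * ((p - 1) * norm ?c powr p)"
      using that by (simp add: algebra_simps)
    moreover have "r * ((1 / r) powr p * norm x powr p) = r powr (1 - p) * norm x powr p"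
      using rp[OF that] by (simp only: mult.assoc[symmetric])
    ultimately show ?thesis by simp
  qed
  have "p * (norm ?c powr (p - 2) * (?c \<bullet> a)) + p * (norm ?c powr (p - 2) * (?c \<bullet> b)) =
      p * (norm ?c powr (p - 2) * (?c \<bullet> ?c))"
    by (simp add: inner_add_right algebra_simps)
  also have "\<dots> = p * norm ?c powr p" using norm_powr_p_flux(1)[OF assms(1), of ?c] by simp
  finally show ?thesis
    using B[of "1 - s" a] B[of s b] assms by (simp add: algebra_simps)
qed

text \<open>
  By homogeneity it is enough to consider pairs with \<open>|a|\<^sup>p + |b|\<^sup>p = 1\<close> and \<open>|a - b|\<^sup>p \<ge> d\<close>.
  These form a compact set on which the convexity defect is positive, hence bounded below. The
  argument treats \<open>p < 2\<close> and \<open>p \<ge> 2\<close> in the same way.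
\<close>

lemma norm_powr_uniformly_convex:
  fixes d p :: real
  assumes "1 < p" "0 < d"
  shows "\<exists>c>0. \<forall>a b :: 'b::euclidean_space.
     norm (a - b) powr p \<le> d * (norm a powr p + norm b powr p)
       + c * ((norm a powr p + norm b powr p) / 2 - norm ((1/2) *\<^sub>R (a + b)) powr p)"
proof -
  define q where "q = (\<lambda>z :: 'b \<times> 'b. norm (fst z) powr p + norm (snd z) powr p)"
  define e where "e = (\<lambda>z :: 'b \<times> 'b. q z / 2 - norm ((1/2) *\<^sub>R (fst z + snd z)) powr p)"
  define D where "D = (\<lambda>z :: 'b \<times> 'b. norm (fst z - snd z) powr p)"
  have cont: "continuous_on UNIV q" "continuous_on UNIV e" "continuous_on UNIV D"
    unfolding q_def e_def D_def using assms(1) by (auto intro!: continuous_intros continuous_on_powr')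
  define K where "K = {z. q z = 1} \<inter> {z. d \<le> D z}"
  have "closed K" unfolding K_def
    using cont by (intro closed_Int closed_Collect_eq closed_Collect_le continuous_intros) auto
  moreover have "bounded K"
  proof (rule boundedI[of _ 2])
    fix z assume "z \<in> K"
    then have "norm (fst z) powr p + norm (snd z) powr p = 1" by (simp add: K_def q_def)
    moreover have "0 \<le> norm (fst z) powr p" "0 \<le> norm (snd z) powr p" by simp_all
    ultimately have "norm (fst z) powr p \<le> 1" "norm (snd z) powr p \<le> 1" by linarith+
    moreover have "t \<le> 1" if "t powr p \<le> 1" for t
    proof (rule ccontr)
      assume "\<not> t \<le> 1"
      then have "t powr 0 < t powr p" using assms(1) by (intro powr_less_mono) auto
      then show False using that \<open>\<not> t \<le> 1\<close> by simp
    qed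
    ultimately have "norm (fst z) \<le> 1" "norm (snd z) \<le> 1" by auto
    then show "norm z \<le> 2" using norm_Pair_le[of "fst z" "snd z"] by simp
  qed
  ultimately have K: "compact K" by (simp add: compact_eq_bounded_closed)
  have epos: "0 < e z" if "fst z \<noteq> snd z" for z
  proof -
    let ?a = "fst z" and ?b = "snd z" and ?c = "(1/2) *\<^sub>R (fst z + snd z)"
    have "?a \<noteq> ?c" "?b \<noteq> ?c"
    proof -
      have "?a - ?c = (1/2) *\<^sub>R (?a - ?b)" "?b - ?c = (1/2) *\<^sub>R (?b - ?a)"
        by (simp_all add: algebra_simps flip: scaleR_add_left)
      then show "?a \<noteq> ?c" "?b \<noteq> ?c" using that by auto
    qed
    then have "p * (norm ?c powr (p - 2) * (?c \<bullet> ?a)) - (p - 1) * norm ?c powr p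
       + (p * (norm ?c powr (p - 2) * (?c \<bullet> ?b)) - (p - 1) * norm ?c powr p) < q z"
      unfolding q_def
      by (rule add_strict_mono[OF norm_powr_tangent(2)[OF assms(1)] norm_powr_tangent(2)[OF assms(1)]])
    moreover have "p * (norm c powr (p - 2) * (c \<bullet> a)) + p * (norm c powr (p - 2) * (c \<bullet> b))
       = 2 * p * norm c powr p" if "a + b = 2 *\<^sub>R c" for a b c :: 'b
    proof -
      have "p * (norm c powr (p - 2) * (c \<bullet> a)) + p * (norm c powr (p - 2) * (c \<bullet> b))
         = p * (norm c powr (p - 2) * (c \<bullet> (a + b)))"
        by (simp add: inner_add_right algebra_simps)
      also have "\<dots> = 2 * p * (norm c powr (p - 2) * (c \<bullet> c))" unfolding that by simp
      finally show ?thesis using norm_powr_p_flux(1)[OF assms(1), of c] by simp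
    qed
    from this[of ?a ?b ?c]
    have "p * (norm ?c powr (p - 2) * (?c \<bullet> ?a)) + p * (norm ?c powr (p - 2) * (?c \<bullet> ?b))
       = 2 * p * norm ?c powr p" by simp
    ultimately show ?thesis by (simp add: e_def algebra_simps)
  qed
  have enn: "0 \<le> e z" for z
  proof (cases "fst z = snd z")
    case True
    then show ?thesis unfolding e_def q_def True scaleR_half_double by simp
  qed (use epos in force)
  have "\<exists>\<mu>>0. \<forall>z\<in>K. \<mu> \<le> e z"
  proof (cases "K = {}")
    case False
    then obtain z0 where "z0 \<in> K" "\<forall>z\<in>K. e z0 \<le> e z"
      using continuous_attains_inf[OF K False continuous_on_subset[OF cont(2)]] by auto
    moreover have "fst z0 \<noteq> snd z0" using \<open>z0 \<in> K\<close> assms by (auto simp: K_def D_def)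
    ultimately show ?thesis using epos[of z0] by (intro exI[of _ "e z0"]) simp
  qed (auto intro: exI[of _ 1])
  then obtain \<mu> where \<mu>: "\<mu> > 0" "\<And>z. z \<in> K \<Longrightarrow> \<mu> \<le> e z" by auto
  have Dq: "D z \<le> 2 powr p * q z" for z
    using norm_add_powr_le[of p "fst z" "- snd z"] assms by (simp add: D_def q_def)
  have main: "D z \<le> d * q z + (2 powr p / \<mu>) * e z" for z
  proof (cases "q z = 0")
    case True
    then have "D z \<le> 0" using Dq[of z] by simp
    moreover have "0 \<le> (2 powr p / \<mu>) * e z" using enn[of z] \<mu> by simp
    ultimately show ?thesis using True by simp
  next
    case False
    moreover have "q z \<ge> 0" by (simp add: q_def)
    ultimately have qz: "q z > 0" by simp
    define r where "r = q z powr (1 / p)"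
    have r: "r > 0" "r powr p = q z" using qz assms by (auto simp: r_def powr_powr)
    let ?z = "(1 / r) *\<^sub>R z"
    have sc: "norm ((1 / r) *\<^sub>R x) powr p = norm x powr p / q z" for x :: 'b
      using r by (simp add: powr_divide)
    have s1: "q ?z = 1" using sc[of "fst z"] sc[of "snd z"] qz by (simp add: q_def flip: add_divide_distrib)
    have "D ?z = D z / q z" using sc[of "fst z - snd z"] by (simp add: D_def scaleR_diff_right)
    moreover have "e ?z = e z / q z"
      using sc[of "(1/2) *\<^sub>R (fst z + snd z)"] s1 qz
      by (simp add: e_def algebra_simps diff_divide_distrib)
    ultimately have s: "D ?z = D z / q z" "e ?z = e z / q z" by auto
    show ?thesis
    proof (cases "d \<le> D ?z")
      case True
      then have "?z \<in> K" using s1 by (simp add: K_def)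
      then have "\<mu> * q z \<le> e z" using \<mu>(2)[of ?z] s qz by (simp add: field_simps)
      then have "2 powr p * q z \<le> (2 powr p / \<mu>) * e z" using \<mu>
        by (simp add: field_simps)
      moreover have "0 \<le> d * q z" using qz assms by simp
      ultimately show ?thesis using Dq[of z] by linarith
    next
      case False
      then have "D z \<le> d * q z" using s qz by (simp add: field_simps)
      moreover have "0 \<le> (2 powr p / \<mu>) * e z" using enn[of z] \<mu> by simp
      ultimately show ?thesis by linarith
    qed
  qed
  show ?thesis
  proof (intro exI[of _ "2 powr p / \<mu>"] conjI allI)
    show "0 < 2 powr p / \<mu>" using \<mu> by simp
    fix a b :: 'b
    show "norm (a - b) powr p \<le> d * (norm a powr p + norm b powr p)
       + 2 powr p / \<mu> * ((norm a powr p + norm b powr p) / 2 - norm ((1/2) *\<^sub>R (a + b)) powr p)"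
      using main[of "(a, b)"] by (simp add: D_def q_def e_def)
  qed
qed

text \<open>
  One of the two terms on the right dominates, according to whether \<open>t \<le> e s\<close> or not.
\<close>

lemma young_powr:
  fixes s t e p :: real
  assumes "1 < p" "0 \<le> s" "0 \<le> t" "0 < e"
  shows "s powr (p - 1) * t \<le> e * s powr p + e powr (1 - p) * t powr p"
proof (cases "t \<le> e * s")
  case True
  then have "s powr (p - 1) * t \<le> s powr (p - 1) * (e * s)" by (intro mult_left_mono) auto
  also have "\<dots> = e * (s * s powr (p - 1))" by simp
  also have "\<dots> = e * s powr p" using assms powr_mult_base[of s "p - 1"] by simp
  finally show ?thesis by (rule order_trans) simp
next
  case False
  then have "s \<le> t / e" using assms by (simp add: field_simps)
  then have "s powr (p - 1) * t \<le> (t / e) powr (p - 1) * t" using assms by (intro mult_right_mono powr_mono2) auto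
  also have "\<dots> = e powr (1 - p) * (t * t powr (p - 1))"
  proof -
    have "e powr (1 - p) = 1 / e powr (p - 1)" using powr_minus_divide[of e "p - 1"] by simp
    then show ?thesis using assms by (simp add: powr_divide)
  qed
  also have "t * t powr (p - 1) = t powr p" using assms powr_mult_base[of t "p - 1"] by simp
  finally show ?thesis by (rule order_trans) (use assms in simp)
qed

lemma L1_le_powr:
  fixes t e p :: real
  assumes "1 < p" "0 \<le> t" "0 < e"
  shows "t \<le> e + e powr (1 - p) * t powr p"
  using young_powr[OF assms(1), of 1 t e] assms by simp

section \<open>Integration by parts\<close>

lemma integrable_continuous_compact_support:
  fixes h :: "'a::euclidean_space \<Rightarrow> 'b::euclidean_space"
  assumes "continuous_on UNIV h" "compact K" "\<And>x. x \<notin> K \<Longrightarrow> h x = 0"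
  shows "integrable lborel h"
proof -
  have "(\<lambda>x. indicator K x *\<^sub>R h x) = h"
    using assms(3) by (auto simp: indicator_def)
  then show ?thesis
    using borel_integrable_compact[OF assms(2) continuous_on_subset[OF assms(1)]] by simp
qed

lemma lebesgue_on_integral_support:
  fixes h :: "'a::euclidean_space \<Rightarrow> 'b::euclidean_space"
  assumes "h \<in> borel_measurable borel" "S \<in> sets lebesgue" "\<And>x. x \<notin> S \<Longrightarrow> h x = 0"
  shows "integral\<^sup>L (lebesgue_on S) h = integral\<^sup>L lborel h"
    and "integrable (lebesgue_on S) h \<longleftrightarrow> integrable lborel h"
proof -
  have "(\<lambda>x. indicator S x *\<^sub>R h x) = h"
    using assms(3) by (auto simp: indicator_def)
  then show "integral\<^sup>L (lebesgue_on S) h = integral\<^sup>L lborel h"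
    and "integrable (lebesgue_on S) h \<longleftrightarrow> integrable lborel h"
    using assms by (simp_all add: integral_restrict_space integrable_restrict_space
        integral_completion integrable_completion)
qed

text \<open>
  Difference quotients of \<open>g\<close> have integral zero because Lebesgue measure is translation
  invariant, and the mean value theorem provides a dominating function for passing to the
  derivative.
\<close>

lemma integral_directional_derivative_eq_0:
  fixes g d :: "'a::euclidean_space \<Rightarrow> real"
  assumes deriv: "\<And>x. ((\<lambda>t. g (x + t *\<^sub>R e)) has_real_derivative d x) (at 0)"
    and cont: "continuous_on UNIV g" "continuous_on UNIV d"
    and supp: "\<And>x. R < norm x \<Longrightarrow> g x = 0"
  shows "integral\<^sup>L lborel d = 0"
proof -
  have deriv': "((\<lambda>t. g (x + t *\<^sub>R e)) has_real_derivative d (x + t *\<^sub>R e)) (at t)" for x t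
  proof -
    have "((\<lambda>s. g ((x + t *\<^sub>R e) + (s - t) *\<^sub>R e)) has_real_derivative d (x + t *\<^sub>R e)) (at t)"
    proof -
      have "((\<lambda>s. s - t) has_real_derivative 1) (at t)" by (auto intro!: derivative_eq_intros)
      moreover have "((\<lambda>t'. g ((x + t *\<^sub>R e) + t' *\<^sub>R e)) has_real_derivative d (x + t *\<^sub>R e)) (at (t - t))"
        using deriv[of "x + t *\<^sub>R e"] by simp
      ultimately show ?thesis
        using DERIV_chain2[where f = "\<lambda>t'. g ((x + t *\<^sub>R e) + t' *\<^sub>R e)" and g = "\<lambda>s. s - t" and x = t and s = UNIV]
        by fastforce
    qed
    moreover have "(\<lambda>s. g ((x + t *\<^sub>R e) + (s - t) *\<^sub>R e)) = (\<lambda>s. g (x + s *\<^sub>R e))"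
      by (simp add: algebra_simps)
    ultimately show ?thesis by simp
  qed
  define h where "h = (\<lambda>k. inverse (real (Suc k)))"
  have h: "0 < h k" "h k \<le> 1" for k by (auto simp: h_def field_simps)
  define q where "q = (\<lambda>k x. (g (x + h k *\<^sub>R e) - g x) / h k)"
  obtain B where B: "\<And>x. x \<in> cball 0 (R + 2 * norm e) \<Longrightarrow> \<bar>d x\<bar> \<le> B"
  proof (cases "R + 2 * norm e \<ge> 0")
    case True
    have "bounded (d ` cball 0 (R + 2 * norm e))"
      using compact_imp_bounded[OF compact_continuous_image[OF continuous_on_subset[OF cont(2)]]]
      by (meson compact_cball subset_UNIV)
    then obtain a where "\<forall>x\<in>cball 0 (R + 2 * norm e). \<bar>d x\<bar> \<le> a" unfolding bounded_iff by auto
    then show ?thesis by (intro that[of a]) blast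
  next
    case False
    then have "cball 0 (R + 2 * norm e) = ({} :: 'a set)" by auto
    then show ?thesis using that[of 0] by blast
  qed
  have bound: "norm (q k x) \<le> B * indicator (cball 0 (R + norm e)) x" for k x
  proof (cases "x \<in> cball 0 (R + norm e)")
    case True
    obtain z where z: "0 < z" "z < h k"
      "g (x + h k *\<^sub>R e) - g (x + 0 *\<^sub>R e) = (h k - 0) * d (x + z *\<^sub>R e)"
      using MVT2[of 0 "h k" "\<lambda>t. g (x + t *\<^sub>R e)" "\<lambda>t. d (x + t *\<^sub>R e)"] h deriv' by auto
    have "norm (x + z *\<^sub>R e) \<le> norm x + z * norm e"
      using norm_triangle_ineq[of x "z *\<^sub>R e"] z by simp
    moreover have "z * norm e \<le> 1 * norm e" using z h[of k] by (intro mult_right_mono) auto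
    ultimately have "\<bar>d (x + z *\<^sub>R e)\<bar> \<le> B" using True by (intro B) auto
    moreover have "q k x = d (x + z *\<^sub>R e)" using z h[of k] by (simp add: q_def)
    ultimately show ?thesis using True by simp
  next
    case False
    have "norm x \<le> norm (x + h k *\<^sub>R e) + norm (h k *\<^sub>R e)"
      using norm_triangle_ineq4[of "x + h k *\<^sub>R e" "h k *\<^sub>R e"] by simp
    moreover have "norm (h k *\<^sub>R e) \<le> 1 * norm e" using h[of k] by (simp add: mult_left_le_one_le)
    ultimately have "g (x + h k *\<^sub>R e) = 0" "g x = 0"
      using False norm_ge_zero[of e] by (auto intro!: supp simp del: norm_scaleR norm_ge_zero)
    then show ?thesis using False by (simp add: q_def)
  qed
  have lim: "(\<lambda>k. q k x) \<longlonglongrightarrow> d x" for x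
  proof -
    have "((\<lambda>t. (g (x + t *\<^sub>R e) - g x) / t) \<longlongrightarrow> d x) (at 0)"
      using deriv[of x] by (simp add: has_field_derivative_iff)
    moreover have "filterlim h (at 0) sequentially"
      unfolding h_def filterlim_at using LIMSEQ_inverse_real_of_nat by auto
    ultimately show ?thesis unfolding q_def by (rule filterlim_compose)
  qed
  have gm: "g \<in> borel_measurable borel" "d \<in> borel_measurable borel"
    using cont by (auto intro: borel_measurable_continuous_onI)
  have qm: "q k \<in> borel_measurable lborel" for k
    unfolding q_def using cont h(1)[of k]
    by (auto intro!: borel_measurable_continuous_onI continuous_intros
        continuous_on_compose2[OF cont(1)])
  have "(\<lambda>k. integral\<^sup>L lborel (q k)) \<longlonglongrightarrow> integral\<^sup>L lborel d"
  proof (rule integral_dominated_convergence)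
    show "integrable lborel (\<lambda>x::'a. B * indicator (cball 0 (R + norm e)) x)"
      by (intro integrable_mult_right integrable_real_indicator) (use emeasure_lborel_cball_finite in auto)
  qed (use gm qm lim bound in auto)
  moreover have "integral\<^sup>L lborel (q k) = 0" for k
  proof -
    have gi: "integrable lborel g"
      using supp by (intro integrable_continuous_compact_support[OF cont(1) compact_cball[of 0 R]]) auto
    have eq: "integral\<^sup>L lborel g = integral\<^sup>L lborel (\<lambda>x. g (h k *\<^sub>R e + x))"
      using integral_distr[of "(+) (h k *\<^sub>R e)" lborel borel g] gm by (simp add: lborel_distr_plus)
    have gi': "integrable lborel (\<lambda>x. g (h k *\<^sub>R e + x))"
      using gi integrable_distr_eq[of "(+) (h k *\<^sub>R e)" lborel borel g] gm by (simp add: lborel_distr_plus)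
    show ?thesis unfolding q_def using gi gi' eq by (simp add: add.commute)
  qed
  ultimately show ?thesis by (simp add: LIMSEQ_const_iff)
qed

definition grad :: "(real^'n::finite \<Rightarrow> real) \<Rightarrow> real^'n \<Rightarrow> real^'n" where
  "grad f x = (\<chi> i. partial_deriv i f x)"

lemma grad_nth [simp]: "grad f x $ i = partial_deriv i f x"
  by (simp add: grad_def)

lemma partial_deriv_eq_inner:
  assumes "(f has_derivative (\<lambda>h. G \<bullet> h)) (at x)"
  shows "partial_deriv i f x = G $ i"
  unfolding partial_deriv_def frechet_derivative_at[OF assms, symmetric]
  by (simp add: inner_axis)

lemma grad_eqI: "(f has_derivative (\<lambda>h. G \<bullet> h)) (at x) \<Longrightarrow> grad f x = G"
  by (simp add: vec_eq_iff partial_deriv_eq_inner)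

text \<open>
  The condition \<open>Ck (Suc 0)\<close> means class \<open>C\<^sup>1\<close>; for such functions the vector of partial
  derivatives represents the total derivative.
\<close>

lemma C1_has_derivative:
  assumes "Ck (Suc 0) f"
  shows "(f has_derivative (\<lambda>h. grad f x \<bullet> h)) (at x)"
proof -
  have "f differentiable (at x)" using assms by (auto simp: differentiable_on_def)
  then have D: "(f has_derivative frechet_derivative f (at x)) (at x)"
    by (simp add: frechet_derivative_works)
  then have lin: "linear (frechet_derivative f (at x))"
    by (rule has_derivative_linear)
  have "frechet_derivative f (at x) h = grad f x \<bullet> h" for h
  proof -
    have "frechet_derivative f (at x) h = frechet_derivative f (at x) (\<Sum>i\<in>UNIV. h $ i *\<^sub>R axis i 1)"
      using basis_expansion[of h] by (simp add: scalar_mult_eq_scaleR)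
    also have "\<dots> = (\<Sum>i\<in>UNIV. h $ i *\<^sub>R frechet_derivative f (at x) (axis i 1))"
      using lin by (simp add: linear_sum linear_scale)
    finally show ?thesis by (simp add: inner_vec_def partial_deriv_def mult.commute)
  qed
  then show ?thesis using D by (metis (no_types, lifting) ext)
qed

lemma C1I:
  assumes "\<And>x. (f has_derivative (\<lambda>h. G x \<bullet> h)) (at x)" "continuous_on UNIV G"
  shows "Ck (Suc 0) f" "grad f = G"
proof -
  show eq: "grad f = G" using assms(1) by (auto intro: grad_eqI)
  have "partial_deriv i f = (\<lambda>x. G x $ i)" for i using eq by (metis grad_nth)
  moreover have "continuous_on UNIV (\<lambda>x. G x $ i)" for i using assms(2) by (intro continuous_intros)
  ultimately show "Ck (Suc 0) f"
    using assms(1) by (auto simp: differentiable_on_def differentiable_def)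
qed

lemma C1_continuous:
  assumes "Ck (Suc 0) f"
  shows "continuous_on UNIV f" "continuous_on UNIV (grad f)" "continuous_on UNIV (partial_deriv i f)"
proof -
  show "continuous_on UNIV f"
    using assms by (auto intro: differentiable_imp_continuous_on)
  show "continuous_on UNIV (partial_deriv i f)" for i using assms by auto
  then show "continuous_on UNIV (grad f)"
    unfolding grad_def by (intro continuous_on_vec_lambda)
qed

lemma C1_directional:
  assumes "Ck (Suc 0) f"
  shows "((\<lambda>t. f (x + t *\<^sub>R axis i 1)) has_real_derivative partial_deriv i f x) (at 0)"
proof -
  have "((\<lambda>t. f (x + t *\<^sub>R axis i 1)) has_derivative (\<lambda>t. grad f x \<bullet> (t *\<^sub>R axis i 1))) (at 0)"
    by (rule has_derivative_compose[of "\<lambda>t. x + t *\<^sub>R axis i 1", where g = f and g' = "\<lambda>h. grad f x \<bullet> h"])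
       (auto intro!: derivative_eq_intros C1_has_derivative[OF assms])
  then show ?thesis
    by (simp add: has_field_derivative_def inner_axis mult_commute_abs)
qed

lemma Ck_Suc_imp_C1: "Ck (Suc k) f \<Longrightarrow> Ck (Suc 0) f"
proof (induction k arbitrary: f)
  case (Suc k)
  then show ?case by (auto simp: intro!: differentiable_imp_continuous_on)
qed auto

lemma test_function_C1: "\<phi> \<in> test_functions U \<Longrightarrow> Ck (Suc 0) \<phi>"
  unfolding test_functions_def by blast

lemma test_function_support:
  assumes "\<phi> \<in> test_functions U"
  obtains K where "compact K" "K \<subseteq> U" "\<And>x. x \<notin> K \<Longrightarrow> \<phi> x = 0" "\<And>x. x \<notin> K \<Longrightarrow> grad \<phi> x = 0"
proof
  define K where "K = closure {x. \<phi> x \<noteq> 0}"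
  show K: "compact K" "K \<subseteq> U" using assms by (auto simp: test_functions_def K_def)
  show z: "\<phi> x = 0" if "x \<notin> K" for x
  proof (rule ccontr)
    assume "\<phi> x \<noteq> 0"
    then have "x \<in> K" unfolding K_def by (intro subsetD[OF closure_subset]) simp
    then show False using that by blast
  qed
  show "grad \<phi> x = 0" if "x \<notin> K" for x
  proof (rule grad_eqI)
    have "((\<lambda>_. 0) has_derivative (\<lambda>h. 0 \<bullet> h)) (at x)" by simp
    then show "(\<phi> has_derivative (\<lambda>h. 0 \<bullet> h)) (at x)"
      by (rule has_derivative_transform_within_open[of _ _ _ UNIV "- K"])
        (use that z K compact_imp_closed in auto)
  qed
qed

text \<open>
  The product \<open>f \<phi>\<close> has compact support, so its partial derivatives have integral zero.
\<close>

lemma has_weak_gradient_C1: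
  assumes f: "Ck (Suc 0) f" and U: "open U"
  shows "has_weak_gradient U f (grad f)"
  unfolding has_weak_gradient_def
proof (intro conjI ballI allI)
  have li: "locally_integrable U g" if "continuous_on UNIV g"
    for g :: "real^'a \<Rightarrow> 'b::euclidean_space"
    unfolding locally_integrable_def set_integrable_def
  proof (intro allI impI)
    fix K :: "(real^'a) set" assume K: "compact K \<and> K \<subseteq> U"
    have "integrable lborel (\<lambda>x. indicator K x *\<^sub>R g x)"
      using K that by (intro borel_integrable_compact) (auto intro: continuous_on_subset)
    then show "integrable lebesgue (\<lambda>x. indicator K x *\<^sub>R g x)"
      by (subst integrable_completion) auto
  qed
  show "locally_integrable U f" "locally_integrable U (grad f)"
    using li C1_continuous[OF f] by auto
  fix \<phi> i assume \<phi>: "\<phi> \<in> test_functions U"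
  note C = test_function_C1[OF \<phi>]
  obtain K where K: "compact K" "K \<subseteq> U" "\<And>x. x \<notin> K \<Longrightarrow> \<phi> x = 0" "\<And>x. x \<notin> K \<Longrightarrow> grad \<phi> x = 0"
    using test_function_support[OF \<phi>] by blast
  obtain R where R: "\<And>x. x \<in> K \<Longrightarrow> norm x \<le> R"
    using compact_imp_bounded[OF K(1)] by (auto simp: bounded_iff)
  have K': "partial_deriv i \<phi> x = 0" if "x \<notin> K" for x
    using K(4)[OF that] by (metis grad_nth zero_index)
  let ?a = "\<lambda>x. f x * partial_deriv i \<phi> x" and ?b = "\<lambda>x. grad f x $ i * \<phi> x"
  have cont: "continuous_on UNIV ?a" "continuous_on UNIV ?b"
    using C1_continuous[OF f] C1_continuous[OF C] by (auto intro!: continuous_intros)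
  have int: "integrable lborel ?a" "integrable lborel ?b"
    using K K' cont by (auto intro!: integrable_continuous_compact_support[OF _ K(1)])
  have "integral\<^sup>L lborel (\<lambda>x. ?a x + ?b x) = 0"
  proof (rule integral_directional_derivative_eq_0[where g = "\<lambda>x. f x * \<phi> x" and R = R])
    show "((\<lambda>t. f (x + t *\<^sub>R axis i 1) * \<phi> (x + t *\<^sub>R axis i 1)) has_real_derivative ?a x + ?b x) (at 0)" for x
      using C1_directional[OF f, of x i] C1_directional[OF C, of x i]
      by (auto intro!: derivative_eq_intros)
    show "f x * \<phi> x = 0" if "R < norm x" for x using R[of x] that K by fastforce
  qed (use cont C1_continuous[OF f] C1_continuous[OF C] in \<open>auto intro!: continuous_intros\<close>)
  then have "integral\<^sup>L lborel ?a = - integral\<^sup>L lborel ?b" using int by simp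
  moreover have "U \<in> sets lebesgue" using U by auto
  then have "integral\<^sup>L (lebesgue_on U) ?a = integral\<^sup>L lborel ?a" "integral\<^sup>L (lebesgue_on U) ?b = integral\<^sup>L lborel ?b"
    using K(2,3) K'
    by (intro lebesgue_on_integral_support(1) borel_measurable_continuous_onI cont; auto)+
  ultimately show "integral\<^sup>L (lebesgue_on U) ?a = - integral\<^sup>L (lebesgue_on U) ?b" by simp
qed

section \<open>Smooth bump functions and uniqueness of weak gradients\<close>

lemma Ck_Suc_imp_Ck: "Ck (Suc k) f \<Longrightarrow> Ck k f"
  by (induction k arbitrary: f) (auto intro: differentiable_imp_continuous_on)

lemma Ck_SucI:
  assumes "\<And>x. (f has_derivative (\<lambda>h. G x \<bullet> h)) (at x)" "\<And>i. Ck k (\<lambda>x. G x $ i)"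
  shows "Ck (Suc k) f"
proof -
  have "partial_deriv i f = (\<lambda>x. G x $ i)" for i
    using partial_deriv_eq_inner[OF assms(1)] by auto
  then show ?thesis
    using assms by (auto simp: differentiable_on_def differentiable_def)
qed

lemma Ck_const: "Ck k (\<lambda>_. c)"
proof (induction k arbitrary: c)
  case (Suc k)
  show ?case by (rule Ck_SucI[where G = "\<lambda>_. 0"]) (use Suc in auto)
qed auto

lemma Ck_add: "Ck k f \<Longrightarrow> Ck k g \<Longrightarrow> Ck k (\<lambda>x. f x + g x)"
proof (induction k arbitrary: f g)
  case (Suc k)
  note C = Suc.prems[THEN Ck_Suc_imp_C1]
  show ?case
  proof (rule Ck_SucI)
    show "((\<lambda>x. f x + g x) has_derivative (\<lambda>h. (grad f x + grad g x) \<bullet> h)) (at x)" for x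
      unfolding inner_add_left by (intro derivative_intros C1_has_derivative C)
    show "Ck k (\<lambda>x. (grad f x + grad g x) $ i)" for i
      using Suc by simp
  qed
qed (auto intro: continuous_intros)

lemma Ck_mult: "Ck k f \<Longrightarrow> Ck k g \<Longrightarrow> Ck k (\<lambda>x. f x * g x)"
proof (induction k arbitrary: f g)
  case (Suc k)
  note C = Suc.prems[THEN Ck_Suc_imp_C1]
  show ?case
  proof (rule Ck_SucI)
    show "((\<lambda>x. f x * g x) has_derivative (\<lambda>h. (f x *\<^sub>R grad g x + g x *\<^sub>R grad f x) \<bullet> h)) (at x)" for x
      using has_derivative_mult[OF C1_has_derivative[OF C(1)] C1_has_derivative[OF C(2)], of x]
      by (simp add: inner_add_left mult.commute add.commute)
    show "Ck k (\<lambda>x. (f x *\<^sub>R grad g x + g x *\<^sub>R grad f x) $ i)" for i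
      using Suc Suc.prems[THEN Ck_Suc_imp_Ck] by (auto intro!: Ck_add Suc.IH)
  qed
qed (auto intro: continuous_intros)

lemma Ck_prod: "finite A \<Longrightarrow> (\<And>a. a \<in> A \<Longrightarrow> Ck k (f a)) \<Longrightarrow> Ck k (\<lambda>x. \<Prod>a\<in>A. f a x)"
  by (induction A rule: finite_induct) (auto intro: Ck_const Ck_mult)

text \<open>
  The functions \<open>exp (- c / t) / t ^ m\<close>, extended by zero to \<open>t \<le> 0\<close>, form a family that is
  closed under differentiation up to linear combinations; this makes all of them smooth.
\<close>

definition flat_exp :: "real \<Rightarrow> nat \<Rightarrow> real \<Rightarrow> real" where
  "flat_exp c m t = (if 0 < t then exp (- c / t) / t ^ m else 0)"

lemma flat_exp_has_real_derivative:
  assumes c: "0 < c"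
  shows "(flat_exp c m has_real_derivative c * flat_exp c (m + 2) t - real m * flat_exp c (m + 1) t) (at t)"
proof -
  consider "t < 0" | "t = 0" | "0 < t" by linarith
  then show ?thesis
  proof cases
    case 1
    have "((\<lambda>_. 0) has_real_derivative 0) (at t)" by simp
    then have "(flat_exp c m has_real_derivative 0) (at t)"
      by (rule has_field_derivative_transform_within_open[where S = "{..<0}"]) (use 1 in \<open>auto simp: flat_exp_def\<close>)
    then show ?thesis using 1 by (simp add: flat_exp_def)
  next
    case 2
    let ?g = "\<lambda>h. flat_exp c m h / h"
    \<comment> \<open>To the right of the origin, exponential decay beats every power.\<close>
    have lim: "((\<lambda>h::real. exp (- c / h) / h ^ (m + 1)) \<longlongrightarrow> 0) (at_right 0)"
    proof -
      have "((\<lambda>x. (1 / c) ^ (m + 1) * (x ^ (m + 1) / exp x)) \<longlongrightarrow> (1 / c) ^ (m + 1) * 0) at_top"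
        by (intro tendsto_intros tendsto_power_div_exp_0)
      moreover have "filterlim (\<lambda>h::real. c * inverse h) at_top (at_right 0)"
        by (intro filterlim_tendsto_pos_mult_at_top[OF tendsto_const c] filterlim_inverse_at_top_right)
      ultimately have "((\<lambda>h. (1 / c) ^ (m + 1) * ((c * inverse h) ^ (m + 1) / exp (c * inverse h))) \<longlongrightarrow> 0) (at_right 0)"
        using filterlim_compose by fastforce
      moreover have "(1 / c) ^ (m + 1) * ((c * inverse h) ^ (m + 1) / exp (c * inverse h)) = exp (- c / h) / h ^ (m + 1)" for h
        using c by (simp add: power_mult_distrib power_divide exp_minus field_simps)
      ultimately show ?thesis by simp
    qed
    have "(?g \<longlongrightarrow> 0) (at_right 0)"
      by (rule Lim_transform_eventually[OF lim])
         (auto simp: eventually_at_right_less flat_exp_def eventually_at_filter)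
    moreover have "(?g \<longlongrightarrow> 0) (at_left 0)"
      by (rule Lim_transform_eventually[OF tendsto_const])
         (auto simp: flat_exp_def eventually_at_filter)
    ultimately have "(?g \<longlongrightarrow> 0) (at 0)" by (simp add: filterlim_split_at)
    then show ?thesis using 2 by (simp add: has_field_derivative_iff flat_exp_def)
  next
    case 3
    have "((\<lambda>t. exp (- c / t) / t ^ m) has_real_derivative
       c * (exp (- c / t) / t ^ (m + 2)) - real m * (exp (- c / t) / t ^ (m + 1))) (at t)"
    proof -
      have "real m * t ^ (m - 1) = real m * t ^ m / t" using 3 by (cases m) auto
      then have "((\<lambda>t. t ^ m) has_real_derivative real m * t ^ m / t) (at t)"
        using DERIV_pow[of m t UNIV] by simp
      moreover have "((\<lambda>t. exp (- c / t)) has_real_derivative exp (- c / t) * (c / t\<^sup>2)) (at t)"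
        using 3 by (auto intro!: derivative_eq_intros simp: power2_eq_square)
      ultimately have "((\<lambda>t. exp (- c / t) / t ^ m) has_real_derivative
          (exp (- c / t) * (c / t\<^sup>2) * t ^ m - exp (- c / t) * (real m * t ^ m / t)) / (t ^ m * t ^ m)) (at t)"
        using 3 by (intro DERIV_divide) auto
      moreover have "(exp (- c / t) * (c / t\<^sup>2) * t ^ m - exp (- c / t) * (real m * t ^ m / t)) / (t ^ m * t ^ m)
         = c * (exp (- c / t) / t ^ (m + 2)) - real m * (exp (- c / t) / t ^ (m + 1))"
        using 3 by (simp add: field_simps power2_eq_square)
      ultimately show ?thesis by simp
    qed
    then have "(flat_exp c m has_real_derivative
       c * (exp (- c / t) / t ^ (m + 2)) - real m * (exp (- c / t) / t ^ (m + 1))) (at t)"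
      by (rule has_field_derivative_transform_within_open[where S = "{0<..}"]) (use 3 in \<open>auto simp: flat_exp_def\<close>)
    then show ?thesis using 3 by (simp add: flat_exp_def)
  qed
qed

lemma Ck_flat_exp:
  fixes i :: "'n::finite"
  assumes "0 < c"
  shows "Ck k (\<lambda>x::real^'n. flat_exp c m (s * x $ i + b))"
proof (induction k arbitrary: m)
  case 0
  have "continuous_on UNIV (flat_exp c m)"
    using DERIV_isCont[OF flat_exp_has_real_derivative[OF assms]]
    by (intro continuous_at_imp_continuous_on) auto
  then have "continuous_on UNIV (\<lambda>x::real^'n. flat_exp c m (s * x $ i + b))"
    by (rule continuous_on_compose2) (auto intro!: continuous_intros)
  then show ?case by simp
next
  case (Suc k)
  define d where "d = (\<lambda>x::real^'n. s * (c * flat_exp c (m + 2) (s * x $ i + b) + (- real m) * flat_exp c (m + 1) (s * x $ i + b)))"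
  show ?case
  proof (rule Ck_SucI[where G = "\<lambda>x. axis i (d x)"])
    fix x :: "real^'n"
    have "((\<lambda>x. flat_exp c m (s * x $ i + b)) has_derivative
        (\<lambda>h. (s * h $ i) * (c * flat_exp c (m + 2) (s * x $ i + b) - real m * flat_exp c (m + 1) (s * x $ i + b)))) (at x)"
      by (rule has_derivative_compose[of "\<lambda>x. s * x $ i + b",
            OF _ flat_exp_has_real_derivative[OF assms, unfolded has_field_derivative_def],
            THEN has_derivative_eq_rhs])
         (auto intro!: derivative_eq_intros bounded_linear.has_derivative[OF bounded_linear_vec_nth])
    then show "((\<lambda>x. flat_exp c m (s * x $ i + b)) has_derivative (\<lambda>h. axis i (d x) \<bullet> h)) (at x)"
      by (simp add: inner_axis' d_def algebra_simps)
  next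
    fix j
    have "Ck k d" unfolding d_def by (intro Ck_mult Ck_add Ck_const Suc)
    then show "Ck k (\<lambda>x. axis i (d x) $ j)"
      by (cases "j = i") (auto simp: axis_def Ck_const)
  qed
qed

text \<open>
  As \<open>k\<close> grows, the exponents \<open>- 1 / ((k + 1) (x\<^sub>i - a\<^sub>i))\<close> and \<open>- 1 / ((k + 1) (b\<^sub>i - x\<^sub>i))\<close>
  tend to zero inside the box, and the function tends to the indicator function of the open
  box.
\<close>

definition box_bump :: "real^'n::finite \<Rightarrow> real^'n \<Rightarrow> nat \<Rightarrow> real^'n \<Rightarrow> real" where
  "box_bump a b k x = (\<Prod>i\<in>UNIV. flat_exp (1 / Suc k) 0 (x $ i - a $ i) * flat_exp (1 / Suc k) 0 (b $ i - x $ i))"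

lemma flat_exp_0_bounds: "0 < c \<Longrightarrow> 0 \<le> flat_exp c 0 t" "0 < c \<Longrightarrow> flat_exp c 0 t \<le> 1"
  by (auto simp: flat_exp_def)

lemma mem_box_vec: "x \<in> box a b \<longleftrightarrow> (\<forall>i. a $ i < x $ i \<and> x $ i < b $ i)" for x :: "real^'n::finite"
  by (simp add: mem_box_cart)

lemma box_bump_bounds: "0 \<le> box_bump a b k x" "box_bump a b k x \<le> 1"
  unfolding box_bump_def
  by (intro prod_nonneg prod_le_1 ballI conjI mult_nonneg_nonneg mult_le_one flat_exp_0_bounds; simp)+

lemma box_bump_eq_0: "x \<notin> box a b \<Longrightarrow> box_bump a b k x = 0"
  unfolding box_bump_def mem_box_vec by (fastforce simp: flat_exp_def intro: prod_zero)

lemma box_bump_LIMSEQ: "(\<lambda>k. box_bump a b k x) \<longlonglongrightarrow> indicator (box a b) x"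
proof (cases "x \<in> box a b")
  case True
  have lim: "(\<lambda>k. flat_exp (1 / Suc k) 0 t) \<longlonglongrightarrow> 1" if "0 < t" for t
  proof -
    have "(\<lambda>k. exp (- (inverse (real (Suc k))) * inverse t)) \<longlonglongrightarrow> exp (- 0 * inverse t)"
      by (intro tendsto_intros LIMSEQ_inverse_real_of_nat)
    then show ?thesis using that by (simp add: flat_exp_def field_simps)
  qed
  have "(\<lambda>k. box_bump a b k x) \<longlonglongrightarrow> (\<Prod>i\<in>(UNIV::'a set). 1 * 1)"
    unfolding box_bump_def using True by (intro tendsto_intros lim) (auto simp: mem_box_vec)
  then show ?thesis using True by simp
qed (simp add: box_bump_eq_0)

lemma box_bump_test_function:
  assumes "cbox a b \<subseteq> U"
  shows "box_bump a b k \<in> test_functions U"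
proof -
  have "Ck l (box_bump a b k)" for l
  proof -
    have "Ck l (\<lambda>x. \<Prod>i\<in>UNIV. flat_exp (1 / Suc k) 0 (1 * x $ i + - a $ i) * flat_exp (1 / Suc k) 0 (- 1 * x $ i + b $ i))"
      by (intro Ck_prod Ck_mult Ck_flat_exp) auto
    moreover have "(\<lambda>x. \<Prod>i\<in>UNIV. flat_exp (1 / Suc k) 0 (1 * x $ i + - a $ i) * flat_exp (1 / Suc k) 0 (- 1 * x $ i + b $ i))
       = box_bump a b k"
      by (auto simp: box_bump_def)
    ultimately show ?thesis by simp
  qed
  moreover have "closure {x. box_bump a b k x \<noteq> 0} \<subseteq> cbox a b"
    using box_bump_eq_0 box_subset_cbox by (intro closure_minimal) fastforce+
  moreover from this have "bounded {x. box_bump a b k x \<noteq> 0}"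
    by (intro bounded_subset[OF bounded_cbox[of a b]]) (rule order_trans[OF closure_subset])
  ultimately show ?thesis using assms by (auto simp: test_functions_def compact_closure)
qed

text \<open>
  Open boxes are an intersection-stable generator of the Borel sets, so the integral over
  every Borel set vanishes.
\<close>

lemma AE_eq_0_if_box_integrals_eq_0:
  fixes f :: "'a::euclidean_space \<Rightarrow> real"
  assumes int: "integrable lebesgue f" and tot: "integral\<^sup>L lebesgue f = 0"
    and box: "\<And>a b. (LINT x|lebesgue. indicator (box a b) x * f x) = 0"
  shows "AE x in lebesgue. f x = 0"
proof -
  obtain g where g: "g \<in> borel_measurable lborel" "AE x in lborel. f x = g x"
    using completion_ex_borel_measurable_real[OF borel_measurable_integrable[OF int]] by auto
  have g': "AE x in lebesgue. f x = g x" using g(2) by (rule AE_completion)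
  have gm: "g \<in> borel_measurable lebesgue" using g(1) by (rule measurable_completion)
  have gi: "integrable lborel g"
  proof -
    have "integrable lebesgue g" by (rule integrable_cong_AE_imp[OF int gm]) (use g' in auto)
    then show ?thesis using integrable_completion[OF g(1)] by simp
  qed
  have eq: "(LINT x|lborel. indicator A x * g x) = (LINT x|lebesgue. indicator A x * f x)" if "A \<in> sets borel" for A
  proof -
    have "(LINT x|lborel. indicator A x * g x) = (LINT x|lebesgue. indicator A x * g x)"
      using that g by (subst integral_completion) auto
    also have "\<dots> = (LINT x|lebesgue. indicator A x * f x)"
      using that gm borel_measurable_integrable[OF int] g'
      by (intro integral_cong_AE borel_measurable_times borel_measurable_indicator) auto
    finally show ?thesis .
  qed
  have gsi: "set_integrable lborel A g" if "A \<in> sets borel" for A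
    unfolding set_integrable_def using that by (intro integrable_mult_indicator gi) auto
  have "AE x in lborel. g x = 0"
  proof (rule density_unique_real[OF gi integrable_zero])
    fix A :: "'a set" assume "A \<in> sets lborel"
    then have sig: "A \<in> sigma_sets UNIV (range (\<lambda>(a, b). box a b))"
      by (simp add: borel_eq_box)
    have stable: "Int_stable (range (\<lambda>(a, b). box a b) :: 'a set set)"
      by (auto simp: Int_stable_def box_Int_box)
    have sub: "range (\<lambda>(a, b). box a b) \<subseteq> Pow (UNIV :: 'a set)" by simp
    from stable sub sig have "set_lebesgue_integral lborel A g = 0"
    proof (induction rule: sigma_sets_induct_disjoint)
      case (basic A)
      then show ?case using eq[of A] box by (auto simp: set_lebesgue_integral_def)
    next
      case (compl A)
      then have A: "A \<in> sets borel" by (simp add: borel_eq_box)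
      have "set_lebesgue_integral lborel (A \<union> (UNIV - A)) g
          = set_lebesgue_integral lborel A g + set_lebesgue_integral lborel (UNIV - A) g"
        using A gsi by (intro set_integral_Un) auto
      moreover have "set_lebesgue_integral lborel (A \<union> (UNIV - A)) g = 0"
        using eq[of UNIV] tot by (simp add: set_lebesgue_integral_def)
      ultimately show ?case using compl by simp
    next
      case (union A)
      then have A: "A i \<in> sets borel" for i by (auto simp: borel_eq_box)
      have "set_lebesgue_integral lborel (\<Union>i. A i) g = (\<Sum>i. set_lebesgue_integral lborel (A i) g)"
      proof (rule lebesgue_integral_countable_add)
        show "set_integrable lborel (\<Union>i. A i) g"
          using A by (intro gsi) auto
      qed (use A union in \<open>auto simp: disjoint_family_on_def\<close>)
      then show ?case using union by simp
    qed (auto simp: set_lebesgue_integral_def)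
    then show "set_lebesgue_integral lborel A g = set_lebesgue_integral lborel A (\<lambda>_. 0)"
      by (simp add: set_lebesgue_integral_def)
  qed
  then have "AE x in lebesgue. g x = 0" by (rule AE_completion)
  then show ?thesis using g' by eventually_elim simp
qed

text \<open>
  Testing with \<open>box_bump\<close> shows that \<open>w\<close> has integral zero over each box whose closure lies in
  \<open>U\<close>, and countably many closed boxes cover \<open>U\<close>.
\<close>

lemma fundamental_lemma_of_calculus_of_variations:
  fixes w :: "real^'n::finite \<Rightarrow> real"
  assumes U: "open U" and w: "locally_integrable U w"
    and zero: "\<And>\<phi>. \<phi> \<in> test_functions U \<Longrightarrow> (LINT x|lebesgue_on U. w x * \<phi> x) = 0"
  shows "AE x in lebesgue_on U. w x = 0"
proof -
  have Us: "U \<in> sets lebesgue" using U by auto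
  have wi: "integrable lebesgue (\<lambda>x. indicator (cbox a b) x * w x)" if "cbox a b \<subseteq> U" for a b
    using w that by (auto simp: locally_integrable_def set_integrable_def)
  have box0: "(LINT x|lebesgue. indicator (box a b) x * w x) = 0" if ab: "cbox a b \<subseteq> U" for a b
  proof -
    note wm = borel_measurable_integrable[OF wi[OF ab]]
    have eq: "indicator U x *\<^sub>R (w x * box_bump a b k x) = (indicator (cbox a b) x * w x) * box_bump a b k x" for x k
      using ab box_subset_cbox[of a b] by (cases "x \<in> box a b") (auto simp: box_bump_eq_0 indicator_def)
    have "(\<lambda>k. LINT x|lebesgue. (indicator (cbox a b) x * w x) * box_bump a b k x)
        \<longlonglongrightarrow> (LINT x|lebesgue. (indicator (cbox a b) x * w x) * indicator (box a b) x)"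
    proof (rule integral_dominated_convergence)
      show "integrable lebesgue (\<lambda>x. \<bar>indicator (cbox a b) x * w x\<bar>)" using wi[OF ab] by simp
      have "continuous_on UNIV (box_bump a b k)" for k
        using C1_continuous(1)[OF test_function_C1[OF box_bump_test_function[OF ab]]] .
      then have "box_bump a b k \<in> borel_measurable lebesgue" for k
        by (intro measurable_completion) (auto intro: borel_measurable_continuous_onI)
      then show "(\<lambda>x. indicator (cbox a b) x * w x * box_bump a b k x) \<in> borel_measurable lebesgue" for k
        using wm by measurable
      show "AE x in lebesgue. norm (indicator (cbox a b) x * w x * box_bump a b k x) \<le> \<bar>indicator (cbox a b) x * w x\<bar>" for k
        using box_bump_bounds[of a b k] by (auto simp: abs_mult intro!: mult_left_le)
      show "(\<lambda>x. indicator (cbox a b) x * w x * indicator (box a b) x) \<in> borel_measurable lebesgue"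
        by (intro borel_measurable_times wm borel_measurable_indicator) auto
    qed (auto intro!: tendsto_intros box_bump_LIMSEQ)
    moreover have "(LINT x|lebesgue. (indicator (cbox a b) x * w x) * box_bump a b k x) = 0" for k
      using zero[OF box_bump_test_function[OF ab], of k] Us
      by (simp add: integral_restrict_space eq[symmetric])
    ultimately have "(LINT x|lebesgue. (indicator (cbox a b) x * w x) * indicator (box a b) x) = 0"
      by (simp add: LIMSEQ_const_iff)
    moreover have "(indicator (cbox a b) x * w x) * indicator (box a b) x = indicator (box a b) x * w x" for x
      using box_subset_cbox[of a b] by (auto simp: indicator_def)
    ultimately show ?thesis by simp
  qed
  have ae: "AE x in lebesgue. x \<in> cbox a b \<longrightarrow> w x = 0" if ab: "cbox a b \<subseteq> U" for a b
  proof -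
    have "AE x in lebesgue. indicator (box a b) x * w x = 0"
    proof (rule AE_eq_0_if_box_integrals_eq_0)
      have "integrable lebesgue (\<lambda>x. indicator (box a b) x *\<^sub>R (indicator (cbox a b) x * w x))"
        using wi[OF ab] by (intro integrable_mult_indicator) auto
      moreover have "indicator (box a b) x *\<^sub>R (indicator (cbox a b) x * w x) = indicator (box a b) x * w x" for x
        using box_subset_cbox[of a b] by (auto simp: indicator_def)
      ultimately show "integrable lebesgue (\<lambda>x. indicator (box a b) x * w x)" by (simp only:)
      show "(LINT x|lebesgue. indicator (box a b) x * w x) = 0" by (rule box0[OF ab])
      fix c d :: "real^'n"
      obtain u v where uv: "box c d \<inter> box a b = box u v" "cbox c d \<inter> cbox a b = cbox u v"
        by (rule that[OF box_Int_box Int_interval])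
      have "(LINT x|lebesgue. indicator (box u v) x * w x) = 0"
        by (rule box0) (use uv ab in auto)
      then show "(LINT x|lebesgue. indicator (box c d) x * (indicator (box a b) x * w x)) = 0"
        unfolding uv(1)[symmetric] by (simp add: indicator_inter_arith mult.assoc)
    qed
    moreover have "AE x in lebesgue. x \<notin> cbox a b - box a b"
    proof -
      have "negligible (cbox a b - box a b)" by (rule negligible_frontier_interval)
      then show ?thesis by (intro AE_not_in) (simp add: negligible_iff_null_sets)
    qed
    ultimately show ?thesis by eventually_elim (auto simp: indicator_def split: if_splits)
  qed
  obtain \<D> where D: "countable \<D>" "\<D> \<subseteq> Pow U" "\<And>X. X \<in> \<D> \<Longrightarrow> \<exists>a b. X = cbox a b" "\<Union>\<D> = U"
    using open_countable_Union_open_cbox[OF U] by metis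
  have "AE x in lebesgue. \<forall>X\<in>\<D>. x \<in> X \<longrightarrow> w x = 0"
    using D ae by (subst AE_ball_countable) (auto, blast)
  then have "AE x in lebesgue. x \<in> U \<longrightarrow> w x = 0"
    using D(4) by (auto elim!: eventually_mono)
  then show ?thesis using Us by (simp add: AE_restrict_space_iff)
qed

lemma locally_integrable_diff:
  fixes f g :: "real^'n::finite \<Rightarrow> 'b::euclidean_space"
  shows "locally_integrable U f \<Longrightarrow> locally_integrable U g \<Longrightarrow> locally_integrable U (\<lambda>x. f x - g x)"
  by (simp add: locally_integrable_def set_integral_diff)

lemma locally_integrable_mult_test_function:
  fixes f :: "real^'n::finite \<Rightarrow> real"
  assumes "open U" "locally_integrable U f" "\<phi> \<in> test_functions U"
  shows "integrable (lebesgue_on U) (\<lambda>x. f x * \<phi> x)"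
    and "integrable (lebesgue_on U) (\<lambda>x. f x * partial_deriv i \<phi> x)"
proof -
  obtain K where K: "compact K" "K \<subseteq> U" "\<And>x. x \<notin> K \<Longrightarrow> \<phi> x = 0" "\<And>x. x \<notin> K \<Longrightarrow> grad \<phi> x = 0"
    using test_function_support[OF assms(3)] by blast
  have K': "partial_deriv i \<phi> x = 0" if "x \<notin> K" for x
    using K(4)[OF that] by (metis grad_nth zero_index)
  have Us: "U \<in> sets lebesgue" using assms(1) by auto
  have fi: "integrable lebesgue (\<lambda>x. indicator K x * f x)"
    using assms(2) K by (auto simp: locally_integrable_def set_integrable_def)
  have main: "integrable (lebesgue_on U) (\<lambda>x. f x * g x)"
    if g: "continuous_on UNIV g" "\<And>x. x \<notin> K \<Longrightarrow> g x = 0" for g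
  proof -
    obtain B where B: "\<And>x. x \<in> K \<Longrightarrow> \<bar>g x\<bar> \<le> B"
      using compact_imp_bounded[OF compact_continuous_image[OF continuous_on_subset[OF g(1) subset_UNIV] K(1)]]
      by (auto simp: bounded_iff)
    have gm: "g \<in> borel_measurable lebesgue"
      using g(1) by (intro measurable_completion) (auto intro: borel_measurable_continuous_onI)
    have "integrable lebesgue (\<lambda>x. (indicator K x * f x) * g x)"
    proof (rule Bochner_Integration.integrable_bound)
      show "integrable lebesgue (\<lambda>x. B * (indicator K x * f x))" using fi by simp
      show "(\<lambda>x. indicator K x * f x * g x) \<in> borel_measurable lebesgue"
        using gm borel_measurable_integrable[OF fi] by measurable
      show "AE x in lebesgue. norm (indicator K x * f x * g x) \<le> norm (B * (indicator K x * f x))"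
      proof (intro AE_I2)
        fix x
        show "norm (indicator K x * f x * g x) \<le> norm (B * (indicator K x * f x))"
        proof (cases "x \<in> K")
          case True
          then have "\<bar>f x\<bar> * \<bar>g x\<bar> \<le> \<bar>f x\<bar> * \<bar>B\<bar>" using B[of x] by (intro mult_left_mono) auto
          then show ?thesis using True by (simp add: abs_mult mult.commute)
        qed simp
      qed
    qed
    moreover have "(indicator K x * f x) * g x = indicator U x *\<^sub>R (f x * g x)" for x
      using g(2)[of x] K(2) by (auto simp: indicator_def)
    ultimately show ?thesis using Us by (simp add: integrable_restrict_space)
  qed
  note C = C1_continuous[OF test_function_C1[OF assms(3)]]
  show "integrable (lebesgue_on U) (\<lambda>x. f x * \<phi> x)" using K C by (intro main) auto
  show "integrable (lebesgue_on U) (\<lambda>x. f x * partial_deriv i \<phi> x)" using K' C by (intro main) auto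
qed

lemma locally_integrable_nth:
  fixes G :: "real^'n::finite \<Rightarrow> real^'m::finite"
  assumes "locally_integrable U G"
  shows "locally_integrable U (\<lambda>x. G x $ i)"
  using assms unfolding locally_integrable_def set_integrable_def
  by (auto dest!: integrable_bounded_linear[OF bounded_linear_vec_nth[of i]])

text \<open>
  This makes the choice in the definition of \<open>weak_gradient\<close> harmless.
\<close>

lemma has_weak_gradient_unique:
  assumes U: "open U" and G: "has_weak_gradient U u G" and H: "has_weak_gradient U u H"
  shows "AE x in lebesgue_on U. G x = H x"
proof -
  have li: "locally_integrable U (\<lambda>x. G x $ i)" "locally_integrable U (\<lambda>x. H x $ i)" for i
    using G H locally_integrable_nth unfolding has_weak_gradient_def by blast+
  have "AE x in lebesgue_on U. G x $ i - H x $ i = 0" for i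
  proof (rule fundamental_lemma_of_calculus_of_variations[OF U])
    show "locally_integrable U (\<lambda>x. G x $ i - H x $ i)" by (intro locally_integrable_diff li)
    fix \<phi> assume \<phi>: "\<phi> \<in> test_functions U"
    have "(LINT x|lebesgue_on U. u x * partial_deriv i \<phi> x) = - (LINT x|lebesgue_on U. G x $ i * \<phi> x)"
      "(LINT x|lebesgue_on U. u x * partial_deriv i \<phi> x) = - (LINT x|lebesgue_on U. H x $ i * \<phi> x)"
      using G H \<phi> unfolding has_weak_gradient_def by blast+
    then have "(LINT x|lebesgue_on U. G x $ i * \<phi> x) = (LINT x|lebesgue_on U. H x $ i * \<phi> x)"
      by linarith
    then show "(LINT x|lebesgue_on U. (G x $ i - H x $ i) * \<phi> x) = 0"
      using locally_integrable_mult_test_function(1)[OF U li(1) \<phi>] locally_integrable_mult_test_function(1)[OF U li(2) \<phi>]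
      by (simp add: left_diff_distrib)
  qed
  then have "AE x in lebesgue_on U. \<forall>i. G x $ i - H x $ i = 0" by (subst AE_all_countable) auto
  then show ?thesis by eventually_elim (simp add: vec_eq_iff)
qed

section \<open>The Lebesgue spaces\<close>

text \<open>
  The \<open>p\<close>-th power of the \<open>L\<^sup>p\<close> norm. Powers are easier to add and integrate than norms, and
  the estimates below allow constant factors.
\<close>

definition p_mass :: "(real^'n::finite) set \<Rightarrow> real \<Rightarrow> (real^'n \<Rightarrow> 'b::euclidean_space) \<Rightarrow> real" where
  "p_mass U p f = (LINT x|lebesgue_on U. norm (f x) powr p)"

lemma p_mass_nonneg: "0 \<le> p_mass U p f"
  unfolding p_mass_def by (intro Bochner_Integration.integral_nonneg) simp

lemma Lp_spaceD:
  assumes "f \<in> Lp_space U p"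
  shows "f \<in> borel_measurable (lebesgue_on U)" "integrable (lebesgue_on U) (\<lambda>x. norm (f x) powr p)"
  using assms by (auto simp: Lp_space_def)

lemma Lp_space_bound:
  fixes f :: "real^'n::finite \<Rightarrow> 'b::euclidean_space"
  assumes "f \<in> borel_measurable (lebesgue_on U)" "integrable (lebesgue_on U) g"
    "AE x in lebesgue_on U. norm (f x) powr p \<le> g x"
  shows "f \<in> Lp_space U p" "p_mass U p f \<le> integral\<^sup>L (lebesgue_on U) g"
proof -
  have i: "integrable (lebesgue_on U) (\<lambda>x. norm (f x) powr p)"
    by (rule Bochner_Integration.integrable_bound[OF assms(2)])
       (use assms in \<open>auto elim!: eventually_mono\<close>)
  then show "f \<in> Lp_space U p" using assms by (simp add: Lp_space_def)
  show "p_mass U p f \<le> integral\<^sup>L (lebesgue_on U) g"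
    unfolding p_mass_def using i assms by (intro integral_mono_AE) auto
qed

lemma Lp_space_AE_cong:
  assumes "f \<in> Lp_space U p" "g \<in> borel_measurable (lebesgue_on U)" "AE x in lebesgue_on U. g x = f x"
  shows "g \<in> Lp_space U p"
  using assms(3) by (intro Lp_space_bound(1)[OF assms(2) Lp_spaceD(2)[OF assms(1)]]) (auto elim!: eventually_mono)

lemma p_mass_AE_cong:
  assumes "f \<in> borel_measurable (lebesgue_on U)" "g \<in> borel_measurable (lebesgue_on U)"
    "AE x in lebesgue_on U. g x = f x"
  shows "p_mass U p g = p_mass U p f"
  unfolding p_mass_def using assms by (intro integral_cong_AE) (auto elim!: eventually_mono)

lemma Lp_add:
  assumes "0 \<le> p" "f \<in> Lp_space U p" "g \<in> Lp_space U p"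
  shows "(\<lambda>x. f x + g x) \<in> Lp_space U p"
    and "p_mass U p (\<lambda>x. f x + g x) \<le> 2 powr p * (p_mass U p f + p_mass U p g)"
proof -
  note D = Lp_spaceD[OF assms(2)] Lp_spaceD[OF assms(3)]
  have int: "integrable (lebesgue_on U) (\<lambda>x. 2 powr p * (norm (f x) powr p + norm (g x) powr p))"
    using D by simp
  have m: "(\<lambda>x. f x + g x) \<in> borel_measurable (lebesgue_on U)" using D by simp
  have b: "AE x in lebesgue_on U. norm (f x + g x) powr p \<le> 2 powr p * (norm (f x) powr p + norm (g x) powr p)"
    by (intro AE_I2 norm_add_powr_le assms)
  show "(\<lambda>x. f x + g x) \<in> Lp_space U p" by (rule Lp_space_bound(1)[OF m int b])
  show "p_mass U p (\<lambda>x. f x + g x) \<le> 2 powr p * (p_mass U p f + p_mass U p g)"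
    using Lp_space_bound(2)[OF m int b] D by (simp add: p_mass_def)
qed

lemma Lp_scaleR:
  assumes "f \<in> Lp_space U p"
  shows "(\<lambda>x. c *\<^sub>R f x) \<in> Lp_space U p" "p_mass U p (\<lambda>x. c *\<^sub>R f x) = \<bar>c\<bar> powr p * p_mass U p f"
  using Lp_spaceD[OF assms] by (auto simp: Lp_space_def p_mass_def powr_mult)

lemma Lp_diff:
  assumes "0 \<le> p" "f \<in> Lp_space U p" "g \<in> Lp_space U p"
  shows "(\<lambda>x. f x - g x) \<in> Lp_space U p"
    and "p_mass U p (\<lambda>x. f x - g x) \<le> 2 powr p * (p_mass U p f + p_mass U p g)"
  using Lp_add[OF assms(1,2) Lp_scaleR(1)[OF assms(3), of "-1"]] Lp_scaleR(2)[OF assms(3), of "-1"] by simp_all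

text \<open>
  Hoelder's inequality for the pairing of \<open>|f|\<^sup>p\<^sup>-\<^sup>2 f\<close> with \<open>g\<close>, in the form that Young's
  inequality gives pointwise; the free parameter \<open>e\<close> balances the two masses.
\<close>

lemma Lp_flux_integrable:
  fixes f g :: "real^'n::finite \<Rightarrow> 'b::euclidean_space"
  assumes p: "1 < p" and f: "f \<in> Lp_space U p" and g: "g \<in> Lp_space U p"
    and s: "s \<in> borel_measurable (lebesgue_on U)" "AE x in lebesgue_on U. \<bar>s x\<bar> \<le> M"
  shows "integrable (lebesgue_on U) (\<lambda>x. s x * norm (f x) powr (p - 2) * (f x \<bullet> g x))"
    and "0 < e \<Longrightarrow> \<bar>LINT x|lebesgue_on U. s x * norm (f x) powr (p - 2) * (f x \<bullet> g x)\<bar>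
           \<le> M * (e * p_mass U p f + e powr (1 - p) * p_mass U p g)"
proof -
  note D = Lp_spaceD[OF f] Lp_spaceD[OF g]
  let ?I = "\<lambda>x. s x * norm (f x) powr (p - 2) * (f x \<bullet> g x)"
  let ?B = "\<lambda>e x. M * (e * norm (f x) powr p + e powr (1 - p) * norm (g x) powr p)"
  have m: "?I \<in> borel_measurable (lebesgue_on U)" using D s by measurable
  have int: "integrable (lebesgue_on U) (?B e)" for e using D by simp
  have bound: "AE x in lebesgue_on U. \<bar>?I x\<bar> \<le> ?B e x" if "0 < e" for e
    using s(2)
  proof eventually_elim
    case (elim x)
    have "\<bar>norm (f x) powr (p - 2) * (f x \<bullet> g x)\<bar> = \<bar>(norm (f x) powr (p - 2) *\<^sub>R f x) \<bullet> g x\<bar>" by simp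
    also have "\<dots> \<le> norm (norm (f x) powr (p - 2) *\<^sub>R f x) * norm (g x)" by (rule Cauchy_Schwarz_ineq2)
    also have "\<dots> = norm (f x) powr (p - 1) * norm (g x)" unfolding norm_powr_p_flux(2)[OF p] ..
    also have "\<dots> \<le> e * norm (f x) powr p + e powr (1 - p) * norm (g x) powr p"
      by (rule young_powr[OF p _ _ that]) auto
    finally have *: "\<bar>norm (f x) powr (p - 2) * (f x \<bullet> g x)\<bar> \<le> \<dots>" .
    have "\<bar>?I x\<bar> = \<bar>s x\<bar> * \<bar>norm (f x) powr (p - 2) * (f x \<bullet> g x)\<bar>" by (simp add: abs_mult mult.assoc)
    also have "\<dots> \<le> M * (e * norm (f x) powr p + e powr (1 - p) * norm (g x) powr p)"
      using elim by (intro mult_mono *) auto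
    finally show ?case .
  qed
  show I: "integrable (lebesgue_on U) ?I"
  proof (rule Bochner_Integration.integrable_bound[OF int[of 1] m])
    show "AE x in lebesgue_on U. norm (?I x) \<le> norm (?B 1 x)"
      using bound[of 1] by (auto elim!: eventually_mono)
  qed
  assume e: "0 < e"
  have "\<bar>integral\<^sup>L (lebesgue_on U) ?I\<bar> \<le> (LINT x|lebesgue_on U. \<bar>?I x\<bar>)"
    using integral_norm_bound[of "lebesgue_on U" ?I] by simp
  also have "\<dots> \<le> integral\<^sup>L (lebesgue_on U) (?B e)"
    by (intro integral_mono_AE integrable_abs I int bound[OF e])
  also have "\<dots> = M * (e * p_mass U p f + e powr (1 - p) * p_mass U p g)"
    using D by (simp add: p_mass_def)
  finally show "\<bar>integral\<^sup>L (lebesgue_on U) ?I\<bar> \<le> M * (e * p_mass U p f + e powr (1 - p) * p_mass U p g)" .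
qed

lemma Lp_imp_integrable:
  fixes f :: "real^'n::finite \<Rightarrow> 'b::euclidean_space"
  assumes p: "1 < p" and U: "U \<in> lmeasurable" and f: "f \<in> Lp_space U p"
  shows "integrable (lebesgue_on U) f"
    and "0 < e \<Longrightarrow> (LINT x|lebesgue_on U. norm (f x)) \<le> e * measure lebesgue U + e powr (1 - p) * p_mass U p f"
proof -
  interpret finite_measure "lebesgue_on U" using U by (rule finite_measure_lebesgue_on)
  note D = Lp_spaceD[OF f]
  have int: "integrable (lebesgue_on U) (\<lambda>x. e + e powr (1 - p) * norm (f x) powr p)" for e
    using D by simp
  show I: "integrable (lebesgue_on U) f"
    by (rule Bochner_Integration.integrable_bound[OF int[of 1] D(1)])
       (use L1_le_powr[OF p, of "norm (f _)" 1] in auto)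
  assume e: "0 < e"
  have "(LINT x|lebesgue_on U. norm (f x)) \<le> (LINT x|lebesgue_on U. e + e powr (1 - p) * norm (f x) powr p)"
    by (intro integral_mono int integrable_norm I L1_le_powr p e) auto
  also have "\<dots> = e * measure lebesgue U + e powr (1 - p) * p_mass U p f"
    using D U by (simp add: p_mass_def measure_restrict_space fmeasurableD)
  finally show "(LINT x|lebesgue_on U. norm (f x)) \<le> e * measure lebesgue U + e powr (1 - p) * p_mass U p f" .
qed

lemma Lp_imp_locally_integrable:
  fixes f :: "real^'n::finite \<Rightarrow> 'b::euclidean_space"
  assumes p: "1 < p" and U: "U \<in> lmeasurable" and f: "f \<in> Lp_space U p"
  shows "locally_integrable U f"
  unfolding locally_integrable_def
proof (intro allI impI)
  fix K assume K: "compact K \<and> K \<subseteq> U"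
  have "set_integrable lebesgue U f"
    using Lp_imp_integrable(1)[OF assms] U
    by (simp add: integrable_restrict_space set_integrable_def fmeasurableD)
  then show "f absolutely_integrable_on K"
    by (rule set_integrable_subset) (use K in \<open>auto dest: compact_imp_closed\<close>)
qed

lemma bounded_in_Lp:
  fixes f :: "real^'n::finite \<Rightarrow> 'b::euclidean_space"
  assumes "U \<in> lmeasurable" "f \<in> borel_measurable (lebesgue_on U)" "\<And>x. x \<in> U \<Longrightarrow> norm (f x) \<le> B" "0 \<le> p"
  shows "f \<in> Lp_space U p"
proof -
  interpret finite_measure "lebesgue_on U" using assms by (intro finite_measure_lebesgue_on)
  show ?thesis
    by (rule Lp_space_bound(1)[OF assms(2), of "\<lambda>_. B powr p"])
       (use assms in \<open>auto intro!: AE_I2 powr_mono2\<close>)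
qed

lemma continuous_in_Lp:
  fixes f :: "real^'n::finite \<Rightarrow> 'b::euclidean_space"
  assumes "bounded U" "open U" "continuous_on UNIV f" "0 \<le> p"
  shows "f \<in> Lp_space U p"
proof -
  have "compact (f ` closure U)"
    using assms by (intro compact_continuous_image continuous_on_subset[OF assms(3)]) auto
  then obtain B where B: "\<forall>x\<in>closure U. norm (f x) \<le> B"
    by (auto dest!: compact_imp_bounded simp: bounded_iff)
  have "f \<in> borel_measurable lebesgue"
    using assms(3) by (intro measurable_completion) (auto intro: borel_measurable_continuous_onI)
  then have "f \<in> borel_measurable (lebesgue_on U)" by (rule measurable_restrict_space1)
  then show ?thesis
    using assms B closure_subset[of U] by (intro bounded_in_Lp[of _ _ B] bounded_set_imp_lmeasurable) auto
qed

text \<open>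
  Along a subsequence, \<open>2\<^sup>k\<^sup>p |f (r (k + 1)) - f (r k)|\<^sup>p\<close> has a finite sum almost everywhere,
  because the integrals form a convergent series. The increments are then bounded by multiples
  of \<open>2\<^sup>-\<^sup>k\<close>, and the subsequence converges almost everywhere. Fatou's lemma turns this limit
  into the \<open>L\<^sup>p\<close> limit of the whole sequence.
\<close>

lemma Lp_complete:
  fixes f :: "nat \<Rightarrow> real^'n::finite \<Rightarrow> 'b::euclidean_space"
  assumes p: "1 < p" and f: "\<And>k. f k \<in> Lp_space U p"
    and cauchy: "\<And>e. 0 < e \<Longrightarrow> \<exists>N. \<forall>m\<ge>N. \<forall>n\<ge>N. p_mass U p (\<lambda>x. f m x - f n x) < e"
  shows "\<exists>g\<in>Lp_space U p. (\<lambda>k. p_mass U p (\<lambda>x. f k x - g x)) \<longlonglongrightarrow> 0"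
proof -
  let ?M = "lebesgue_on U"
  note fm[measurable] = Lp_spaceD(1)[OF f]
  have fd: "(\<lambda>x. f m x - f n x) \<in> Lp_space U p" for m n using p f by (intro Lp_diff) auto
  have nn: "(\<integral>\<^sup>+x. ennreal (norm (f m x - f n x) powr p) \<partial>?M) = ennreal (p_mass U p (\<lambda>x. f m x - f n x))" for m n
    unfolding p_mass_def using Lp_spaceD(2)[OF fd] by (intro nn_integral_eq_integral) auto
  define q where "q = 2 powr p"
  have q: "1 < q" using p unfolding q_def by (intro gr_one_powr) auto
  \<comment> \<open>Bounds by powers of \<open>1 / q\<^sup>2\<close> leave a geometric series after multiplication by the weights
    \<open>q ^ k\<close> in \<open>h\<close>, which in turn make the increments geometrically small.\<close>
  have "\<exists>N. \<forall>m\<ge>N. \<forall>n\<ge>N. p_mass U p (\<lambda>x. f m x - f n x) < (1 / q ^ 2) ^ k" for k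
    using q by (intro cauchy) simp
  then obtain N where N: "\<And>k m n. N k \<le> m \<Longrightarrow> N k \<le> n \<Longrightarrow> p_mass U p (\<lambda>x. f m x - f n x) < (1 / q ^ 2) ^ k"
    by metis
  \<comment> \<open>The sum makes \<open>r\<close> monotone, so that both \<open>r k\<close> and \<open>r (Suc k)\<close> lie beyond \<open>N k\<close>.\<close>
  define r where "r = (\<lambda>k. (\<Sum>j\<le>k. N j) + k)"
  have rN: "N k \<le> r k" "N k \<le> r (Suc k)" for k
    using member_le_sum[of k "{..k}" N] by (auto simp: r_def)
  define h where "h = (\<lambda>k x. q ^ k * norm (f (r (Suc k)) x - f (r k) x) powr p)"
  have hm[measurable]: "h k \<in> borel_measurable ?M" for k unfolding h_def by measurable
  have "(\<integral>\<^sup>+x. (\<Sum>k. ennreal (h k x)) \<partial>?M) = (\<Sum>k. \<integral>\<^sup>+x. ennreal (h k x) \<partial>?M)"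
    by (rule nn_integral_suminf) measurable
  also have "\<dots> \<le> (\<Sum>k. ennreal ((1 / q) ^ k))"
  proof (rule suminf_le)
    fix k
    have "(\<integral>\<^sup>+x. ennreal (h k x) \<partial>?M) = ennreal (q ^ k) * (\<integral>\<^sup>+x. ennreal (norm (f (r (Suc k)) x - f (r k) x) powr p) \<partial>?M)"
      unfolding h_def using q by (subst nn_integral_cmult[symmetric]) (auto simp: ennreal_mult)
    also have "\<dots> = ennreal (q ^ k * p_mass U p (\<lambda>x. f (r (Suc k)) x - f (r k) x))"
      unfolding nn using q p_mass_nonneg by (subst ennreal_mult) auto
    also have "\<dots> \<le> ennreal ((1 / q) ^ k)"
    proof (rule ennreal_leI)
      have "q ^ k * p_mass U p (\<lambda>x. f (r (Suc k)) x - f (r k) x) \<le> q ^ k * (1 / q ^ 2) ^ k"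
        using N[of k "r (Suc k)" "r k"] rN q by (intro mult_left_mono) auto
      also have "\<dots> = (q * (1 / q ^ 2)) ^ k" by (simp only: power_mult_distrib)
      also have "q * (1 / q ^ 2) = 1 / q" using q by (simp add: power2_eq_square)
      finally show "q ^ k * p_mass U p (\<lambda>x. f (r (Suc k)) x - f (r k) x) \<le> (1 / q) ^ k" .
    qed
    finally show "(\<integral>\<^sup>+x. ennreal (h k x) \<partial>?M) \<le> ennreal ((1 / q) ^ k)" .
  qed auto
  also have "\<dots> < \<infinity>"
  proof -
    have "summable (\<lambda>k. (1 / q) ^ k)" using q by (intro summable_geometric) auto
    then have "(\<Sum>k. ennreal ((1 / q) ^ k)) = ennreal (\<Sum>k. (1 / q) ^ k)"
      using q by (intro suminf_ennreal2) auto
    then show ?thesis by simp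
  qed
  finally have fin: "(\<integral>\<^sup>+x. (\<Sum>k. ennreal (h k x)) \<partial>?M) \<noteq> \<infinity>" by simp
  have "AE x in ?M. (\<Sum>k. ennreal (h k x)) \<noteq> \<infinity>"
    by (rule nn_integral_PInf_AE[OF _ fin]) measurable
  then have conv: "AE x in ?M. convergent (\<lambda>k. f (r k) x)"
  proof eventually_elim
    case (elim x)
    define S where "S = enn2real (\<Sum>k. ennreal (h k x))"
    have hS: "h k x \<le> S" for k
    proof -
      have "ennreal (h k x) \<le> (\<Sum>k. ennreal (h k x))"
        using sum_le_suminf[of "\<lambda>k. ennreal (h k x)" "{k}"] by auto
      also have "\<dots> = ennreal S" unfolding S_def using elim by (simp add: ennreal_enn2real less_top)
      finally show ?thesis by (simp add: S_def)
    qed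
    have diff: "norm (f (r (Suc k)) x - f (r k) x) \<le> S powr (1 / p) * (1 / 2) ^ k" for k
    proof -
      let ?d = "norm (f (r (Suc k)) x - f (r k) x)"
      have qk: "q ^ k = (2 ^ k) powr p" by (simp add: q_def powr_powr powr_realpow[symmetric] mult.commute)
      have "(2 ^ k * ?d) powr p \<le> S" using hS[of k] by (simp add: h_def qk powr_mult)
      then have "((2 ^ k * ?d) powr p) powr (1 / p) \<le> S powr (1 / p)"
        using p by (intro powr_mono2) auto
      then have "2 ^ k * ?d \<le> S powr (1 / p)" using p by (simp add: powr_powr)
      then show ?thesis by (simp add: field_simps)
    qed
    have "summable (\<lambda>k. f (r (Suc k)) x - f (r k) x)"
      by (rule summable_comparison_test'[where N = 0 and g = "\<lambda>k. S powr (1 / p) * (1 / 2) ^ k"])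
         (use diff in \<open>auto intro!: summable_mult summable_geometric\<close>)
    then have "(\<lambda>n. \<Sum>k<n. f (r (Suc k)) x - f (r k) x) \<longlonglongrightarrow> (\<Sum>k. f (r (Suc k)) x - f (r k) x)"
      by (rule summable_LIMSEQ)
    then have "(\<lambda>n. f (r n) x - f (r 0) x) \<longlonglongrightarrow> (\<Sum>k. f (r (Suc k)) x - f (r k) x)"
      by (simp add: sum_lessThan_telescope[of "\<lambda>k. f (r k) x"])
    then have "(\<lambda>n. (f (r n) x - f (r 0) x) + f (r 0) x) \<longlonglongrightarrow> (\<Sum>k. f (r (Suc k)) x - f (r k) x) + f (r 0) x"
      by (intro tendsto_add tendsto_const)
    then show ?case by (auto simp: convergent_def)
  qed
  define g where "g = (\<lambda>x. lim (\<lambda>k. f (r k) x))"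
  have gm[measurable]: "g \<in> borel_measurable ?M"
    unfolding g_def by (rule borel_measurable_lim_metric) measurable
  have bound: "(\<integral>\<^sup>+x. ennreal (norm (f m x - g x) powr p) \<partial>?M) \<le> ennreal e"
    if m: "\<And>n. n \<ge> L \<Longrightarrow> p_mass U p (\<lambda>x. f m x - f n x) \<le> e" for m L e
  proof -
    have "(\<integral>\<^sup>+x. ennreal (norm (f m x - g x) powr p) \<partial>?M)
        = (\<integral>\<^sup>+x. liminf (\<lambda>k. ennreal (norm (f m x - f (r k) x) powr p)) \<partial>?M)"
    proof (rule nn_integral_cong_AE)
      show "AE x in ?M. ennreal (norm (f m x - g x) powr p) = liminf (\<lambda>k. ennreal (norm (f m x - f (r k) x) powr p))"
        using conv
      proof eventually_elim
        case (elim x)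
        then have "(\<lambda>k. f (r k) x) \<longlonglongrightarrow> g x" by (simp add: g_def convergent_LIMSEQ_iff)
        then have "(\<lambda>k. ennreal (norm (f m x - f (r k) x) powr p)) \<longlonglongrightarrow> ennreal (norm (f m x - g x) powr p)"
          using p by (intro tendsto_intros tendsto_powr') auto
        then show ?case by (rule lim_imp_Liminf[OF trivial_limit_sequentially, symmetric])
      qed
    qed
    also have "\<dots> \<le> liminf (\<lambda>k. \<integral>\<^sup>+x. ennreal (norm (f m x - f (r k) x) powr p) \<partial>?M)"
      by (rule nn_integral_liminf) measurable
    also have "\<dots> \<le> limsup (\<lambda>k. \<integral>\<^sup>+x. ennreal (norm (f m x - f (r k) x) powr p) \<partial>?M)"
      by (rule Liminf_le_Limsup) simp
    also have "\<dots> \<le> ennreal e"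
    proof (rule Limsup_bounded)
      show "\<forall>\<^sub>F k in sequentially. (\<integral>\<^sup>+x. ennreal (norm (f m x - f (r k) x) powr p) \<partial>?M) \<le> ennreal e"
        using eventually_ge_at_top[of L]
      proof eventually_elim
        case (elim k)
        have "L \<le> r k" using elim by (simp add: r_def)
        then show ?case unfolding nn using m by (intro ennreal_leI) auto
      qed
    qed
    finally show ?thesis .
  qed
  have dm: "(\<lambda>x. f m x - g x) \<in> Lp_space U p \<and> p_mass U p (\<lambda>x. f m x - g x) \<le> e"
    if "\<And>n. n \<ge> L \<Longrightarrow> p_mass U p (\<lambda>x. f m x - f n x) \<le> e" "0 \<le> e" for m L e
  proof -
    have b: "(\<integral>\<^sup>+x. ennreal (norm (f m x - g x) powr p) \<partial>?M) \<le> ennreal e" by (rule bound[OF that(1)])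
    have I: "integrable ?M (\<lambda>x. norm (f m x - g x) powr p)"
      by (rule integrableI_bounded) (use b in \<open>auto intro: le_less_trans\<close>)
    have "ennreal (p_mass U p (\<lambda>x. f m x - g x)) \<le> ennreal e"
      unfolding p_mass_def using b nn_integral_eq_integral[OF I] by simp
    then show ?thesis using I that(2) by (auto simp: Lp_space_def ennreal_le_iff)
  qed
  have lim: "\<exists>L. \<forall>m\<ge>L. (\<lambda>x. f m x - g x) \<in> Lp_space U p \<and> p_mass U p (\<lambda>x. f m x - g x) \<le> e" if e: "0 < e" for e
  proof -
    obtain L where "\<forall>m\<ge>L. \<forall>n\<ge>L. p_mass U p (\<lambda>x. f m x - f n x) < e" using cauchy[OF e] by blast
    then have L: "p_mass U p (\<lambda>x. f m x - f n x) \<le> e" if "L \<le> m" "L \<le> n" for m n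
      using that less_imp_le by blast
    show ?thesis
    proof (intro exI[of _ L] allI impI)
      fix m assume "L \<le> m"
      then show "(\<lambda>x. f m x - g x) \<in> Lp_space U p \<and> p_mass U p (\<lambda>x. f m x - g x) \<le> e"
        by (intro dm[of L] L) (use e in auto)
    qed
  qed
  obtain m where "(\<lambda>x. f m x - g x) \<in> Lp_space U p" using lim[of 1] by auto
  from Lp_diff(1)[OF _ f[of m] this] p have "g \<in> Lp_space U p" by simp
  moreover have "(\<lambda>k. p_mass U p (\<lambda>x. f k x - g x)) \<longlonglongrightarrow> 0"
  proof (rule LIMSEQ_I)
    fix e :: real assume "0 < e"
    then obtain L where "\<forall>m\<ge>L. p_mass U p (\<lambda>x. f m x - g x) \<le> e / 2" using lim[of "e / 2"] by auto
    then have "norm (p_mass U p (\<lambda>x. f n x - g x) - 0) < e" if "L \<le> n" for n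
      using that \<open>0 < e\<close> p_mass_nonneg[of U p "\<lambda>x. f n x - g x"] by force
    then show "\<exists>no. \<forall>n\<ge>no. norm (p_mass U p (\<lambda>x. f n x - g x) - 0) < e" by blast
  qed
  ultimately show ?thesis by blast
qed

section \<open>Sobolev functions on a bounded open set\<close>

lemma continuous_on_p_flux:
  assumes "1 < p"
  shows "continuous_on UNIV (\<lambda>b::'b::real_normed_vector. norm b powr (p - 2) *\<^sub>R b)"
proof (intro continuous_at_imp_continuous_on ballI)
  fix b :: 'b
  show "isCont (\<lambda>b::'b. norm b powr (p - 2) *\<^sub>R b) b"
  proof (cases "b = 0")
    case True
    have eq: "norm (norm x powr (p - 2) *\<^sub>R x) = norm x powr (p - 1)" for x :: 'b
      using powr_mult_base[of "norm x" "p - 2"] by (simp add: mult.commute)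
    have "((\<lambda>x::'b. norm x powr (p - 1)) \<longlongrightarrow> norm (0::'b) powr (p - 1)) (at 0)"
      using assms by (intro tendsto_powr' tendsto_intros) auto
    then have "((\<lambda>x::'b. norm (norm x powr (p - 2) *\<^sub>R x)) \<longlongrightarrow> 0) (at 0)"
      unfolding eq by simp
    then have "((\<lambda>x::'b. norm x powr (p - 2) *\<^sub>R x) \<longlongrightarrow> 0) (at 0)" by (rule tendsto_norm_zero_cancel)
    then show ?thesis using True by (simp add: isCont_def)
  next
    case False
    then show ?thesis unfolding isCont_def
      by (intro tendsto_scaleR tendsto_powr tendsto_norm tendsto_ident_at tendsto_const) simp
  qed
qed

lemma abs_powr_has_real_derivative:
  fixes t p :: real
  assumes "1 < p"
  shows "((\<lambda>t. \<bar>t\<bar> powr p) has_real_derivative p * (\<bar>t\<bar> powr (p - 2) * t)) (at t)"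
proof -
  have mb: "s powr (p - 1) = s powr (p - 2) * s" if "0 < s" for s :: real
    using powr_mult_base[of s "p - 2"] that by (simp add: mult.commute)
  consider "0 < t" | "t < 0" | "t = 0" by linarith
  then show ?thesis
  proof cases
    case 1
    have "((\<lambda>t. t powr p) has_real_derivative p * t powr (p - 1)) (at t)"
      using 1 by (intro has_real_derivative_powr)
    then have "((\<lambda>t. \<bar>t\<bar> powr p) has_real_derivative p * t powr (p - 1)) (at t)"
      by (rule has_field_derivative_transform_within_open[where S = "{0<..}"]) (use 1 in auto)
    then show ?thesis using 1 mb[of t] by simp
  next
    case 2
    have "((\<lambda>t. (- t) powr p) has_real_derivative (p * (- t) powr (p - 1)) * (- 1)) (at t)"
      using 2 by (intro DERIV_chain2[OF has_real_derivative_powr]) (auto intro!: derivative_eq_intros)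
    then have "((\<lambda>t. \<bar>t\<bar> powr p) has_real_derivative (p * (- t) powr (p - 1)) * (- 1)) (at t)"
      by (rule has_field_derivative_transform_within_open[where S = "{..<0}"]) (use 2 in auto)
    then show ?thesis using 2 mb[of "- t"] by simp
  next
    case 3
    have "((\<lambda>h::real. \<bar>h\<bar> powr (p - 1)) \<longlongrightarrow> \<bar>0\<bar> powr (p - 1)) (at 0)"
      using assms by (intro tendsto_powr' tendsto_intros) auto
    moreover have "norm (\<bar>h\<bar> powr p / h) = \<bar>h\<bar> powr (p - 1)" if "h \<noteq> 0" for h :: real
      using powr_mult_base[of "\<bar>h\<bar>" "p - 1"] that by (simp add: field_simps abs_mult)
    then have "\<forall>\<^sub>F h in at 0. \<bar>h\<bar> powr (p - 1) = norm (\<bar>h\<bar> powr p / h)" for h :: real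
      by (auto simp: eventually_at_filter)
    ultimately have "((\<lambda>h::real. norm (\<bar>h\<bar> powr p / h)) \<longlongrightarrow> 0) (at 0)"
      by (simp add: Lim_transform_eventually)
    then have "((\<lambda>h::real. \<bar>h\<bar> powr p / h) \<longlongrightarrow> 0) (at 0)" by (rule tendsto_norm_zero_cancel)
    then show ?thesis using 3 assms by (simp add: has_field_derivative_iff)
  qed
qed

lemma locally_integrable_add:
  fixes f g :: "real^'n::finite \<Rightarrow> 'b::euclidean_space"
  shows "locally_integrable U f \<Longrightarrow> locally_integrable U g \<Longrightarrow> locally_integrable U (\<lambda>x. f x + g x)"
  by (simp add: locally_integrable_def set_integral_add)

lemma locally_integrable_scaleR:
  fixes f :: "real^'n::finite \<Rightarrow> 'b::euclidean_space"
  shows "locally_integrable U f \<Longrightarrow> locally_integrable U (\<lambda>x. c *\<^sub>R f x)"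
  by (simp add: locally_integrable_def)

lemma has_weak_gradient_lincomb:
  assumes U: "open U" and u: "has_weak_gradient U u G" and v: "has_weak_gradient U v H"
  shows "has_weak_gradient U (\<lambda>x. u x + c * v x) (\<lambda>x. G x + c *\<^sub>R H x)"
  unfolding has_weak_gradient_def
proof (intro conjI ballI allI)
  note u' = u[unfolded has_weak_gradient_def] and v' = v[unfolded has_weak_gradient_def]
  show "locally_integrable U (\<lambda>x. u x + c * v x)"
    using u' v' locally_integrable_scaleR[of U v c] by (intro locally_integrable_add) auto
  show "locally_integrable U (\<lambda>x. G x + c *\<^sub>R H x)"
    using u' v' by (intro locally_integrable_add locally_integrable_scaleR) auto
  fix \<phi> i assume \<phi>: "\<phi> \<in> test_functions U"
  note I = locally_integrable_mult_test_function[OF U _ \<phi>]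
  have int: "integrable (lebesgue_on U) (\<lambda>x. u x * partial_deriv i \<phi> x)"
    "integrable (lebesgue_on U) (\<lambda>x. v x * partial_deriv i \<phi> x)"
    "integrable (lebesgue_on U) (\<lambda>x. G x $ i * \<phi> x)"
    "integrable (lebesgue_on U) (\<lambda>x. H x $ i * \<phi> x)"
    using u' v' I locally_integrable_nth by blast+
  have "(LINT x|lebesgue_on U. (u x + c * v x) * partial_deriv i \<phi> x) =
      (LINT x|lebesgue_on U. u x * partial_deriv i \<phi> x) + c * (LINT x|lebesgue_on U. v x * partial_deriv i \<phi> x)"
    using int by (simp add: distrib_right mult.assoc)
  also have "\<dots> = - (LINT x|lebesgue_on U. G x $ i * \<phi> x) + c * - (LINT x|lebesgue_on U. H x $ i * \<phi> x)"
    using u' v' \<phi> by simp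
  also have "\<dots> = - (LINT x|lebesgue_on U. (G x + c *\<^sub>R H x) $ i * \<phi> x)"
    using int by (simp add: distrib_right mult.assoc)
  finally show "(LINT x|lebesgue_on U. (u x + c * v x) * partial_deriv i \<phi> x) =
     - (LINT x|lebesgue_on U. (G x + c *\<^sub>R H x) $ i * \<phi> x)" .
qed

text \<open>
  On an open set, \<open>f\<close> is the pointwise limit of its restrictions to finite unions of closed
  boxes.
\<close>

lemma locally_integrable_imp_measurable:
  fixes f :: "real^'n::finite \<Rightarrow> 'b::euclidean_space"
  assumes U: "open U" and f: "locally_integrable U f"
  shows "f \<in> borel_measurable (lebesgue_on U)"
proof (cases "U = {}")
  case False
  obtain \<D> where D: "countable \<D>" "\<D> \<subseteq> Pow U" "\<And>X. X \<in> \<D> \<Longrightarrow> \<exists>a b. X = cbox a b" "\<Union>\<D> = U"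
    using open_countable_Union_open_cbox[OF U] by metis
  have ne: "\<D> \<noteq> {}" using D(4) False by auto
  define C where "C = (\<lambda>n. \<Union>k<n. from_nat_into \<D> k)"
  have Cc: "compact (C n)" "C n \<subseteq> U" for n
  proof -
    have "compact (from_nat_into \<D> k)" "from_nat_into \<D> k \<subseteq> U" for k
      using from_nat_into[OF ne, of k] D(2,3) by (force intro: compact_cbox, auto)
    then show "compact (C n)" "C n \<subseteq> U" unfolding C_def by (auto intro!: compact_UN)
  qed
  have lim: "(\<lambda>n. indicator (C n) x *\<^sub>R f x) \<longlonglongrightarrow> indicator U x *\<^sub>R f x" for x
  proof (cases "x \<in> U")
    case True
    then obtain k where k: "x \<in> from_nat_into \<D> k"
      using D(4) from_nat_into_surj[OF D(1)] by blast
    have "\<forall>\<^sub>F n in sequentially. indicator (C n) x *\<^sub>R f x = indicator U x *\<^sub>R f x"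
      using eventually_gt_at_top[of k]
    proof eventually_elim
      case (elim n)
      then have "x \<in> C n" using k by (auto simp: C_def)
      then show ?case using True by simp
    qed
    then show ?thesis by (rule tendsto_eventually)
  next
    case False
    then have "x \<notin> C n" for n using Cc by auto
    then show ?thesis using False by simp
  qed
  have "(\<lambda>x. indicator U x *\<^sub>R f x) \<in> borel_measurable lebesgue"
  proof (rule borel_measurable_LIMSEQ_metric)
    show "(\<lambda>x. indicator (C n) x *\<^sub>R f x) \<in> borel_measurable lebesgue" for n
      using f Cc[of n] by (intro borel_measurable_integrable) (auto simp: locally_integrable_def set_integrable_def)
  qed (rule lim)
  then show ?thesis using U by (subst borel_measurable_restrict_space_iff) auto
next
  case True
  then show ?thesis by (subst borel_measurable_restrict_space_iff) auto
qed

locale sobolev_domain =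
  fixes U :: "(real^'n::finite) set" and p :: real
  assumes open_U: "open U" and bounded_U: "bounded U" and p: "1 < p"
begin

abbreviation wgrad :: "(real^'n \<Rightarrow> real) \<Rightarrow> real^'n \<Rightarrow> real^'n" where
  "wgrad \<equiv> weak_gradient U"

lemma lmeasurable_U: "U \<in> lmeasurable" and sets_U: "U \<in> sets lebesgue"
  using open_U bounded_U by (auto intro: bounded_set_imp_lmeasurable)

lemma p0: "0 \<le> p" using p by simp

lemma has_weak_gradient_wgrad: "has_weak_gradient U u G \<Longrightarrow> has_weak_gradient U u (wgrad u)"
  unfolding weak_gradient_def by (rule someI[where P = "has_weak_gradient U u"])

lemma wgrad_AE_eq: "has_weak_gradient U u G \<Longrightarrow> AE x in lebesgue_on U. wgrad u x = G x"
  using has_weak_gradient_unique[OF open_U] has_weak_gradient_wgrad by blast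

lemma W1p_has_weak_gradient: "u \<in> W1p U p \<Longrightarrow> has_weak_gradient U u (wgrad u)"
  unfolding W1p_def using has_weak_gradient_wgrad by blast

lemma W1p_Lp:
  assumes "u \<in> W1p U p"
  shows "u \<in> Lp_space U p" "wgrad u \<in> Lp_space U p"
proof -
  show "u \<in> Lp_space U p" using assms by (simp add: W1p_def)
  obtain G where G: "G \<in> Lp_space U p" "has_weak_gradient U u G" using assms by (auto simp: W1p_def)
  have "wgrad u \<in> borel_measurable (lebesgue_on U)"
    using W1p_has_weak_gradient[OF assms] by (intro locally_integrable_imp_measurable open_U) (simp add: has_weak_gradient_def)
  then show "wgrad u \<in> Lp_space U p"
    using wgrad_AE_eq[OF G(2)] by (intro Lp_space_AE_cong[OF G(1)])
qed

lemma W1pI: "u \<in> Lp_space U p \<Longrightarrow> G \<in> Lp_space U p \<Longrightarrow> has_weak_gradient U u G \<Longrightarrow> u \<in> W1p U p"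
  unfolding W1p_def by blast

lemma wgrad_p_mass:
  assumes "G \<in> Lp_space U p" "has_weak_gradient U u G"
  shows "p_mass U p (wgrad u) = p_mass U p G"
proof (rule p_mass_AE_cong)
  show "wgrad u \<in> borel_measurable (lebesgue_on U)"
    using has_weak_gradient_wgrad[OF assms(2)] by (intro locally_integrable_imp_measurable open_U) (simp add: has_weak_gradient_def)
qed (use assms wgrad_AE_eq Lp_spaceD in auto)

lemma W1p_lincomb:
  assumes "u \<in> W1p U p" "v \<in> W1p U p"
  shows "(\<lambda>x. u x + c * v x) \<in> W1p U p"
    and "has_weak_gradient U (\<lambda>x. u x + c * v x) (\<lambda>x. wgrad u x + c *\<^sub>R wgrad v x)"
    and "(\<lambda>x. wgrad u x + c *\<^sub>R wgrad v x) \<in> Lp_space U p"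
proof -
  note L = W1p_Lp[OF assms(1)] W1p_Lp[OF assms(2)]
  show w: "has_weak_gradient U (\<lambda>x. u x + c * v x) (\<lambda>x. wgrad u x + c *\<^sub>R wgrad v x)"
    by (intro has_weak_gradient_lincomb open_U W1p_has_weak_gradient assms)
  show "(\<lambda>x. wgrad u x + c *\<^sub>R wgrad v x) \<in> Lp_space U p"
    by (intro Lp_add(1)[OF p0] Lp_scaleR(1) L)
  moreover have "(\<lambda>x. u x + c *\<^sub>R v x) \<in> Lp_space U p"
    by (intro Lp_add(1)[OF p0] Lp_scaleR(1) L)
  ultimately show "(\<lambda>x. u x + c * v x) \<in> W1p U p" using w by (intro W1pI) simp_all
qed

definition sobolev_mass :: "(real^'n \<Rightarrow> real) \<Rightarrow> real" where
  "sobolev_mass u = p_mass U p u + p_mass U p (wgrad u)"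

lemma sobolev_mass_nonneg: "0 \<le> sobolev_mass u"
  by (simp add: sobolev_mass_def p_mass_nonneg)

lemma sobolev_mass_lincomb:
  assumes "u \<in> W1p U p" "v \<in> W1p U p"
  shows "sobolev_mass (\<lambda>x. u x + c * v x) \<le> 2 powr p * (sobolev_mass u + \<bar>c\<bar> powr p * sobolev_mass v)"
proof -
  note L = W1p_Lp[OF assms(1)] W1p_Lp[OF assms(2)]
  have "p_mass U p (\<lambda>x. u x + c *\<^sub>R v x) \<le> 2 powr p * (p_mass U p u + p_mass U p (\<lambda>x. c *\<^sub>R v x))"
    by (intro Lp_add(2)[OF p0] Lp_scaleR(1) L)
  moreover have "p_mass U p (\<lambda>x. wgrad u x + c *\<^sub>R wgrad v x)
      \<le> 2 powr p * (p_mass U p (wgrad u) + p_mass U p (\<lambda>x. c *\<^sub>R wgrad v x))"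
    by (intro Lp_add(2)[OF p0] Lp_scaleR(1) L)
  ultimately show ?thesis
    unfolding sobolev_mass_def wgrad_p_mass[OF W1p_lincomb(3,2)[OF assms]]
      Lp_scaleR(2)[OF L(3)] Lp_scaleR(2)[OF L(4)]
    by (simp add: algebra_simps)
qed

lemma W1p_norm_less_iff:
  assumes "0 < e"
  shows "W1p_norm U p u < e \<longleftrightarrow> sobolev_mass u < e powr p"
proof -
  have eq: "W1p_norm U p u = sobolev_mass u powr (1 / p)"
    by (simp add: W1p_norm_def sobolev_mass_def p_mass_def)
  have "e = (e powr p) powr (1 / p)" using assms p by (simp add: powr_powr)
  moreover have "sobolev_mass u powr (1 / p) < (e powr p) powr (1 / p)" if "sobolev_mass u < e powr p"
    using that p sobolev_mass_nonneg[of u] by (intro powr_less_mono2) auto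
  moreover have "(e powr p) powr (1 / p) \<le> sobolev_mass u powr (1 / p)" if "e powr p \<le> sobolev_mass u"
    using that p by (intro powr_mono2) auto
  ultimately show ?thesis unfolding eq by (metis not_less)
qed

lemma W1p_0_iff:
  "u \<in> W1p_0 U p \<longleftrightarrow> u \<in> W1p U p \<and> (\<forall>e>0. \<exists>\<phi>\<in>test_functions U. sobolev_mass (\<lambda>x. u x - \<phi> x) < e)"
proof -
  have "(\<forall>e>0. \<exists>\<phi>\<in>test_functions U. W1p_norm U p (\<lambda>x. u x - \<phi> x) < e) \<longleftrightarrow>
      (\<forall>e>0. \<exists>\<phi>\<in>test_functions U. sobolev_mass (\<lambda>x. u x - \<phi> x) < e)" (is "?l = ?r")
  proof
    assume l: ?l
    show ?r
    proof (intro allI impI)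
      fix e :: real assume e: "0 < e"
      then have "0 < e powr (1 / p)" by simp
      then obtain \<phi> where \<phi>: "\<phi> \<in> test_functions U" "W1p_norm U p (\<lambda>x. u x - \<phi> x) < e powr (1 / p)"
        using l by blast
      then have "sobolev_mass (\<lambda>x. u x - \<phi> x) < (e powr (1 / p)) powr p"
        using e by (subst W1p_norm_less_iff[symmetric]) auto
      also have "\<dots> = e" using e p by (simp add: powr_powr)
      finally show "\<exists>\<phi>\<in>test_functions U. sobolev_mass (\<lambda>x. u x - \<phi> x) < e" using \<phi>(1) by blast
    qed
  next
    assume r: ?r
    show ?l
    proof (intro allI impI)
      fix e :: real assume e: "0 < e"
      then have "0 < e powr p" by simp
      then obtain \<phi> where "\<phi> \<in> test_functions U" "sobolev_mass (\<lambda>x. u x - \<phi> x) < e powr p"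
        using r by blast
      then show "\<exists>\<phi>\<in>test_functions U. W1p_norm U p (\<lambda>x. u x - \<phi> x) < e"
        using W1p_norm_less_iff[OF e] by blast
    qed
  qed
  then show ?thesis by (simp add: W1p_0_def)
qed

lemma C1_W1p:
  assumes "Ck (Suc 0) f"
  shows "f \<in> W1p U p" "has_weak_gradient U f (grad f)" "grad f \<in> Lp_space U p"
    "AE x in lebesgue_on U. wgrad f x = grad f x"
proof -
  note C = C1_continuous[OF assms]
  show w: "has_weak_gradient U f (grad f)" by (rule has_weak_gradient_C1[OF assms open_U])
  show g: "grad f \<in> Lp_space U p" using C by (intro continuous_in_Lp bounded_U open_U p0)
  show "f \<in> W1p U p" using C by (intro W1pI[OF _ g w] continuous_in_Lp bounded_U open_U p0)
  show "AE x in lebesgue_on U. wgrad f x = grad f x" by (rule wgrad_AE_eq[OF w])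
qed

lemma test_function_lincomb:
  assumes "\<phi> \<in> test_functions U" "\<psi> \<in> test_functions U"
  shows "(\<lambda>x. \<phi> x + c * \<psi> x) \<in> test_functions U"
    and "grad (\<lambda>x. \<phi> x + c * \<psi> x) = (\<lambda>x. grad \<phi> x + c *\<^sub>R grad \<psi> x)"
proof -
  have Ck: "Ck k \<phi>" "Ck k \<psi>" for k using assms by (auto simp: test_functions_def)
  have "Ck k (\<lambda>x. \<phi> x + c * \<psi> x)" for k by (intro Ck_add Ck_mult Ck_const Ck)
  moreover
  let ?S = "closure {x. \<phi> x \<noteq> 0} \<union> closure {x. \<psi> x \<noteq> 0}"
  have S: "compact ?S" "?S \<subseteq> U" using assms by (auto simp: test_functions_def)
  have "{x. \<phi> x + c * \<psi> x \<noteq> 0} \<subseteq> {x. \<phi> x \<noteq> 0} \<union> {x. \<psi> x \<noteq> 0}" by auto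
  from closure_mono[OF this] have cl: "closure {x. \<phi> x + c * \<psi> x \<noteq> 0} \<subseteq> ?S" by simp
  then have "compact (closure {x. \<phi> x + c * \<psi> x \<noteq> 0})"
    using S(1) by (meson bounded_subset closed_closure compact_eq_bounded_closed)
  ultimately show "(\<lambda>x. \<phi> x + c * \<psi> x) \<in> test_functions U"
    using cl S(2) by (auto simp: test_functions_def)
  show "grad (\<lambda>x. \<phi> x + c * \<psi> x) = (\<lambda>x. grad \<phi> x + c *\<^sub>R grad \<psi> x)"
  proof
    fix x
    have "((\<lambda>x. \<phi> x + c * \<psi> x) has_derivative (\<lambda>h. grad \<phi> x \<bullet> h + c * (grad \<psi> x \<bullet> h))) (at x)"
      by (intro derivative_intros C1_has_derivative test_function_C1[OF assms(1)] test_function_C1[OF assms(2)])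
    then show "grad (\<lambda>x. \<phi> x + c * \<psi> x) x = grad \<phi> x + c *\<^sub>R grad \<psi> x"
      by (intro grad_eqI) (simp add: inner_add_left)
  qed
qed

lemma W1p_0_lincomb:
  assumes u: "u \<in> W1p_0 U p" and v: "v \<in> W1p_0 U p"
  shows "(\<lambda>x. u x + c * v x) \<in> W1p_0 U p"
  unfolding W1p_0_iff
proof (intro conjI allI impI)
  have uv: "u \<in> W1p U p" "v \<in> W1p U p" using u v by (auto simp: W1p_0_iff)
  then show "(\<lambda>x. u x + c * v x) \<in> W1p U p" by (rule W1p_lincomb)
  fix e :: real assume "0 < e"
  define C where "C = 2 powr p * (1 + \<bar>c\<bar> powr p)"
  have C: "0 < C" unfolding C_def by (intro mult_pos_pos) (auto intro: add_pos_nonneg)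
  define d where "d = e / C"
  have d: "0 < d" using C \<open>0 < e\<close> by (simp add: d_def)
  obtain \<phi> \<psi> where \<phi>: "\<phi> \<in> test_functions U" "sobolev_mass (\<lambda>x. u x - \<phi> x) < d"
    and \<psi>: "\<psi> \<in> test_functions U" "sobolev_mass (\<lambda>x. v x - \<psi> x) < d"
    using u v d unfolding W1p_0_iff by blast
  have W: "(\<lambda>x. u x + (-1) * \<phi> x) \<in> W1p U p" "(\<lambda>x. v x + (-1) * \<psi> x) \<in> W1p U p"
    by (intro W1p_lincomb(1) uv C1_W1p(1) test_function_C1[OF \<phi>(1)] test_function_C1[OF \<psi>(1)])+
  have "sobolev_mass (\<lambda>x. (u x + (-1) * \<phi> x) + c * (v x + (-1) * \<psi> x))
      \<le> 2 powr p * (sobolev_mass (\<lambda>x. u x + (-1) * \<phi> x) + \<bar>c\<bar> powr p * sobolev_mass (\<lambda>x. v x + (-1) * \<psi> x))"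
    by (rule sobolev_mass_lincomb[OF W])
  also have "\<dots> < 2 powr p * (d + \<bar>c\<bar> powr p * d)"
    using \<phi> \<psi> by (intro mult_strict_left_mono add_less_le_mono mult_left_mono) auto
  also have "\<dots> = C * d" by (simp add: C_def algebra_simps)
  also have "\<dots> = e" using C by (simp add: d_def)
  also have "(\<lambda>x. (u x + (-1) * \<phi> x) + c * (v x + (-1) * \<psi> x)) = (\<lambda>x. (u x + c * v x) - (\<phi> x + c * \<psi> x))"
    by (simp add: algebra_simps)
  finally show "\<exists>\<phi>\<in>test_functions U. sobolev_mass (\<lambda>x. (u x + c * v x) - \<phi> x) < e"
    by (rule bexI[OF _ test_function_lincomb(1)[OF \<phi>(1) \<psi>(1)]])
qed

lemma has_weak_gradient_diff_test:
  assumes "has_weak_gradient U u G" "\<phi> \<in> test_functions U"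
  shows "has_weak_gradient U (\<lambda>x. u x - \<phi> x) (\<lambda>x. G x - grad \<phi> x)"
  using has_weak_gradient_lincomb[OF open_U assms(1) C1_W1p(2)[OF test_function_C1[OF assms(2)]], of "-1"] by simp

lemma W1p_0_approx:
  assumes "u \<in> W1p_0 U p" "0 < e"
  obtains \<phi> where "\<phi> \<in> test_functions U" "p_mass U p (\<lambda>x. wgrad u x - grad \<phi> x) < e"
proof -
  obtain \<phi> where \<phi>: "\<phi> \<in> test_functions U" "sobolev_mass (\<lambda>x. u x - \<phi> x) < e"
    using assms by (auto simp: W1p_0_iff)
  have u: "u \<in> W1p U p" using assms by (simp add: W1p_0_iff)
  have "p_mass U p (wgrad (\<lambda>x. u x - \<phi> x)) = p_mass U p (\<lambda>x. wgrad u x - grad \<phi> x)"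
    by (intro wgrad_p_mass Lp_diff(1)[OF p0] W1p_Lp(2)[OF u] C1_W1p(3) test_function_C1[OF \<phi>(1)] \<phi>(1)
        has_weak_gradient_diff_test W1p_has_weak_gradient u)
  then show ?thesis using \<phi> p_mass_nonneg[of U p "\<lambda>x. u x - \<phi> x"]
    by (intro that[of \<phi>]) (auto simp: sobolev_mass_def)
qed

text \<open>
  Pairing with a bounded function is continuous under convergence in \<open>L\<^sup>p\<close>, so the defining
  identity of the weak gradient passes to the limit.
\<close>

lemma W1p_0_limit:
  assumes \<phi>: "\<And>k. \<phi> k \<in> test_functions U"
    and w: "w \<in> Lp_space U p" "(\<lambda>k. p_mass U p (\<lambda>x. \<phi> k x - w x)) \<longlonglongrightarrow> 0"
    and G: "G \<in> Lp_space U p" "(\<lambda>k. p_mass U p (\<lambda>x. grad (\<phi> k) x - G x)) \<longlonglongrightarrow> 0"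
  shows "has_weak_gradient U w G" "w \<in> W1p_0 U p"
proof -
  note C1 = test_function_C1[OF \<phi>]
  note PL = C1_W1p(3)[OF C1] W1p_Lp(1)[OF C1_W1p(1)[OF C1]]
  have pair: "(\<lambda>k. LINT x|lebesgue_on U. h k x * \<eta> x) \<longlonglongrightarrow> (LINT x|lebesgue_on U. l x * \<eta> x)"
    if h: "\<And>k. h k \<in> Lp_space U p" "l \<in> Lp_space U p" "(\<lambda>k. p_mass U p (\<lambda>x. h k x - l x)) \<longlonglongrightarrow> 0"
      and \<eta>: "continuous_on UNIV \<eta>"
    for h :: "nat \<Rightarrow> real^'n \<Rightarrow> real" and l \<eta>
  proof -
    have "compact (\<eta> ` closure U)"
      using bounded_U by (intro compact_continuous_image continuous_on_subset[OF \<eta>]) auto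
    then obtain B where B: "\<forall>x\<in>closure U. \<bar>\<eta> x\<bar> \<le> B"
      by (auto dest!: compact_imp_bounded simp: bounded_iff)
    have \<eta>m: "\<eta> \<in> borel_measurable (lebesgue_on U)"
      using \<eta> by (intro measurable_restrict_space1 measurable_completion) (auto intro: borel_measurable_continuous_onI)
    have int: "integrable (lebesgue_on U) (\<lambda>x. f x * \<eta> x)" if "f \<in> Lp_space U p" for f :: "real^'n \<Rightarrow> real"
    proof (rule Bochner_Integration.integrable_bound)
      show "integrable (lebesgue_on U) (\<lambda>x. \<bar>B\<bar> * norm (f x))"
        using Lp_imp_integrable(1)[OF p lmeasurable_U that] by simp
      show "AE x in lebesgue_on U. norm (f x * \<eta> x) \<le> norm (\<bar>B\<bar> * norm (f x))"
      proof (rule AE_I2)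
        fix x assume "x \<in> space (lebesgue_on U)"
        then have "\<bar>\<eta> x\<bar> \<le> \<bar>B\<bar>" using B closure_subset[of U] by force
        then have "\<bar>\<eta> x\<bar> * \<bar>f x\<bar> \<le> \<bar>B\<bar> * \<bar>f x\<bar>" by (rule mult_right_mono) simp
        then show "norm (f x * \<eta> x) \<le> norm (\<bar>B\<bar> * norm (f x))" by (simp add: abs_mult mult.commute)
      qed
    qed (use \<eta>m Lp_spaceD(1)[OF that] in measurable)
    let ?A = "\<bar>B\<bar> + 1"
    have dL: "(\<lambda>x. h k x - l x) \<in> Lp_space U p" for k by (intro Lp_diff(1)[OF p0] h)
    have est: "\<bar>(LINT x|lebesgue_on U. h k x * \<eta> x) - (LINT x|lebesgue_on U. l x * \<eta> x)\<bar>
        \<le> ?A * (e * measure lebesgue U + e powr (1 - p) * p_mass U p (\<lambda>x. h k x - l x))" if e: "0 < e" for k e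
    proof -
      have "(LINT x|lebesgue_on U. h k x * \<eta> x) - (LINT x|lebesgue_on U. l x * \<eta> x)
          = (LINT x|lebesgue_on U. (h k x - l x) * \<eta> x)"
        using int h by (simp add: left_diff_distrib)
      also have "\<bar>\<dots>\<bar> \<le> (LINT x|lebesgue_on U. \<bar>(h k x - l x) * \<eta> x\<bar>)"
        using integral_norm_bound[of "lebesgue_on U" "\<lambda>x. (h k x - l x) * \<eta> x"] by simp
      also have "\<dots> \<le> (LINT x|lebesgue_on U. ?A * norm (h k x - l x))"
      proof (rule integral_mono)
        show "integrable (lebesgue_on U) (\<lambda>x. \<bar>(h k x - l x) * \<eta> x\<bar>)" using int[OF dL] by simp
        show "integrable (lebesgue_on U) (\<lambda>x. ?A * norm (h k x - l x))"
          using Lp_imp_integrable(1)[OF p lmeasurable_U dL] by simp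
        fix x assume "x \<in> space (lebesgue_on U)"
        then have "\<bar>\<eta> x\<bar> \<le> ?A" using B closure_subset[of U] by force
        then have "\<bar>\<eta> x\<bar> * \<bar>h k x - l x\<bar> \<le> ?A * \<bar>h k x - l x\<bar>" by (rule mult_right_mono) simp
        then show "\<bar>(h k x - l x) * \<eta> x\<bar> \<le> ?A * norm (h k x - l x)" by (simp add: abs_mult mult.commute)
      qed
      also have "\<dots> = ?A * (LINT x|lebesgue_on U. norm (h k x - l x))" by simp
      also have "\<dots> \<le> ?A * (e * measure lebesgue U + e powr (1 - p) * p_mass U p (\<lambda>x. h k x - l x))"
        by (intro mult_left_mono Lp_imp_integrable(2)[OF p lmeasurable_U dL e]) auto
      finally show ?thesis .
    qed
    show ?thesis
    proof (rule LIMSEQ_I)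
      fix r :: real assume r: "0 < r"
      define e where "e = r / (2 * ?A * (measure lebesgue U + 1))"
      have mu: "0 \<le> measure lebesgue U" by simp
      have e: "0 < e" unfolding e_def using r by (intro divide_pos_pos mult_pos_pos add_nonneg_pos mu) auto
      have e1: "?A * (e * measure lebesgue U) \<le> r / 2"
      proof -
        have "?A * (e * measure lebesgue U) \<le> ?A * (e * (measure lebesgue U + 1))"
          using e by (intro mult_left_mono) auto
        also have "\<dots> = r / 2" 
        proof -
          have nz: "?A \<noteq> 0" "measure lebesgue U + 1 \<noteq> 0" using mu by linarith+
          have "?A * (e * (measure lebesgue U + 1)) = ?A * (measure lebesgue U + 1) * e" by (simp only: mult_ac)
          also have "\<dots> = r / 2"
          proof -
            have "a * b * (r / (2 * a * b)) = r / 2" if "a \<noteq> 0" "b \<noteq> 0" for a b :: real using that by simp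
            then show ?thesis unfolding e_def using nz by blast
          qed
          finally show ?thesis .
        qed
        finally show ?thesis by simp
      qed
      have "(\<lambda>k. ?A * (e powr (1 - p) * p_mass U p (\<lambda>x. h k x - l x))) \<longlonglongrightarrow> ?A * (e powr (1 - p) * 0)"
        by (intro tendsto_intros h)
      then have "\<forall>\<^sub>F k in sequentially. ?A * (e powr (1 - p) * p_mass U p (\<lambda>x. h k x - l x)) < r / 2"
        by (rule order_tendstoD(2)) (use r in simp)
      then obtain N where N: "\<And>k. k \<ge> N \<Longrightarrow> ?A * (e powr (1 - p) * p_mass U p (\<lambda>x. h k x - l x)) < r / 2"
        by (auto simp: eventually_sequentially)
      show "\<exists>N. \<forall>k\<ge>N. norm ((LINT x|lebesgue_on U. h k x * \<eta> x) - (LINT x|lebesgue_on U. l x * \<eta> x)) < r"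
      proof (intro exI allI impI)
        fix k assume "N \<le> k"
        have "?A * (e * measure lebesgue U + e powr (1 - p) * p_mass U p (\<lambda>x. h k x - l x))
           = ?A * (e * measure lebesgue U) + ?A * (e powr (1 - p) * p_mass U p (\<lambda>x. h k x - l x))"
          by (rule distrib_left)
        then show "norm ((LINT x|lebesgue_on U. h k x * \<eta> x) - (LINT x|lebesgue_on U. l x * \<eta> x)) < r"
          using est[OF e, of k] N[OF \<open>N \<le> k\<close>] e1 by auto
      qed
    qed
  qed
  show wG: "has_weak_gradient U w G"
    unfolding has_weak_gradient_def
  proof (intro conjI ballI allI)
    show "locally_integrable U w" "locally_integrable U G"
      by (intro Lp_imp_locally_integrable[OF p lmeasurable_U] w G)+
    fix \<eta> i assume \<eta>: "\<eta> \<in> test_functions U"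
    note CE = C1_continuous[OF test_function_C1[OF \<eta>]]
    have nth: "(\<lambda>x. F x $ i) \<in> Lp_space U p \<and> p_mass U p (\<lambda>x. F x $ i) \<le> p_mass U p F"
      if "F \<in> Lp_space U p" for F :: "real^'n \<Rightarrow> real^'n"
    proof -
      note D = Lp_spaceD[OF that]
      have m: "(\<lambda>x. F x $ i) \<in> borel_measurable (lebesgue_on U)"
        using measurable_compose[OF D(1) borel_measurable_nth] by simp
      have b: "AE x in lebesgue_on U. norm (F x $ i) powr p \<le> norm (F x) powr p"
        using p by (intro AE_I2 powr_mono2 Finite_Cartesian_Product.norm_nth_le) auto
      show ?thesis using Lp_space_bound[OF m D(2) b] by (simp add: p_mass_def)
    qed
    have "(\<lambda>k. LINT x|lebesgue_on U. \<phi> k x * partial_deriv i \<eta> x) \<longlonglongrightarrow> (LINT x|lebesgue_on U. w x * partial_deriv i \<eta> x)"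
      by (intro pair PL w CE)
    moreover have "(\<lambda>k. LINT x|lebesgue_on U. grad (\<phi> k) x $ i * \<eta> x) \<longlonglongrightarrow> (LINT x|lebesgue_on U. G x $ i * \<eta> x)"
    proof (rule pair)
      show "(\<lambda>x. grad (\<phi> k) x $ i) \<in> Lp_space U p" for k using nth[OF PL(1)] by blast
      show "(\<lambda>x. G x $ i) \<in> Lp_space U p" using nth[OF G(1)] by blast
      have "p_mass U p (\<lambda>x. grad (\<phi> k) x $ i - G x $ i) \<le> p_mass U p (\<lambda>x. grad (\<phi> k) x - G x)" for k
        using nth[OF Lp_diff(1)[OF p0 PL(1)[of k] G(1)]] by simp
      then show "(\<lambda>k. p_mass U p (\<lambda>x. grad (\<phi> k) x $ i - G x $ i)) \<longlonglongrightarrow> 0"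
        by (intro tendsto_sandwich[OF _ _ tendsto_const G(2)]) (auto intro!: always_eventually p_mass_nonneg)
    qed (rule CE)
    moreover have "(LINT x|lebesgue_on U. \<phi> k x * partial_deriv i \<eta> x) = - (LINT x|lebesgue_on U. grad (\<phi> k) x $ i * \<eta> x)" for k
      using C1_W1p(2)[OF C1, of k] \<eta> unfolding has_weak_gradient_def by blast
    ultimately show "(LINT x|lebesgue_on U. w x * partial_deriv i \<eta> x) = - (LINT x|lebesgue_on U. G x $ i * \<eta> x)"
      using LIMSEQ_unique tendsto_minus by (metis (no_types, lifting) ext)
  qed
  have wW: "w \<in> W1p U p" by (rule W1pI[OF w(1) G(1) wG])
  show "w \<in> W1p_0 U p"
    unfolding W1p_0_iff
  proof (intro conjI allI impI wW)
    fix e :: real assume e: "0 < e"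
    have sym: "p_mass U p (\<lambda>x. a x - b x) = p_mass U p (\<lambda>x. b x - a x)" for a b :: "real^'n \<Rightarrow> 'c::euclidean_space"
      by (simp add: p_mass_def norm_minus_commute)
    have "sobolev_mass (\<lambda>x. w x - \<phi> k x) = p_mass U p (\<lambda>x. \<phi> k x - w x) + p_mass U p (\<lambda>x. grad (\<phi> k) x - G x)" for k
      unfolding sobolev_mass_def
      using wgrad_p_mass[OF Lp_diff(1)[OF p0 G(1) PL(1)[of k]] has_weak_gradient_diff_test[OF wG \<phi>[of k]]]
      by (simp add: sym[of w] sym[of G])
    then have "(\<lambda>k. sobolev_mass (\<lambda>x. w x - \<phi> k x)) \<longlonglongrightarrow> 0 + 0"
      using tendsto_add[OF w(2) G(2)] by simp
    then have "\<forall>\<^sub>F k in sequentially. sobolev_mass (\<lambda>x. w x - \<phi> k x) < e"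
      using e by (intro order_tendstoD) auto
    then obtain k where "sobolev_mass (\<lambda>x. w x - \<phi> k x) < e"
      using eventually_happens trivial_limit_sequentially by blast
    then show "\<exists>\<phi>\<in>test_functions U. sobolev_mass (\<lambda>x. w x - \<phi> x) < e" using \<phi> by blast
  qed
qed

text \<open>
  Integrate \<open>\<partial>\<^sub>i (x\<^sub>i |\<phi>|\<^sup>p) = |\<phi>|\<^sup>p + p x\<^sub>i |\<phi>|\<^sup>p\<^sup>-\<^sup>2 \<phi> \<partial>\<^sub>i\<phi>\<close>, whose integral is zero, and
  absorb the last term by Young's inequality, using that \<open>x\<^sub>i\<close> is bounded on \<open>U\<close>.
\<close>

lemma poincare:
  "\<exists>C>0. \<forall>\<phi>\<in>test_functions U. p_mass U p \<phi> \<le> C * p_mass U p (grad \<phi>)"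
proof -
  fix i :: 'n
  obtain R where R: "0 < R" "\<And>x. x \<in> U \<Longrightarrow> norm x \<le> R"
    using bounded_U by (auto simp: bounded_pos)
  \<comment> \<open>With this parameter, Young's inequality produces exactly half of \<open>|\<phi>|\<^sup>p\<close>.\<close>
  define e where "e = 1 / (2 * p * R)"
  have e: "0 < e" using R p by (simp add: e_def)
  define C where "C = 2 * (p * R * e powr (1 - p))"
  have C: "0 < C" using R p e by (simp add: C_def)
  have "p_mass U p \<phi> \<le> C * p_mass U p (grad \<phi>)" if \<phi>: "\<phi> \<in> test_functions U" for \<phi>
  proof -
    note C1 = test_function_C1[OF \<phi>]
    note cont = C1_continuous[OF C1]
    obtain K where K: "compact K" "K \<subseteq> U" "\<And>x. x \<notin> K \<Longrightarrow> \<phi> x = 0" "\<And>x. x \<notin> K \<Longrightarrow> grad \<phi> x = 0"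
      using test_function_support[OF \<phi>] by blast
    define d where "d = (\<lambda>x. \<bar>\<phi> x\<bar> powr p + x $ i * (p * (\<bar>\<phi> x\<bar> powr (p - 2) * \<phi> x) * partial_deriv i \<phi> x))"
    have fc: "continuous_on UNIV (\<lambda>x. \<bar>\<phi> x\<bar> powr (p - 2) * \<phi> x)"
      using continuous_on_compose2[OF continuous_on_p_flux[OF p, where 'b = real] cont(1)] by simp
    have pc: "continuous_on UNIV (\<lambda>x. \<bar>\<phi> x\<bar> powr p)"
      using p cont by (intro continuous_on_powr' continuous_intros) auto
    have dc: "continuous_on UNIV d"
      unfolding d_def by (intro continuous_intros fc pc cont)
    have d0: "d x = 0" if "x \<notin> K" for x using K(3)[OF that] by (simp add: d_def)
    have "integral\<^sup>L lborel d = 0"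
    proof (rule integral_directional_derivative_eq_0[where g = "\<lambda>x. x $ i * \<bar>\<phi> x\<bar> powr p" and e = "axis i 1" and R = R])
      fix x
      have A: "((\<lambda>t. \<bar>\<phi> (x + t *\<^sub>R axis i 1)\<bar> powr p) has_real_derivative
          p * (\<bar>\<phi> x\<bar> powr (p - 2) * \<phi> x) * partial_deriv i \<phi> x) (at 0)"
        using DERIV_chain2[OF abs_powr_has_real_derivative[OF p] C1_directional[OF C1, of x i]] by simp
      have B: "((\<lambda>t. (x + t *\<^sub>R axis i 1) $ i) has_real_derivative 1) (at 0)"
        by (auto intro!: derivative_eq_intros)
      show "((\<lambda>t. (x + t *\<^sub>R axis i 1) $ i * \<bar>\<phi> (x + t *\<^sub>R axis i 1)\<bar> powr p) has_real_derivative d x) (at 0)"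
        using DERIV_mult[OF B A] by (simp add: d_def mult.commute)
      show "x $ i * \<bar>\<phi> x\<bar> powr p = 0" if "R < norm x"
        using K(2,3) R(2)[of x] that by force
    next
      show "continuous_on UNIV (\<lambda>x. x $ i * \<bar>\<phi> x\<bar> powr p)" by (intro continuous_intros pc)
    qed (rule dc)
    moreover have "d \<in> borel_measurable borel" using dc by (rule borel_measurable_continuous_onI)
    ultimately have d: "integral\<^sup>L (lebesgue_on U) d = 0" "integrable (lebesgue_on U) d"
      using lebesgue_on_integral_support[of d U] sets_U d0 K(2)
        integrable_continuous_compact_support[OF dc K(1) d0] by auto
    have pw: "\<bar>\<phi> x\<bar> powr p \<le> 2 * d x + C * norm (grad \<phi> x) powr p" if "x \<in> U" for x
    proof -
      have "\<bar>x $ i\<bar> \<le> R" using component_le_norm_cart[of x i] R(2)[OF that] by linarith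
      moreover have "\<bar>\<bar>\<phi> x\<bar> powr (p - 2) * \<phi> x\<bar> = \<bar>\<phi> x\<bar> powr (p - 1)"
        using powr_mult_base[of "\<bar>\<phi> x\<bar>" "p - 2"] by (simp add: abs_mult mult.commute)
      moreover have "\<bar>partial_deriv i \<phi> x\<bar> \<le> norm (grad \<phi> x)"
        using component_le_norm_cart[of "grad \<phi> x" i] by simp
      ultimately have "\<bar>x $ i * (p * (\<bar>\<phi> x\<bar> powr (p - 2) * \<phi> x) * partial_deriv i \<phi> x)\<bar>
          \<le> R * (p * \<bar>\<phi> x\<bar> powr (p - 1) * norm (grad \<phi> x))"
        using p R(1) unfolding abs_mult by (intro mult_mono) (auto simp: abs_mult)
      also have "\<dots> = p * R * (\<bar>\<phi> x\<bar> powr (p - 1) * norm (grad \<phi> x))" by simp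
      also have "\<dots> \<le> p * R * (e * \<bar>\<phi> x\<bar> powr p + e powr (1 - p) * norm (grad \<phi> x) powr p)"
        using p R(1) e by (intro mult_left_mono young_powr) auto
      also have "\<dots> = \<bar>\<phi> x\<bar> powr p / 2 + C / 2 * norm (grad \<phi> x) powr p"
        using p R(1) by (simp add: e_def C_def field_simps)
      finally show ?thesis by (simp add: d_def abs_le_iff field_simps)
    qed
    have "p_mass U p \<phi> \<le> (LINT x|lebesgue_on U. 2 * d x + C * norm (grad \<phi> x) powr p)"
    proof (rule Lp_space_bound(2))
      show "\<phi> \<in> borel_measurable (lebesgue_on U)" using Lp_spaceD(1)[OF W1p_Lp(1)[OF C1_W1p(1)[OF C1]]] .
      show "integrable (lebesgue_on U) (\<lambda>x. 2 * d x + C * norm (grad \<phi> x) powr p)"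
        using d(2) Lp_spaceD(2)[OF C1_W1p(3)[OF C1]] by simp
      show "AE x in lebesgue_on U. norm (\<phi> x) powr p \<le> 2 * d x + C * norm (grad \<phi> x) powr p"
        using pw by (intro AE_I2) simp
    qed
    also have "\<dots> = C * p_mass U p (grad \<phi>)"
      using d Lp_spaceD(2)[OF C1_W1p(3)[OF C1]] by (simp add: p_mass_def)
    finally show ?thesis .
  qed
  then show ?thesis using C by blast
qed

end

section \<open>Existence of weak solutions\<close>

lemma le_if_le_powr_one_minus:
  fixes a b q :: real
  assumes "\<And>s. 0 < s \<Longrightarrow> s < 1 \<Longrightarrow> a \<le> (1 - s) powr q * b"
  shows "a \<le> b"
proof (rule tendsto_lowerbound)
  have "((\<lambda>s::real. (1 - s) powr q * b) \<longlongrightarrow> (1 - 0) powr q * b) (at_right 0)"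
    by (intro tendsto_intros) auto
  then show "((\<lambda>s::real. (1 - s) powr q * b) \<longlongrightarrow> b) (at_right 0)" by simp
  have "\<forall>\<^sub>F s::real in at_right 0. s \<in> {0<..<1}" by (rule eventually_at_right_real) simp
  then show "\<forall>\<^sub>F s in at_right 0. a \<le> (1 - s) powr q * b"
    by eventually_elim (use assms in auto)
qed simp

locale conductivity = sobolev_domain U p for U :: "(real^'n::finite) set" and p :: real +
  fixes \<sigma> :: "real^'n \<Rightarrow> real" and M \<epsilon> :: real
  assumes \<sigma>_measurable: "\<sigma> \<in> borel_measurable (lebesgue_on U)"
    and \<sigma>_upper: "AE x in lebesgue_on U. \<sigma> x \<le> M"
    and \<sigma>_lower: "AE x in lebesgue_on U. \<epsilon> \<le> \<sigma> x"
    and \<epsilon>: "0 < \<epsilon>" "\<epsilon> \<le> M"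
begin

lemma M_nonneg: "0 \<le> M" using \<epsilon> by simp

lemma \<sigma>_abs: "AE x in lebesgue_on U. \<bar>\<sigma> x\<bar> \<le> M"
  using \<sigma>_upper \<sigma>_lower by eventually_elim (use \<epsilon> in auto)

definition energy :: "(real^'n \<Rightarrow> real^'n) \<Rightarrow> real" where
  "energy G = (LINT x|lebesgue_on U. \<sigma> x * norm (G x) powr p)"

lemma energy_integrable:
  assumes "G \<in> Lp_space U p"
  shows "integrable (lebesgue_on U) (\<lambda>x. \<sigma> x * norm (G x) powr p)"
proof (rule Bochner_Integration.integrable_bound)
  show "integrable (lebesgue_on U) (\<lambda>x. M * norm (G x) powr p)" using Lp_spaceD[OF assms] by simp
  show "AE x in lebesgue_on U. norm (\<sigma> x * norm (G x) powr p) \<le> norm (M * norm (G x) powr p)"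
    using \<sigma>_abs by eventually_elim (use M_nonneg in \<open>auto simp: abs_mult intro!: mult_right_mono\<close>)
qed (use \<sigma>_measurable Lp_spaceD[OF assms] in measurable)

lemma energy_nonneg: "0 \<le> energy G"
  unfolding energy_def
proof (rule integral_nonneg_AE)
  show "AE x in lebesgue_on U. 0 \<le> \<sigma> x * norm (G x) powr p"
    using \<sigma>_lower by eventually_elim (use \<epsilon> in auto)
qed

lemma p_mass_le_energy:
  assumes "G \<in> Lp_space U p"
  shows "\<epsilon> * p_mass U p G \<le> energy G"
proof -
  have "(LINT x|lebesgue_on U. \<epsilon> * norm (G x) powr p) \<le> energy G"
    unfolding energy_def
  proof (rule integral_mono_AE)
    show "AE x in lebesgue_on U. \<epsilon> * norm (G x) powr p \<le> \<sigma> x * norm (G x) powr p"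
      using \<sigma>_lower by eventually_elim (auto intro: mult_right_mono)
  qed (use energy_integrable Lp_spaceD[OF assms] assms in auto)
  then show ?thesis by (simp add: p_mass_def)
qed

lemma energy_AE_cong:
  assumes "G \<in> borel_measurable (lebesgue_on U)" "H \<in> borel_measurable (lebesgue_on U)"
    "AE x in lebesgue_on U. G x = H x"
  shows "energy G = energy H"
  unfolding energy_def
proof (rule integral_cong_AE)
  show "AE x in lebesgue_on U. \<sigma> x * norm (G x) powr p = \<sigma> x * norm (H x) powr p"
    using assms(3) by eventually_elim simp
qed (use \<sigma>_measurable assms in measurable)

lemma energy_add_le:
  assumes G: "G \<in> Lp_space U p" and H: "H \<in> Lp_space U p" and s: "0 < s" "s < 1"
  shows "energy (\<lambda>x. G x + H x) \<le> (1 - s) powr (1 - p) * energy G + s powr (1 - p) * (M * p_mass U p H)"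
proof -
  have "energy (\<lambda>x. G x + H x)
      \<le> (LINT x|lebesgue_on U. (1 - s) powr (1 - p) * (\<sigma> x * norm (G x) powr p) + s powr (1 - p) * (M * norm (H x) powr p))"
    unfolding energy_def
  proof (rule integral_mono_AE)
    show "integrable (lebesgue_on U) (\<lambda>x. \<sigma> x * norm (G x + H x) powr p)"
      by (intro energy_integrable Lp_add(1)[OF p0] G H)
    show "integrable (lebesgue_on U)
        (\<lambda>x. (1 - s) powr (1 - p) * (\<sigma> x * norm (G x) powr p) + s powr (1 - p) * (M * norm (H x) powr p))"
      using energy_integrable[OF G] Lp_spaceD[OF H] by simp
    show "AE x in lebesgue_on U. \<sigma> x * norm (G x + H x) powr p
        \<le> (1 - s) powr (1 - p) * (\<sigma> x * norm (G x) powr p) + s powr (1 - p) * (M * norm (H x) powr p)"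
      using \<sigma>_upper \<sigma>_lower
    proof eventually_elim
      case (elim x)
      have "\<sigma> x * norm (G x + H x) powr p
          \<le> \<sigma> x * ((1 - s) powr (1 - p) * norm (G x) powr p + s powr (1 - p) * norm (H x) powr p)"
        using elim \<epsilon> by (intro mult_left_mono norm_add_powr_le_convex p s) auto
      also have "\<dots> = (1 - s) powr (1 - p) * (\<sigma> x * norm (G x) powr p) + s powr (1 - p) * (\<sigma> x * norm (H x) powr p)"
        by (simp add: algebra_simps)
      also have "\<dots> \<le> (1 - s) powr (1 - p) * (\<sigma> x * norm (G x) powr p) + s powr (1 - p) * (M * norm (H x) powr p)"
        using elim by (intro add_left_mono mult_left_mono mult_right_mono) auto
      finally show ?case .
    qed
  qed
  also have "\<dots> = (1 - s) powr (1 - p) * energy G + s powr (1 - p) * (M * p_mass U p H)"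
    using energy_integrable[OF G] Lp_spaceD[OF H] by (simp add: energy_def p_mass_def)
  finally show ?thesis .
qed

text \<open>
  In \<open>energy_add_le\<close>, let \<open>k\<close> tend to infinity first and \<open>s\<close> to zero afterwards. The same
  applies to the upper bound in the next lemma.
\<close>

lemma energy_lower_bound_limit:
  assumes G: "G \<in> Lp_space U p" and H: "\<And>k. H k \<in> Lp_space U p"
    and lim: "(\<lambda>k. p_mass U p (\<lambda>x. H k x - G x)) \<longlonglongrightarrow> 0"
    and m: "\<And>k. m \<le> energy (H k)"
  shows "m \<le> energy G"
proof (rule le_if_le_powr_one_minus)
  fix s :: real assume s: "0 < s" "s < 1"
  have le: "m \<le> (1 - s) powr (1 - p) * energy G + s powr (1 - p) * (M * p_mass U p (\<lambda>x. H k x - G x))" for k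
    using m[of k] energy_add_le[OF G Lp_diff(1)[OF p0 H[of k] G] s] by simp
  have "(\<lambda>k. (1 - s) powr (1 - p) * energy G + s powr (1 - p) * (M * p_mass U p (\<lambda>x. H k x - G x)))
     \<longlonglongrightarrow> (1 - s) powr (1 - p) * energy G + s powr (1 - p) * (M * 0)"
    by (intro tendsto_intros lim)
  from LIMSEQ_le_const[OF this] le show "m \<le> (1 - s) powr (1 - p) * energy G" by auto
qed

lemma energy_upper_bound_limit:
  assumes G: "G \<in> Lp_space U p" and H: "\<And>k. H k \<in> Lp_space U p"
    and lim: "(\<lambda>k. p_mass U p (\<lambda>x. H k x - G x)) \<longlonglongrightarrow> 0"
    and m: "(\<lambda>k. energy (H k)) \<longlonglongrightarrow> m"
  shows "energy G \<le> m"
proof (rule le_if_le_powr_one_minus)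
  fix s :: real assume s: "0 < s" "s < 1"
  have sym: "p_mass U p (\<lambda>x. G x - H k x) = p_mass U p (\<lambda>x. H k x - G x)" for k
    by (simp add: p_mass_def norm_minus_commute)
  have le: "energy G \<le> (1 - s) powr (1 - p) * energy (H k) + s powr (1 - p) * (M * p_mass U p (\<lambda>x. H k x - G x))" for k
    using energy_add_le[OF H[of k] Lp_diff(1)[OF p0 G H[of k]] s] by (simp add: sym)
  have "(\<lambda>k. (1 - s) powr (1 - p) * energy (H k) + s powr (1 - p) * (M * p_mass U p (\<lambda>x. H k x - G x)))
     \<longlonglongrightarrow> (1 - s) powr (1 - p) * m + s powr (1 - p) * (M * 0)"
    by (intro tendsto_intros lim m)
  from LIMSEQ_le_const[OF this] le show "energy G \<le> (1 - s) powr (1 - p) * m" by auto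
qed

lemma energy_uniformly_convex:
  assumes "0 < d"
  shows "\<exists>c>0. \<forall>G\<in>Lp_space U p. \<forall>H\<in>Lp_space U p.
    energy (\<lambda>x. G x - H x) \<le> d * (energy G + energy H)
      + c * ((energy G + energy H) / 2 - energy (\<lambda>x. (1/2) *\<^sub>R (G x + H x)))"
proof -
  obtain c where c: "c > 0" "\<And>a b :: real^'n. norm (a - b) powr p \<le> d * (norm a powr p + norm b powr p)
       + c * ((norm a powr p + norm b powr p) / 2 - norm ((1/2) *\<^sub>R (a + b)) powr p)"
    using norm_powr_uniformly_convex[OF p assms] by blast
  have "energy (\<lambda>x. G x - H x) \<le> d * (energy G + energy H)
      + c * ((energy G + energy H) / 2 - energy (\<lambda>x. (1/2) *\<^sub>R (G x + H x)))"
    if G: "G \<in> Lp_space U p" and H: "H \<in> Lp_space U p" for G H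
  proof -
    let ?e = "\<lambda>F x. \<sigma> x * norm (F x :: real^'n) powr p"
    let ?A = "\<lambda>x. (1/2) *\<^sub>R (G x + H x)"
    have A: "?A \<in> Lp_space U p" by (intro Lp_scaleR(1) Lp_add(1)[OF p0] G H)
    note I = energy_integrable[OF G] energy_integrable[OF H] energy_integrable[OF A]
    have "energy (\<lambda>x. G x - H x) \<le> (LINT x|lebesgue_on U. d * (?e G x + ?e H x) + c * ((?e G x + ?e H x) / 2 - ?e ?A x))"
      unfolding energy_def
    proof (rule integral_mono_AE)
      show "integrable (lebesgue_on U) (\<lambda>x. \<sigma> x * norm (G x - H x) powr p)"
        by (intro energy_integrable Lp_diff(1)[OF p0] G H)
      show "integrable (lebesgue_on U) (\<lambda>x. d * (?e G x + ?e H x) + c * ((?e G x + ?e H x) / 2 - ?e ?A x))"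
        by (intro Bochner_Integration.integrable_add Bochner_Integration.integrable_diff
            integrable_mult_right integrable_divide_zero I)
      show "AE x in lebesgue_on U. \<sigma> x * norm (G x - H x) powr p
          \<le> d * (?e G x + ?e H x) + c * ((?e G x + ?e H x) / 2 - ?e ?A x)"
        using \<sigma>_lower
      proof eventually_elim
        case (elim x)
        let ?a = "norm (G x) powr p" and ?b = "norm (H x) powr p" and ?m = "norm (?A x) powr p"
        have "\<sigma> x * norm (G x - H x) powr p \<le> \<sigma> x * (d * (?a + ?b) + c * ((?a + ?b) / 2 - ?m))"
          using elim \<epsilon> by (intro mult_left_mono c) auto
        also have "\<dots> = d * (\<sigma> x * ?a + \<sigma> x * ?b) + c * ((\<sigma> x * ?a + \<sigma> x * ?b) / 2 - \<sigma> x * ?m)"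
          by (simp only: distrib_left right_diff_distrib add_divide_distrib times_divide_eq_right mult_ac)
        finally show ?case .
      qed
    qed
    also have "\<dots> = d * (energy G + energy H) + c * ((energy G + energy H) / 2 - energy ?A)"
      unfolding energy_def using I by (simp del: norm_scaleR)
    finally show ?thesis .
  qed
  then show ?thesis using c(1) by blast
qed

lemma p_energy_form_lincomb:
  assumes u: "u \<in> W1p U p" and v: "v \<in> W1p U p" and z: "z \<in> W1p U p"
  shows "p_energy_form U p \<sigma> u (\<lambda>x. v x + c * z x) = p_energy_form U p \<sigma> u v + c * p_energy_form U p \<sigma> u z"
proof -
  let ?G = "wgrad u"
  note L = W1p_Lp(2)[OF u] W1p_Lp(2)[OF v] W1p_Lp(2)[OF z] W1p_Lp(2)[OF W1p_lincomb(1)[OF v z]]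
  note I = Lp_flux_integrable(1)[OF p L(1) L(2) \<sigma>_measurable \<sigma>_abs]
    Lp_flux_integrable(1)[OF p L(1) L(3) \<sigma>_measurable \<sigma>_abs]
  have ae: "AE x in lebesgue_on U. wgrad (\<lambda>x. v x + c * z x) x = wgrad v x + c *\<^sub>R wgrad z x"
    by (rule wgrad_AE_eq[OF W1p_lincomb(2)[OF v z]])
  have "p_energy_form U p \<sigma> u (\<lambda>x. v x + c * z x)
      = (LINT x|lebesgue_on U. \<sigma> x * norm (?G x) powr (p - 2) * (?G x \<bullet> wgrad v x)
          + c * (\<sigma> x * norm (?G x) powr (p - 2) * (?G x \<bullet> wgrad z x)))"
    unfolding p_energy_form_def
  proof (rule integral_cong_AE)
    show "AE x in lebesgue_on U. \<sigma> x * norm (?G x) powr (p - 2) * (?G x \<bullet> wgrad (\<lambda>x. v x + c * z x) x)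
      = \<sigma> x * norm (?G x) powr (p - 2) * (?G x \<bullet> wgrad v x)
          + c * (\<sigma> x * norm (?G x) powr (p - 2) * (?G x \<bullet> wgrad z x))"
      using ae
    proof eventually_elim
      case (elim x)
      show ?case unfolding elim by (simp add: inner_add_right algebra_simps)
    qed
  qed (use L[THEN Lp_spaceD(1)] \<sigma>_measurable in measurable)
  also have "\<dots> = p_energy_form U p \<sigma> u v + c * p_energy_form U p \<sigma> u z"
    using I by (simp add: p_energy_form_def)
  finally show ?thesis .
qed

lemma p_energy_form_self: "p_energy_form U p \<sigma> u u = energy (wgrad u)"
  unfolding p_energy_form_def energy_def
  by (intro Bochner_Integration.integral_cong refl) (metis mult.assoc norm_powr_p_flux(1)[OF p])

text \<open>
  The tangent inequality at \<open>\<nabla>u + t \<nabla>z\<close> and minimality of \<open>\<nabla>u\<close> give \<open>\<integral>\<sigma> |b|\<^sup>p\<^sup>-\<^sup>2 b \<bullet> \<nabla>z \<ge> 0\<close>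
  for \<open>b = \<nabla>u + t \<nabla>z\<close> and \<open>t > 0\<close>. Letting \<open>t\<close> tend to zero by dominated convergence, the
  energy form is nonnegative at \<open>z\<close>, and also at \<open>- z\<close>.
\<close>

lemma minimizer_is_weak_solution:
  assumes u: "u \<in> W1p U p"
    and min: "\<And>z t. z \<in> W1p_0 U p \<Longrightarrow> energy (wgrad u) \<le> energy (\<lambda>x. wgrad u x + t *\<^sub>R wgrad z x)"
  shows "weak_solution U p \<sigma> u"
proof -
  let ?G = "wgrad u"
  note G = W1p_Lp(2)[OF u]
  have nonneg: "0 \<le> p_energy_form U p \<sigma> u z" if z: "z \<in> W1p_0 U p" for z
  proof -
    have zW: "z \<in> W1p U p" using z by (simp add: W1p_0_iff)
    let ?Z = "wgrad z"
    note Z = W1p_Lp(2)[OF zW]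
    define t where "t = (\<lambda>k. inverse (real (Suc k)))"
    have t: "0 < t k" "t k \<le> 1" for k by (auto simp: t_def field_simps)
    define b where "b = (\<lambda>k x. ?G x + t k *\<^sub>R ?Z x)"
    have b: "b k \<in> Lp_space U p" for k unfolding b_def by (intro Lp_add(1)[OF p0] Lp_scaleR(1) G Z)
    define I where "I = (\<lambda>B x. \<sigma> x * norm (B x) powr (p - 2) * (B x \<bullet> ?Z x))"
    have Ii: "integrable (lebesgue_on U) (I B)" if "B \<in> Lp_space U p" for B
      unfolding I_def by (rule Lp_flux_integrable(1)[OF p that Z \<sigma>_measurable \<sigma>_abs])
    have pos: "0 \<le> integral\<^sup>L (lebesgue_on U) (I (b k))" for k
    proof -
      have "(LINT x|lebesgue_on U. \<sigma> x * norm (b k x) powr p - p * t k * I (b k) x) \<le> energy ?G"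
        unfolding energy_def
      proof (rule integral_mono_AE)
        show "integrable (lebesgue_on U) (\<lambda>x. \<sigma> x * norm (b k x) powr p - p * t k * I (b k) x)"
          using energy_integrable[OF b] Ii[OF b] by simp
        show "integrable (lebesgue_on U) (\<lambda>x. \<sigma> x * norm (?G x) powr p)" by (rule energy_integrable[OF G])
        show "AE x in lebesgue_on U. \<sigma> x * norm (b k x) powr p - p * t k * I (b k) x \<le> \<sigma> x * norm (?G x) powr p"
          using \<sigma>_lower
        proof eventually_elim
          case (elim x)
          let ?b = "b k x"
          have Gx: "?G x = ?b - t k *\<^sub>R ?Z x" by (simp add: b_def)
          have "p * (norm ?b powr (p - 2) * (?b \<bullet> ?G x)) - (p - 1) * norm ?b powr p \<le> norm (?G x) powr p"
            by (rule norm_powr_tangent(1)[OF p])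
          moreover have "p * (norm ?b powr (p - 2) * (?b \<bullet> ?G x))
             = p * (norm ?b powr (p - 2) * (?b \<bullet> ?b)) - p * t k * (norm ?b powr (p - 2) * (?b \<bullet> ?Z x))"
            unfolding Gx by (simp add: inner_diff_right algebra_simps)
          ultimately have "norm ?b powr p - p * t k * (norm ?b powr (p - 2) * (?b \<bullet> ?Z x)) \<le> norm (?G x) powr p"
            unfolding norm_powr_p_flux(1)[OF p] by (simp add: algebra_simps)
          then have "\<sigma> x * (norm ?b powr p - p * t k * (norm ?b powr (p - 2) * (?b \<bullet> ?Z x))) \<le> \<sigma> x * norm (?G x) powr p"
            using elim \<epsilon> by (intro mult_left_mono) auto
          then show ?case by (simp add: I_def algebra_simps)
        qed
      qed
      moreover have "(LINT x|lebesgue_on U. \<sigma> x * norm (b k x) powr p - p * t k * I (b k) x)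
          = energy (b k) - p * t k * integral\<^sup>L (lebesgue_on U) (I (b k))"
        using energy_integrable[OF b] Ii[OF b] by (simp add: energy_def)
      moreover have "energy ?G \<le> energy (b k)" unfolding b_def by (rule min[OF z])
      ultimately have "0 \<le> p * t k * integral\<^sup>L (lebesgue_on U) (I (b k))" by linarith
      moreover have "0 < p * t k" using p t by simp
      ultimately show ?thesis by (simp add: zero_le_mult_iff)
    qed
    have "(\<lambda>k. integral\<^sup>L (lebesgue_on U) (I (b k))) \<longlonglongrightarrow> integral\<^sup>L (lebesgue_on U) (I ?G)"
    proof (rule integral_dominated_convergence)
      show "I ?G \<in> borel_measurable (lebesgue_on U)" "\<And>k. I (b k) \<in> borel_measurable (lebesgue_on U)"
        using Ii[OF G] Ii[OF b] by blast+
      show "integrable (lebesgue_on U) (\<lambda>x. M * ((2 powr p + 1) * (norm (?G x) powr p + norm (?Z x) powr p)))"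
        using Lp_spaceD[OF G] Lp_spaceD[OF Z] by simp
      show "AE x in lebesgue_on U. (\<lambda>k. I (b k) x) \<longlonglongrightarrow> I ?G x"
      proof (rule AE_I2)
        fix x
        have "t \<longlonglongrightarrow> 0" unfolding t_def by (rule LIMSEQ_inverse_real_of_nat)
        then have "(\<lambda>k. b k x) \<longlonglongrightarrow> ?G x + 0 *\<^sub>R ?Z x" unfolding b_def by (intro tendsto_intros)
        then have "(\<lambda>k. b k x) \<longlonglongrightarrow> ?G x" by simp
        moreover have "isCont (\<lambda>b::real^'n. norm b powr (p - 2) *\<^sub>R b) (?G x)"
          using continuous_on_p_flux[OF p, where 'b = "real^'n"] by (simp add: continuous_on_eq_continuous_at)
        ultimately have "(\<lambda>k. norm (b k x) powr (p - 2) *\<^sub>R b k x) \<longlonglongrightarrow> norm (?G x) powr (p - 2) *\<^sub>R ?G x"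
          by (rule isCont_tendsto_compose[rotated])
        then have "(\<lambda>k. \<sigma> x * ((norm (b k x) powr (p - 2) *\<^sub>R b k x) \<bullet> ?Z x)) \<longlonglongrightarrow> \<sigma> x * ((norm (?G x) powr (p - 2) *\<^sub>R ?G x) \<bullet> ?Z x)"
          by (intro tendsto_mult tendsto_inner tendsto_const)
        then show "(\<lambda>k. I (b k) x) \<longlonglongrightarrow> I ?G x" by (simp add: I_def mult.assoc)
      qed
      show "AE x in lebesgue_on U. norm (I (b k) x) \<le> M * ((2 powr p + 1) * (norm (?G x) powr p + norm (?Z x) powr p))" for k
        using \<sigma>_abs
      proof eventually_elim
        case (elim x)
        let ?b = "b k x"
        have "\<bar>(norm ?b powr (p - 2) *\<^sub>R ?b) \<bullet> ?Z x\<bar> \<le> norm (norm ?b powr (p - 2) *\<^sub>R ?b) * norm (?Z x)"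
          by (rule Cauchy_Schwarz_ineq2)
        also have "\<dots> = norm ?b powr (p - 1) * norm (?Z x)" unfolding norm_powr_p_flux(2)[OF p] ..
        also have "\<dots> \<le> norm ?b powr p + norm (?Z x) powr p"
          using young_powr[OF p, of "norm ?b" "norm (?Z x)" 1] by simp
        also have "norm ?b powr p \<le> 2 powr p * (norm (?G x) powr p + norm (t k *\<^sub>R ?Z x) powr p)"
          unfolding b_def by (rule norm_add_powr_le[OF p0])
        also have "norm (t k *\<^sub>R ?Z x) powr p \<le> norm (?Z x) powr p"
          using t[of k] p by (intro powr_mono2) (auto simp: mult_left_le_one_le)
        finally have "\<bar>(norm ?b powr (p - 2) *\<^sub>R ?b) \<bullet> ?Z x\<bar>
            \<le> 2 powr p * (norm (?G x) powr p + norm (?Z x) powr p) + norm (?Z x) powr p" by simp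
        also have "\<dots> \<le> (2 powr p + 1) * (norm (?G x) powr p + norm (?Z x) powr p)"
          by (simp add: distrib_right)
        finally have *: "\<bar>(norm ?b powr (p - 2) *\<^sub>R ?b) \<bullet> ?Z x\<bar> \<le> \<dots>" .
        have "norm (I (b k) x) = \<bar>\<sigma> x\<bar> * \<bar>(norm ?b powr (p - 2) *\<^sub>R ?b) \<bullet> ?Z x\<bar>"
          by (simp add: I_def abs_mult mult.assoc)
        also have "\<dots> \<le> M * ((2 powr p + 1) * (norm (?G x) powr p + norm (?Z x) powr p))"
          using elim M_nonneg by (intro mult_mono *) auto
        finally show ?case .
      qed
    qed
    then have "0 \<le> integral\<^sup>L (lebesgue_on U) (I ?G)"
      by (rule LIMSEQ_le_const) (use pos in auto)
    then show ?thesis by (simp add: p_energy_form_def I_def)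
  qed
  have "p_energy_form U p \<sigma> u z = 0" if z: "z \<in> W1p_0 U p" for z
  proof -
    have zW: "z \<in> W1p U p" using z by (simp add: W1p_0_iff)
    \<comment> \<open>The function \<open>z + (- 2) z\<close> is \<open>- z\<close>, written in the form of \<open>W1p_0_lincomb\<close>.\<close>
    have "0 \<le> p_energy_form U p \<sigma> u (\<lambda>x. z x + (- 2) * z x)"
      by (intro nonneg W1p_0_lincomb z)
    then show ?thesis
      using nonneg[OF z] unfolding p_energy_form_lincomb[OF u zW zW] by simp
  qed
  then show ?thesis using u by (simp add: weak_solution_def)
qed

text \<open>
  The energy is minimized over \<open>f + \<phi>\<close> with test functions \<open>\<phi>\<close>. The limit of a minimizing
  sequence is \<open>f + w\<close> with \<open>w\<close> in \<open>W1p_0\<close>, and by density its energy is minimal among all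
  \<open>f + y\<close> with \<open>y\<close> in \<open>W1p_0\<close>.
\<close>

theorem weak_solution_exists:
  assumes f: "f \<in> W1p U p"
  shows "\<exists>u. weak_solution U p \<sigma> u \<and> (\<lambda>x. f x - u x) \<in> W1p_0 U p"
proof -
  let ?F = "wgrad f" and ?T = "test_functions U"
  note F = W1p_Lp(2)[OF f]
  define E where "E = (\<lambda>\<phi>. energy (\<lambda>x. ?F x + grad \<phi> x))"
  have FT: "(\<lambda>x. ?F x + grad \<phi> x) \<in> Lp_space U p" if "\<phi> \<in> ?T" for \<phi>
    by (intro Lp_add(1)[OF p0] F C1_W1p(3) test_function_C1[OF that])
  define m where "m = Inf (E ` ?T)"
  have zero: "(\<lambda>_. 0) \<in> ?T" by (simp add: test_functions_def Ck_const)
  have bdd: "bdd_below (E ` ?T)" by (intro bdd_belowI[of _ 0]) (auto simp: E_def energy_nonneg)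
  have mE: "m \<le> E \<phi>" if "\<phi> \<in> ?T" for \<phi>
    unfolding m_def using bdd that by (intro cInf_lower) auto
  have m0: "0 \<le> m" unfolding m_def using zero by (intro cInf_greatest) (auto simp: E_def energy_nonneg)
  have "\<exists>\<phi>\<in>?T. E \<phi> < m + inverse (real (Suc k))" for k
  proof -
    have "Inf (E ` ?T) < m + inverse (real (Suc k))" by (simp add: m_def)
    then show ?thesis using zero bdd by (subst (asm) cInf_less_iff) auto
  qed
  then obtain \<phi> where \<phi>: "\<And>k. \<phi> k \<in> ?T" "\<And>k. E (\<phi> k) < m + inverse (real (Suc k))" by metis
  define G where "G = (\<lambda>k x. ?F x + grad (\<phi> k) x)"
  have G: "G k \<in> Lp_space U p" for k unfolding G_def by (rule FT[OF \<phi>(1)])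
  have EG: "energy (G k) = E (\<phi> k)" for k by (simp add: E_def G_def)
  \<comment> \<open>Uniform convexity forces the gradients of a minimizing sequence to converge.\<close>
  have cauchy: "\<exists>N. \<forall>k\<ge>N. \<forall>l\<ge>N. p_mass U p (\<lambda>x. grad (\<phi> k) x - grad (\<phi> l) x) < e" if e: "0 < e" for e
  proof -
    define d where "d = e * \<epsilon> / (4 * (m + 1))"
    have d: "0 < d" using e \<epsilon> m0 by (simp add: d_def)
    obtain c where c: "c > 0" "\<And>G H. G \<in> Lp_space U p \<Longrightarrow> H \<in> Lp_space U p \<Longrightarrow>
      energy (\<lambda>x. G x - H x) \<le> d * (energy G + energy H)
      + c * ((energy G + energy H) / 2 - energy (\<lambda>x. (1/2) *\<^sub>R (G x + H x)))"
      using energy_uniformly_convex[OF d] by blast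
    obtain N where N: "inverse (real (Suc N)) < e * \<epsilon> / (2 * c)"
      using reals_Archimedean[of "e * \<epsilon> / (2 * c)"] e \<epsilon> c(1) by auto
    have "p_mass U p (\<lambda>x. grad (\<phi> k) x - grad (\<phi> l) x) < e" if kl: "N \<le> k" "N \<le> l" for k l
    proof -
      have Ek: "energy (G j) \<le> m + inverse (real (Suc N))" "energy (G j) \<le> m + 1" if "N \<le> j" for j
      proof -
        have "inverse (real (Suc j)) \<le> inverse (real (Suc N))" using that by (simp add: field_simps)
        moreover have "inverse (real (Suc j)) \<le> 1" by (simp add: field_simps)
        ultimately show "energy (G j) \<le> m + inverse (real (Suc N))" "energy (G j) \<le> m + 1"
          using \<phi>(2)[of j] unfolding EG by linarith+
      qed
      \<comment> \<open>The mean of \<open>\<phi> k\<close> and \<open>\<phi> l\<close> is again a competitor, so its energy is at least \<open>m\<close>.\<close>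
      define \<psi> where "\<psi> = (\<lambda>x. \<phi> k x + (-1/2) * (\<phi> k x + (-1) * \<phi> l x))"
      have T: "(\<lambda>x. \<phi> k x + (-1) * \<phi> l x) \<in> ?T" by (rule test_function_lincomb(1)[OF \<phi>(1) \<phi>(1)])
      have \<psi>: "\<psi> \<in> ?T" unfolding \<psi>_def by (rule test_function_lincomb(1)[OF \<phi>(1) T])
      have g\<psi>: "grad \<psi> x = grad (\<phi> k) x + (-1/2) *\<^sub>R (grad (\<phi> k) x + (-1) *\<^sub>R grad (\<phi> l) x)" for x
        unfolding \<psi>_def test_function_lincomb(2)[OF \<phi>(1) T] test_function_lincomb(2)[OF \<phi>(1) \<phi>(1)] ..
      have "(\<lambda>x. (1/2) *\<^sub>R (G k x + G l x)) = (\<lambda>x. ?F x + grad \<psi> x)"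
        unfolding g\<psi> by (auto simp: G_def vec_eq_iff field_simps)
      then have mid: "m \<le> energy (\<lambda>x. (1/2) *\<^sub>R (G k x + G l x))"
        using mE[OF \<psi>] by (simp add: E_def)
      have "\<epsilon> * p_mass U p (\<lambda>x. G k x - G l x) \<le> energy (\<lambda>x. G k x - G l x)"
        by (intro p_mass_le_energy Lp_diff(1)[OF p0] G)
      also have "\<dots> \<le> d * (energy (G k) + energy (G l))
          + c * ((energy (G k) + energy (G l)) / 2 - energy (\<lambda>x. (1/2) *\<^sub>R (G k x + G l x)))"
        by (rule c(2)[OF G G])
      also have "\<dots> \<le> d * ((m + 1) + (m + 1)) + c * inverse (real (Suc N))"
      proof (intro add_mono mult_left_mono)
        show "(energy (G k) + energy (G l)) / 2 - energy (\<lambda>x. (1/2) *\<^sub>R (G k x + G l x)) \<le> inverse (real (Suc N))"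
          using mid Ek(1)[OF kl(1)] Ek(1)[OF kl(2)] by argo
      qed (use Ek(2)[OF kl(1)] Ek(2)[OF kl(2)] d c in auto)
      also have "\<dots> < d * ((m + 1) + (m + 1)) + c * (e * \<epsilon> / (2 * c))"
        by (intro add_strict_left_mono mult_strict_left_mono N c(1))
      also have "\<dots> = \<epsilon> * e"
      proof -
        have "m + 1 \<noteq> 0" using m0 by simp
        then have A: "d * ((m + 1) + (m + 1)) = e * \<epsilon> / 2"
          unfolding d_def mult_2[symmetric] by (simp del: distrib_left_numeral)
        have B: "c * (e * \<epsilon> / (2 * c)) = e * \<epsilon> / 2" using c(1) by simp
        show ?thesis unfolding A B by simp
      qed
      finally have "p_mass U p (\<lambda>x. G k x - G l x) < e" using \<epsilon> by simp
      then show ?thesis by (simp add: G_def)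
    qed
    then show ?thesis by blast
  qed
  have gL: "grad (\<phi> k) \<in> Lp_space U p" for k by (rule C1_W1p(3)[OF test_function_C1[OF \<phi>(1)]])
  obtain H where H: "H \<in> Lp_space U p" "(\<lambda>k. p_mass U p (\<lambda>x. grad (\<phi> k) x - H x)) \<longlonglongrightarrow> 0"
    using Lp_complete[OF p gL cauchy] by blast
  obtain C where C: "C > 0" "\<And>\<phi>. \<phi> \<in> ?T \<Longrightarrow> p_mass U p \<phi> \<le> C * p_mass U p (grad \<phi>)"
    using poincare by blast
  have cauchy': "\<exists>N. \<forall>k\<ge>N. \<forall>l\<ge>N. p_mass U p (\<lambda>x. \<phi> k x - \<phi> l x) < e" if e: "0 < e" for e
  proof -
    have le: "p_mass U p (\<lambda>x. \<phi> k x - \<phi> l x) \<le> C * p_mass U p (\<lambda>x. grad (\<phi> k) x - grad (\<phi> l) x)" for k l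
      using C(2)[OF test_function_lincomb(1)[OF \<phi>(1)[of k] \<phi>(1)[of l], of "-1"]]
      unfolding test_function_lincomb(2)[OF \<phi>(1)[of k] \<phi>(1)[of l], of "-1"] by simp
    have "0 < e / C" using e C(1) by simp
    from cauchy[OF this] obtain N where N: "\<forall>k\<ge>N. \<forall>l\<ge>N. p_mass U p (\<lambda>x. grad (\<phi> k) x - grad (\<phi> l) x) < e / C" ..
    have "p_mass U p (\<lambda>x. \<phi> k x - \<phi> l x) < e" if "N \<le> k" "N \<le> l" for k l
    proof -
      have "p_mass U p (\<lambda>x. grad (\<phi> k) x - grad (\<phi> l) x) < e / C" using N that by blast
      then have "C * p_mass U p (\<lambda>x. grad (\<phi> k) x - grad (\<phi> l) x) < e" using C(1) by (simp add: field_simps)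
      then show ?thesis using le[of k l] by linarith
    qed
    then show ?thesis by blast
  qed
  have fL: "\<phi> k \<in> Lp_space U p" for k by (rule W1p_Lp(1)[OF C1_W1p(1)[OF test_function_C1[OF \<phi>(1)]]])
  obtain w where w: "w \<in> Lp_space U p" "(\<lambda>k. p_mass U p (\<lambda>x. \<phi> k x - w x)) \<longlonglongrightarrow> 0"
    using Lp_complete[OF p fL cauchy'] by blast
  note lim = W1p_0_limit[OF \<phi>(1) w H]
  have wW: "w \<in> W1p U p" using lim(2) by (simp add: W1p_0_iff)
  have FH: "(\<lambda>x. ?F x + H x) \<in> Lp_space U p" by (intro Lp_add(1)[OF p0] F H)
  have upper: "energy (\<lambda>x. ?F x + H x) \<le> m"
  proof (rule energy_upper_bound_limit[OF FH G])
    show "(\<lambda>k. p_mass U p (\<lambda>x. G k x - (?F x + H x))) \<longlonglongrightarrow> 0" using H(2) by (simp add: G_def)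
    have "(\<lambda>k. m + inverse (real (Suc k))) \<longlonglongrightarrow> m + 0" by (intro tendsto_intros LIMSEQ_inverse_real_of_nat)
    then show "(\<lambda>k. energy (G k)) \<longlonglongrightarrow> m"
      unfolding EG using \<phi> mE
      by (intro tendsto_sandwich[OF _ _ tendsto_const, of m "\<lambda>k. E (\<phi> k)"]) (auto intro!: always_eventually less_imp_le)
  qed
  have lower: "m \<le> energy (\<lambda>x. ?F x + wgrad y x)" if y: "y \<in> W1p_0 U p" for y
  proof -
    have yW: "y \<in> W1p U p" using y by (simp add: W1p_0_iff)
    have "\<exists>\<eta>\<in>?T. p_mass U p (\<lambda>x. wgrad y x - grad \<eta> x) < inverse (real (Suc k))" for k
      using W1p_0_approx[OF y, of "inverse (real (Suc k))"] by auto
    then obtain \<eta> where \<eta>: "\<And>k. \<eta> k \<in> ?T" "\<And>k. p_mass U p (\<lambda>x. wgrad y x - grad (\<eta> k) x) < inverse (real (Suc k))"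
      by metis
    show ?thesis
    proof (rule energy_lower_bound_limit)
      show "(\<lambda>x. ?F x + wgrad y x) \<in> Lp_space U p" by (intro Lp_add(1)[OF p0] F W1p_Lp(2)[OF yW])
      show "(\<lambda>x. ?F x + grad (\<eta> k) x) \<in> Lp_space U p" for k by (rule FT[OF \<eta>(1)])
      have sym: "p_mass U p (\<lambda>x. (?F x + grad (\<eta> k) x) - (?F x + wgrad y x)) = p_mass U p (\<lambda>x. wgrad y x - grad (\<eta> k) x)" for k
        by (simp add: p_mass_def norm_minus_commute)
      show "(\<lambda>k. p_mass U p (\<lambda>x. (?F x + grad (\<eta> k) x) - (?F x + wgrad y x))) \<longlonglongrightarrow> 0"
        unfolding sym using \<eta>(2)
        by (intro tendsto_sandwich[OF _ _ tendsto_const LIMSEQ_inverse_real_of_nat])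
           (auto intro!: always_eventually less_imp_le p_mass_nonneg)
      show "m \<le> energy (\<lambda>x. ?F x + grad (\<eta> k) x)" for k using mE[OF \<eta>(1)[of k]] by (simp add: E_def)
    qed
  qed
  define u where "u = (\<lambda>x. f x + 1 * w x)"
  have uW: "u \<in> W1p U p" unfolding u_def by (rule W1p_lincomb(1)[OF f wW])
  have "has_weak_gradient U u (\<lambda>x. ?F x + 1 *\<^sub>R H x)"
    unfolding u_def by (rule has_weak_gradient_lincomb[OF open_U W1p_has_weak_gradient[OF f] lim(1)])
  from wgrad_AE_eq[OF this] have uAE: "AE x in lebesgue_on U. wgrad u x = ?F x + H x" by simp
  have wAE: "AE x in lebesgue_on U. wgrad w x = H x" by (rule wgrad_AE_eq[OF lim(1)])
  note meas = Lp_spaceD(1)[OF F] Lp_spaceD(1)[OF W1p_Lp(2)[OF uW]] Lp_spaceD(1)[OF FH]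
  have "weak_solution U p \<sigma> u"
  proof (rule minimizer_is_weak_solution[OF uW])
    fix z t assume z: "z \<in> W1p_0 U p"
    have zW: "z \<in> W1p U p" using z by (simp add: W1p_0_iff)
    have y: "(\<lambda>x. w x + t * z x) \<in> W1p_0 U p" by (rule W1p_0_lincomb[OF lim(2) z])
    then have yW: "(\<lambda>x. w x + t * z x) \<in> W1p U p" by (simp add: W1p_0_iff)
    have yAE: "AE x in lebesgue_on U. wgrad (\<lambda>x. w x + t * z x) x = wgrad w x + t *\<^sub>R wgrad z x"
      by (rule wgrad_AE_eq[OF W1p_lincomb(2)[OF wW zW]])
    have "energy (wgrad u) = energy (\<lambda>x. ?F x + H x)"
      by (rule energy_AE_cong[OF meas(2,3) uAE])
    also have "\<dots> \<le> m" by (rule upper)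
    also have "m \<le> energy (\<lambda>x. ?F x + wgrad (\<lambda>x. w x + t * z x) x)" by (rule lower[OF y])
    also have "\<dots> = energy (\<lambda>x. wgrad u x + t *\<^sub>R wgrad z x)"
    proof (rule energy_AE_cong)
      show "AE x in lebesgue_on U. ?F x + wgrad (\<lambda>x. w x + t * z x) x = wgrad u x + t *\<^sub>R wgrad z x"
        using uAE yAE wAE by eventually_elim simp
    qed (use meas Lp_spaceD(1)[OF W1p_Lp(2)[OF yW]] Lp_spaceD(1)[OF W1p_Lp(2)[OF zW]] in measurable)
    finally show "energy (wgrad u) \<le> energy (\<lambda>x. wgrad u x + t *\<^sub>R wgrad z x)" .
  qed
  moreover have "(\<lambda>x. f x - u x) = (\<lambda>x. w x + (- 2) * w x)" by (auto simp: u_def)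
  then have "(\<lambda>x. f x - u x) \<in> W1p_0 U p" using W1p_0_lincomb[OF lim(2) lim(2), of "-2"] by simp
  ultimately show ?thesis by blast
qed

end

section \<open>Oscillating exponential \<open>p\<close>-harmonic functions\<close>

text \<open>
  For \<open>v = exp (x) w (y)\<close>, the \<open>p\<close>-Laplace equation is the ordinary differential equation
  \<open>(S w')' + (p - 1) S w = 0\<close> with \<open>S = (w\<^sup>2 + w'\<^sup>2) powr ((p - 2) / 2)\<close>. In polar coordinates
  \<open>w = r cos \<theta>\<close>, \<open>w' = - r sin \<theta>\<close> it becomes \<open>dy/d\<theta> = sin\<^sup>2 \<theta> + cos\<^sup>2 \<theta> / (p - 1)\<close> and
  \<open>ln r = (p - 2) / (2 (p - 1)) sin\<^sup>2 \<theta>\<close>, up to constants. The function below is the resulting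
  \<open>y\<close> in terms of \<open>\<theta>\<close>.
\<close>

definition wolff_phase :: "real \<Rightarrow> real \<Rightarrow> real" where
  "wolff_phase p \<theta> = \<theta> / 2 * (1 + 1 / (p - 1)) + sin (2 * \<theta>) / 4 * (1 / (p - 1) - 1)"

lemma wolff_phase_has_real_derivative:
  "(wolff_phase p has_real_derivative (sin \<theta>)\<^sup>2 + (cos \<theta>)\<^sup>2 / (p - 1)) (at \<theta>)"
proof -
  have "(wolff_phase p has_real_derivative 1 / 2 * (1 + 1 / (p - 1)) + cos (2 * \<theta>) * 2 / 4 * (1 / (p - 1) - 1)) (at \<theta>)"
    unfolding wolff_phase_def[abs_def] by (auto intro!: derivative_eq_intros)
  moreover have "1 / 2 * (1 + k) + cos (2 * \<theta>) * 2 / 4 * (k - 1) = (sin \<theta>)\<^sup>2 + (cos \<theta>)\<^sup>2 * k" for k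
  proof -
    have s: "(sin \<theta>)\<^sup>2 = 1 - (cos \<theta>)\<^sup>2" by (simp add: sin_squared_eq)
    have c: "cos (2 * \<theta>) = 2 * (cos \<theta>)\<^sup>2 - 1" by (simp add: cos_double_cos)
    show ?thesis unfolding s c by algebra
  qed
  from this[of "1 / (p - 1)"] have "1 / 2 * (1 + 1 / (p - 1)) + cos (2 * \<theta>) * 2 / 4 * (1 / (p - 1) - 1)
     = (sin \<theta>)\<^sup>2 + (cos \<theta>)\<^sup>2 / (p - 1)" by simp
  ultimately show ?thesis by simp
qed

text \<open>
  The derivative of the phase is at least \<open>min 1 (1 / (p - 1)) > 0\<close>, so the phase is a
  bijection of the real line with a Lipschitz inverse.
\<close>

lemma wolff_phase_inverse:
  assumes "1 < p"
  obtains \<Theta> where "\<And>y. (\<Theta> has_real_derivative 1 / ((sin (\<Theta> y))\<^sup>2 + (cos (\<Theta> y))\<^sup>2 / (p - 1))) (at y)"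
proof -
  let ?Y = "wolff_phase p" and ?d = "\<lambda>\<theta>. (sin \<theta>)\<^sup>2 + (cos \<theta>)\<^sup>2 / (p - 1)"
  define c where "c = min 1 (1 / (p - 1))"
  have c: "0 < c" using assms by (simp add: c_def)
  have dc: "c \<le> ?d \<theta>" for \<theta>
  proof -
    have "c * (sin \<theta>)\<^sup>2 + c * (cos \<theta>)\<^sup>2 \<le> 1 * (sin \<theta>)\<^sup>2 + (1 / (p - 1)) * (cos \<theta>)\<^sup>2"
      unfolding c_def by (intro add_mono mult_right_mono) auto
    moreover have "c * (sin \<theta>)\<^sup>2 + c * (cos \<theta>)\<^sup>2 = c"
      by (simp flip: distrib_left)
    ultimately show ?thesis by simp
  qed
  have growth: "c * (b - a) \<le> ?Y b - ?Y a" if "a \<le> b" for a b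
  proof (cases "a = b")
    case False
    then have "a < b" using that by simp
    from MVT2[OF this, of ?Y ?d] wolff_phase_has_real_derivative
    obtain z where "?Y b - ?Y a = (b - a) * ?d z" by blast
    moreover have "(b - a) * c \<le> (b - a) * ?d z" using \<open>a < b\<close> dc[of z] by (intro mult_left_mono) auto
    ultimately show ?thesis by (simp add: mult.commute)
  qed simp
  have cont: "continuous_on UNIV ?Y"
    using DERIV_isCont[OF wolff_phase_has_real_derivative] by (intro continuous_at_imp_continuous_on) auto
  have inj: "a = b" if "?Y a = ?Y b" for a b
  proof (rule ccontr)
    assume "a \<noteq> b"
    then consider "a < b" | "b < a" by linarith
    then show False
    proof cases
      case 1
      then have "0 < c * (b - a)" using c by simp
      then show False using growth[of a b] 1 that by simp
    next
      case 2
      then have "0 < c * (a - b)" using c by simp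
      then show False using growth[of b a] 2 that by simp
    qed
  qed
  have surj: "\<exists>\<theta>. ?Y \<theta> = y" for y
  proof -
    define b where "b = \<bar>y\<bar> / c"
    have b: "0 \<le> b" "c * b = \<bar>y\<bar>" using c by (auto simp: b_def)
    have Y0: "?Y 0 = 0" by (simp add: wolff_phase_def)
    have "y \<le> ?Y b" using growth[of 0 b] b Y0 by simp
    moreover have "?Y (- b) \<le> y" using growth[of "- b" 0] b Y0 by simp
    ultimately show ?thesis
      using IVT'[of ?Y "- b" y b] b continuous_on_subset[OF cont] by auto
  qed
  define \<Theta> where "\<Theta> = (\<lambda>y. SOME \<theta>. ?Y \<theta> = y)"
  have Y\<Theta>: "?Y (\<Theta> y) = y" for y unfolding \<Theta>_def using surj by (rule someI_ex)
  have \<Theta>Y: "\<Theta> (?Y \<theta>) = \<theta>" for \<theta> using Y\<Theta>[of "?Y \<theta>"] by (rule inj)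
  have lip: "c * \<bar>\<Theta> y - \<Theta> z\<bar> \<le> \<bar>y - z\<bar>" for y z
    using growth[of "\<Theta> z" "\<Theta> y"] growth[of "\<Theta> y" "\<Theta> z"] Y\<Theta>[of y] Y\<Theta>[of z]
    by (cases "\<Theta> z \<le> \<Theta> y") (auto simp: abs_if)
  have "isCont \<Theta> y" for y
  proof -
    have "((\<lambda>z. \<bar>z - y\<bar> / c) \<longlongrightarrow> \<bar>y - y\<bar> / c) (at y)" using c by (intro tendsto_intros) auto
    then have "((\<lambda>z. \<bar>z - y\<bar> / c) \<longlongrightarrow> 0) (at y)" by simp
    then have "((\<lambda>z. \<Theta> z - \<Theta> y) \<longlongrightarrow> 0) (at y)"
      by (rule Lim_null_comparison[rotated])
         (use lip c in \<open>auto intro!: always_eventually simp: field_simps\<close>)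
    then show ?thesis by (simp add: isCont_def LIM_zero_iff)
  qed
  then have "(\<Theta> has_real_derivative inverse (?d (\<Theta> y))) (at y)" for y
    using dc[of "\<Theta> y"] c Y\<Theta>
    by (intro DERIV_inverse_function[where f = ?Y and a = "y - 1" and b = "y + 1"] wolff_phase_has_real_derivative) auto
  then show ?thesis by (intro that[of \<Theta>]) (simp add: inverse_eq_divide)
qed

text \<open>
  Here \<open>z\<close> is the derivative of \<open>w\<close>, \<open>r\<close> is the modulus of \<open>(w, z)\<close>, and \<open>(A, B)\<close> is the flux
  \<open>r powr (p - 2) (w, z)\<close>; the derivative of \<open>B\<close> encodes the differential equation for \<open>w\<close>.
\<close>

lemma wolff_profile:
  fixes p :: real
  assumes p: "1 < p"
  obtains w z r A A' B :: "real \<Rightarrow> real" and c C :: real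
  where "\<And>y. (w has_real_derivative z y) (at y)"
    and "\<And>y. (w y)\<^sup>2 + (z y)\<^sup>2 = (r y)\<^sup>2"
    and "0 < c" "\<And>y. c \<le> r y" "\<And>y. r y \<le> C"
    and "\<And>y. A y = r y powr (p - 2) * w y"
    and "\<And>y. B y = r y powr (p - 2) * z y"
    and "\<And>y. (A has_real_derivative A' y) (at y)"
    and "\<And>y. (B has_real_derivative - (p - 1) * A y) (at y)"
    and "continuous_on UNIV A'" "continuous_on UNIV z"
proof -
  obtain \<Theta> where \<Theta>: "\<And>y. (\<Theta> has_real_derivative 1 / ((sin (\<Theta> y))\<^sup>2 + (cos (\<Theta> y))\<^sup>2 / (p - 1))) (at y)"
    using wolff_phase_inverse[OF p] by blast
  define k where "k = (p - 2) / (2 * (p - 1))"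
  have k: "2 * (p - 1) * k = p - 2" using p by (simp add: k_def)
  define D where "D = (\<lambda>\<theta>. 1 / ((sin \<theta>)\<^sup>2 + (cos \<theta>)\<^sup>2 / (p - 1)))"
  have pos: "0 < (sin \<theta>)\<^sup>2 + (cos \<theta>)\<^sup>2 / (p - 1)" for \<theta>
  proof (cases "sin \<theta> = 0")
    case True
    then have "(cos \<theta>)\<^sup>2 = 1" using sin_cos_squared_add[of \<theta>] by simp
    then show ?thesis using p True by simp
  next
    case False
    then show ?thesis using p by (intro add_pos_nonneg) auto
  qed
  have D: "((sin \<theta>)\<^sup>2 * (p - 1) + (cos \<theta>)\<^sup>2) * D \<theta> = p - 1" for \<theta>
  proof -
    have "(sin \<theta>)\<^sup>2 * (p - 1) + (cos \<theta>)\<^sup>2 = (p - 1) * ((sin \<theta>)\<^sup>2 + (cos \<theta>)\<^sup>2 / (p - 1))"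
      using p by (simp add: field_simps)
    then show ?thesis using pos[of \<theta>] unfolding D_def by simp
  qed
  have \<Theta>': "(\<Theta> has_real_derivative D (\<Theta> y)) (at y)" for y using \<Theta> by (simp add: D_def)
  \<comment> \<open>\<open>E q\<close> is the power \<open>q\<close> of the modulus \<open>r\<close>; the exponents \<open>1\<close> and \<open>p - 1\<close> give \<open>w, z\<close> and \<open>A, B\<close>.\<close>
  define E where "E = (\<lambda>q \<theta>. exp (q * (k * (sin \<theta>)\<^sup>2)))"
  have E\<Theta>: "((\<lambda>y. E q (\<Theta> y)) has_real_derivative
      q * (k * (2 * sin (\<Theta> y) * cos (\<Theta> y))) * D (\<Theta> y) * E q (\<Theta> y)) (at y)" for q y
    unfolding E_def by (rule derivative_eq_intros \<Theta>' refl | simp)+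
  have cosd: "((\<lambda>y. E q (\<Theta> y) * cos (\<Theta> y)) has_real_derivative
      E q (\<Theta> y) * (D (\<Theta> y) * sin (\<Theta> y)) * (2 * q * k * (cos (\<Theta> y))\<^sup>2 - 1)) (at y)" for q y
    by (rule derivative_eq_intros E\<Theta> \<Theta>' refl)+ (simp add: algebra_simps power2_eq_square)
  have sind: "((\<lambda>y. - E q (\<Theta> y) * sin (\<Theta> y)) has_real_derivative
      - E q (\<Theta> y) * (D (\<Theta> y) * cos (\<Theta> y)) * (2 * q * k * (sin (\<Theta> y))\<^sup>2 + 1)) (at y)" for q y
    by (rule derivative_eq_intros E\<Theta> \<Theta>' refl)+ (simp add: algebra_simps power2_eq_square)
  have c\<Theta>: "continuous_on UNIV \<Theta>"
    using DERIV_isCont[OF \<Theta>'] by (intro continuous_at_imp_continuous_on) auto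
  have cE: "continuous_on UNIV (\<lambda>y. E q (\<Theta> y))" for q unfolding E_def by (intro continuous_intros c\<Theta>)
  have cD: "continuous_on UNIV (\<lambda>y. D (\<Theta> y))"
  proof -
    have "(sin \<theta>)\<^sup>2 + (cos \<theta>)\<^sup>2 / (p - 1) \<noteq> 0" for \<theta>
      using pos[of \<theta>] by simp
    then show ?thesis unfolding D_def using p by (intro continuous_intros c\<Theta>) auto
  qed
  let ?w = "\<lambda>y. E 1 (\<Theta> y) * cos (\<Theta> y)" and ?z = "\<lambda>y. - E 1 (\<Theta> y) * sin (\<Theta> y)"
    and ?A = "\<lambda>y. E (p - 1) (\<Theta> y) * cos (\<Theta> y)" and ?B = "\<lambda>y. - E (p - 1) (\<Theta> y) * sin (\<Theta> y)"
  show ?thesis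
  proof (rule that[where w = ?w and z = ?z and r = "\<lambda>y. E 1 (\<Theta> y)" and A = ?A and B = ?B
        and A' = "\<lambda>y. E (p - 1) (\<Theta> y) * (D (\<Theta> y) * sin (\<Theta> y)) * (2 * (p - 1) * k * (cos (\<Theta> y))\<^sup>2 - 1)"
        and c = "exp (- \<bar>k\<bar>)" and C = "exp \<bar>k\<bar>"])
    fix y
    let ?\<theta> = "\<Theta> y"
    let ?s = "sin ?\<theta>" and ?c = "cos ?\<theta>"
    have sc: "?c\<^sup>2 = 1 - ?s\<^sup>2" by (simp add: cos_squared_eq)
    have "2 * 1 * k * ?c\<^sup>2 - 1 = - ((?s\<^sup>2 * (p - 1) + ?c\<^sup>2) / (p - 1))"
    proof -
      have "(p - 1) * (2 * k * ?c\<^sup>2 - 1) = (2 * (p - 1) * k) * ?c\<^sup>2 - (p - 1)" by (simp add: algebra_simps)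
      also have "\<dots> = - (?s\<^sup>2 * (p - 1) + ?c\<^sup>2)" unfolding k sc by (simp add: algebra_simps)
      finally show ?thesis using p by (simp add: field_simps)
    qed
    moreover have "D ?\<theta> * ((?s\<^sup>2 * (p - 1) + ?c\<^sup>2) / (p - 1)) = 1"
      using D[of ?\<theta>] p by (simp add: mult.commute)
    ultimately have "D ?\<theta> * (2 * 1 * k * ?c\<^sup>2 - 1) = - 1" by simp
    then have "E 1 ?\<theta> * (D ?\<theta> * ?s) * (2 * 1 * k * ?c\<^sup>2 - 1) = - E 1 ?\<theta> * ?s"
      by (metis (no_types, opaque_lifting) mult.assoc mult.commute mult_minus1_right mult_minus_left)
    then show "(?w has_real_derivative ?z y) (at y)" using cosd[of 1 y] by simp
    show "(?w y)\<^sup>2 + (?z y)\<^sup>2 = (E 1 ?\<theta>)\<^sup>2"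
      by (simp add: power_mult_distrib flip: distrib_left)
    have "\<bar>k * ?s\<^sup>2\<bar> \<le> \<bar>k\<bar>"
      by (simp add: abs_mult mult_left_le abs_square_le_1)
    then show "exp (- \<bar>k\<bar>) \<le> E 1 ?\<theta>" "E 1 ?\<theta> \<le> exp \<bar>k\<bar>"
      unfolding E_def by (auto simp: abs_le_iff)
    have "E 1 ?\<theta> powr (p - 2) * E 1 ?\<theta> = E (p - 1) ?\<theta>"
      by (simp add: E_def powr_def algebra_simps flip: exp_add)
    then show "?A y = E 1 ?\<theta> powr (p - 2) * ?w y" "?B y = E 1 ?\<theta> powr (p - 2) * ?z y"
      by (simp_all add: mult.assoc[symmetric])
    show "(?A has_real_derivative E (p - 1) ?\<theta> * (D ?\<theta> * ?s) * (2 * (p - 1) * k * ?c\<^sup>2 - 1)) (at y)"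
      by (rule cosd)
    have "D ?\<theta> * (2 * (p - 1) * k * ?s\<^sup>2 + 1) = p - 1"
    proof -
      have "2 * (p - 1) * k * ?s\<^sup>2 + 1 = ?s\<^sup>2 * (p - 1) + ?c\<^sup>2" unfolding k sc by (simp add: algebra_simps)
      then show ?thesis using D[of ?\<theta>] by (simp add: mult.commute)
    qed
    moreover have "- E (p - 1) ?\<theta> * (D ?\<theta> * ?c) * (2 * (p - 1) * k * ?s\<^sup>2 + 1)
        = - (D ?\<theta> * (2 * (p - 1) * k * ?s\<^sup>2 + 1)) * (E (p - 1) ?\<theta> * ?c)"
      by (simp only: mult_ac mult_minus_left mult_minus_right)
    ultimately show "(?B has_real_derivative - (p - 1) * ?A y) (at y)"
      using sind[of "p - 1" y] by simp
  qed (auto intro!: continuous_intros cE cD c\<Theta>)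
qed

text \<open>
  Classical solutions of the equation with conductivity \<open>1\<close>, with a flux that is itself of
  class \<open>C\<^sup>1\<close>.
\<close>

definition p_harmonic :: "real \<Rightarrow> (real^'n::finite \<Rightarrow> real) \<Rightarrow> bool" where
  "p_harmonic p v \<longleftrightarrow> Ck (Suc 0) v \<and>
     (\<forall>i. Ck (Suc 0) (\<lambda>x. norm (grad v x) powr (p - 2) * grad v x $ i)) \<and>
     (\<forall>x. (\<Sum>i\<in>UNIV. partial_deriv i (\<lambda>x. norm (grad v x) powr (p - 2) * grad v x $ i) x) = 0)"

text \<open>
  The function is \<open>v x = exp (\<tau> \<rho> \<bullet> x) w (\<tau> \<eta> \<bullet> x) / \<tau>\<close>. Its gradient has norm
  \<open>exp (\<tau> \<rho> \<bullet> x) r (\<tau> \<eta> \<bullet> x)\<close>, and the bounds for the modulus \<open>r\<close> do not depend on \<open>\<tau>\<close>.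
\<close>

lemma wolff_solution:
  fixes \<rho> \<eta> :: "real^'n::finite" and p :: real
  assumes p: "1 < p" and \<rho>: "norm \<rho> = 1" and \<eta>: "norm \<eta> = 1" and orth: "\<rho> \<bullet> \<eta> = 0"
  shows "\<exists>c>0. \<exists>C. \<forall>\<tau>>0. \<exists>v. p_harmonic p v \<and>
      (\<forall>x. c * exp (\<tau> * (\<rho> \<bullet> x)) \<le> norm (grad v x) \<and> norm (grad v x) \<le> C * exp (\<tau> * (\<rho> \<bullet> x)))"
proof -
  obtain w z r A A' B :: "real \<Rightarrow> real" and c C :: real
    where w: "\<And>y. (w has_real_derivative z y) (at y)"
    and r: "\<And>y. (w y)\<^sup>2 + (z y)\<^sup>2 = (r y)\<^sup>2"
    and c: "0 < c" "\<And>y. c \<le> r y" "\<And>y. r y \<le> C"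
    and A: "\<And>y. A y = r y powr (p - 2) * w y"
    and B: "\<And>y. B y = r y powr (p - 2) * z y"
    and A': "\<And>y. (A has_real_derivative A' y) (at y)"
    and B': "\<And>y. (B has_real_derivative - (p - 1) * A y) (at y)"
    and cont: "continuous_on UNIV A'" "continuous_on UNIV z"
    using wolff_profile[OF p] by metis
  have rpos: "0 < r y" for y using c(1) c(2)[of y] by linarith
  have contw: "continuous_on UNIV w" "continuous_on UNIV A" "continuous_on UNIV B"
    using DERIV_isCont[OF w] DERIV_isCont[OF A'] DERIV_isCont[OF B']
    by (auto intro!: continuous_at_imp_continuous_on)
  \<comment> \<open>The product rule for functions of the two variables \<open>\<rho> \<bullet> x\<close> and \<open>\<eta> \<bullet> x\<close>.\<close>
  have deriv: "((\<lambda>x. exp (a * (\<rho> \<bullet> x)) * f (\<tau> * (\<eta> \<bullet> x))) has_derivative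
      (\<lambda>h. (exp (a * (\<rho> \<bullet> x)) *\<^sub>R ((a * f (\<tau> * (\<eta> \<bullet> x))) *\<^sub>R \<rho> + (\<tau> * f' (\<tau> * (\<eta> \<bullet> x))) *\<^sub>R \<eta>)) \<bullet> h)) (at x)"
    if f: "\<And>y. (f has_real_derivative f' y) (at y)" for f f' a \<tau> x
  proof -
    have 1: "((\<lambda>x. exp (a * (\<rho> \<bullet> x))) has_derivative (\<lambda>h. (a * (\<rho> \<bullet> h)) * exp (a * (\<rho> \<bullet> x)))) (at x)"
      by (auto intro!: derivative_eq_intros)
    have "((\<lambda>x. \<tau> * (\<eta> \<bullet> x)) has_derivative (\<lambda>h. \<tau> * (\<eta> \<bullet> h))) (at x)"
      by (auto intro!: derivative_eq_intros)
    from has_derivative_compose[OF this f[unfolded has_field_derivative_def]]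
    have 2: "((\<lambda>x. f (\<tau> * (\<eta> \<bullet> x))) has_derivative (\<lambda>h. f' (\<tau> * (\<eta> \<bullet> x)) * (\<tau> * (\<eta> \<bullet> h)))) (at x)" .
    show ?thesis
      by (rule has_derivative_eq_rhs[OF has_derivative_mult[OF 1 2]])
         (auto simp: inner_add_left algebra_simps)
  qed
  have comp: "continuous_on UNIV (\<lambda>x::real^'n. f (\<tau> * (\<eta> \<bullet> x)))" if "continuous_on UNIV f" for f :: "real \<Rightarrow> real" and \<tau>
    by (rule continuous_on_compose2[OF that]) (auto intro!: continuous_intros)
  have dots: "\<rho> \<bullet> \<rho> = 1" "\<eta> \<bullet> \<eta> = 1" using \<rho> \<eta> by (simp_all add: dot_square_norm)
  show ?thesis
  proof (rule exI[of _ c], intro conjI c(1), rule exI[of _ C], intro allI impI)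
    fix \<tau> :: real assume \<tau>: "0 < \<tau>"
    define v where "v = (\<lambda>x. (1 / \<tau>) * (exp (\<tau> * (\<rho> \<bullet> x)) * w (\<tau> * (\<eta> \<bullet> x))))"
    define V where "V = (\<lambda>x. exp (\<tau> * (\<rho> \<bullet> x)) *\<^sub>R (w (\<tau> * (\<eta> \<bullet> x)) *\<^sub>R \<rho> + z (\<tau> * (\<eta> \<bullet> x)) *\<^sub>R \<eta>))"
    have vd: "(v has_derivative (\<lambda>h. V x \<bullet> h)) (at x)" for x
    proof -
      have "(v has_derivative (\<lambda>h. (1 / \<tau>) * ((exp (\<tau> * (\<rho> \<bullet> x)) *\<^sub>R
          ((\<tau> * w (\<tau> * (\<eta> \<bullet> x))) *\<^sub>R \<rho> + (\<tau> * z (\<tau> * (\<eta> \<bullet> x))) *\<^sub>R \<eta>)) \<bullet> h))) (at x)"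
        unfolding v_def by (intro has_derivative_mult_right deriv[OF w])
      then show ?thesis
        by (rule has_derivative_eq_rhs) (use \<tau> in \<open>auto simp: V_def inner_add_left field_simps\<close>)
    qed
    have Vc: "continuous_on UNIV V" unfolding V_def by (intro continuous_intros comp contw cont)
    note v1 = C1I[OF vd Vc]
    have nV: "norm (V x) = exp (\<tau> * (\<rho> \<bullet> x)) * r (\<tau> * (\<eta> \<bullet> x))" for x
    proof -
      let ?w = "w (\<tau> * (\<eta> \<bullet> x))" and ?z = "z (\<tau> * (\<eta> \<bullet> x))" and ?r = "r (\<tau> * (\<eta> \<bullet> x))"
      have "(norm (?w *\<^sub>R \<rho> + ?z *\<^sub>R \<eta>))\<^sup>2 = ?w\<^sup>2 + ?z\<^sup>2"
        unfolding power2_norm_eq_inner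
        using orth dots by (simp add: inner_add_left inner_add_right inner_commute[of \<eta> \<rho>] power2_eq_square)
      then have "(norm (?w *\<^sub>R \<rho> + ?z *\<^sub>R \<eta>))\<^sup>2 = ?r\<^sup>2" using r by simp
      then have "norm (?w *\<^sub>R \<rho> + ?z *\<^sub>R \<eta>) = ?r"
        using rpos[of "\<tau> * (\<eta> \<bullet> x)"] by (simp add: power2_eq_iff_nonneg)
      then show ?thesis by (simp add: V_def)
    qed
    define F where "F = (\<lambda>i x. exp ((p - 1) * \<tau> * (\<rho> \<bullet> x)) * (\<rho> $ i * A (\<tau> * (\<eta> \<bullet> x)) + \<eta> $ i * B (\<tau> * (\<eta> \<bullet> x))))"
    have Feq: "(\<lambda>x. norm (V x) powr (p - 2) * V x $ i) = F i" for i
    proof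
      fix x
      let ?e = "exp (\<tau> * (\<rho> \<bullet> x))"
      have "?e powr (p - 2) * ?e = exp ((p - 1) * \<tau> * (\<rho> \<bullet> x))"
        by (simp add: powr_def algebra_simps flip: exp_add)
      moreover have "norm (V x) powr (p - 2) * V x $ i
          = (?e powr (p - 2) * ?e) * (r (\<tau> * (\<eta> \<bullet> x)) powr (p - 2) * (w (\<tau> * (\<eta> \<bullet> x)) * \<rho> $ i + z (\<tau> * (\<eta> \<bullet> x)) * \<eta> $ i))"
        unfolding nV using rpos by (simp add: V_def powr_mult less_imp_le mult_ac)
      ultimately show "norm (V x) powr (p - 2) * V x $ i = F i x"
        by (simp add: F_def A B distrib_left mult_ac)
    qed
    define FV where "FV = (\<lambda>i x. exp ((p - 1) * \<tau> * (\<rho> \<bullet> x)) *\<^sub>R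
        (((p - 1) * \<tau> * (\<rho> $ i * A (\<tau> * (\<eta> \<bullet> x)) + \<eta> $ i * B (\<tau> * (\<eta> \<bullet> x)))) *\<^sub>R \<rho>
         + (\<tau> * (\<rho> $ i * A' (\<tau> * (\<eta> \<bullet> x)) + \<eta> $ i * (- (p - 1) * A (\<tau> * (\<eta> \<bullet> x))))) *\<^sub>R \<eta>))"
    have Fd: "(F i has_derivative (\<lambda>h. FV i x \<bullet> h)) (at x)" for i x
    proof -
      have "((\<lambda>y. \<rho> $ i * A y + \<eta> $ i * B y) has_real_derivative \<rho> $ i * A' y + \<eta> $ i * (- (p - 1) * A y)) (at y)" for y
        by (intro DERIV_add DERIV_cmult A' B')
      from deriv[OF this, of "(p - 1) * \<tau>" \<tau> x] show ?thesis unfolding F_def FV_def .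
    qed
    have FVc: "continuous_on UNIV (FV i)" for i
      unfolding FV_def by (intro continuous_intros comp contw cont)
    note F1 = C1I[OF Fd FVc]
    have "(\<Sum>i\<in>UNIV. partial_deriv i (F i) x) = 0" for x
    proof -
      let ?a = "A (\<tau> * (\<eta> \<bullet> x))" and ?b = "B (\<tau> * (\<eta> \<bullet> x))" and ?a' = "A' (\<tau> * (\<eta> \<bullet> x))"
        and ?E = "exp ((p - 1) * \<tau> * (\<rho> \<bullet> x))"
      have "partial_deriv i (F i) x = ?E * (p - 1) * \<tau> * ?a * (\<rho> $ i * \<rho> $ i)
          + ?E * ((p - 1) * \<tau> * ?b + \<tau> * ?a') * (\<rho> $ i * \<eta> $ i)
          - ?E * (p - 1) * \<tau> * ?a * (\<eta> $ i * \<eta> $ i)" for i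
        unfolding partial_deriv_eq_inner[OF Fd] by (simp add: FV_def algebra_simps)
      then have "(\<Sum>i\<in>UNIV. partial_deriv i (F i) x) = ?E * (p - 1) * \<tau> * ?a * (\<rho> \<bullet> \<rho>)
          + ?E * ((p - 1) * \<tau> * ?b + \<tau> * ?a') * (\<rho> \<bullet> \<eta>)
          - ?E * (p - 1) * \<tau> * ?a * (\<eta> \<bullet> \<eta>)"
        by (simp only: sum.distrib sum_subtractf sum_distrib_left[symmetric] inner_vec_def inner_real_def)
      then show ?thesis using orth dots by simp
    qed
    moreover have "c * exp (\<tau> * (\<rho> \<bullet> x)) \<le> norm (V x)" "norm (V x) \<le> C * exp (\<tau> * (\<rho> \<bullet> x))" for x
      unfolding nV using c(2,3) by (simp_all add: mult.commute)
    ultimately show "\<exists>v. p_harmonic p v \<and>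
      (\<forall>x. c * exp (\<tau> * (\<rho> \<bullet> x)) \<le> norm (grad v x) \<and> norm (grad v x) \<le> C * exp (\<tau> * (\<rho> \<bullet> x)))"
      using v1(1) F1(1) by (intro exI[of _ v]) (simp only: p_harmonic_def v1(2) Feq simp_thms)
  qed
qed

section \<open>Energy bounds for the Dirichlet-to-Neumann map\<close>

definition (in sobolev_domain) boundary_class :: "(real^'n \<Rightarrow> real) \<Rightarrow> (real^'n \<Rightarrow> real) set" where
  "boundary_class f = {(f, g). f \<in> W1p U p \<and> g \<in> W1p U p \<and> (\<lambda>x. f x - g x) \<in> W1p_0 U p} `` {f}"

context conductivity
begin

text \<open>
  The solution chosen by \<open>dn_map\<close> is a weak solution with boundary values \<open>f\<close>. Changing the
  chosen extension in the second argument by an element of \<open>W1p_0\<close> does not affect the energy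
  form, so the extension may be replaced by the solution itself.
\<close>

lemma dn_map_eq_energy:
  assumes f: "f \<in> W1p U p"
  shows "\<exists>u. weak_solution U p \<sigma> u \<and> (\<lambda>x. f x - u x) \<in> W1p_0 U p \<and>
    dn_map U p \<sigma> (boundary_class f) (boundary_class f) = energy (wgrad u)"
proof -
  let ?F = "boundary_class f"
  have F: "?F \<in> boundary_space U p" unfolding boundary_space_def boundary_class_def using f by (rule quotientI)
  have memF: "g \<in> ?F \<longleftrightarrow> g \<in> W1p U p \<and> (\<lambda>x. f x - g x) \<in> W1p_0 U p" for g
    using f by (auto simp: boundary_class_def)
  define u where "u = (SOME u. u \<in> ?F \<and> weak_solution U p \<sigma> u)"
  have "\<exists>u. u \<in> ?F \<and> weak_solution U p \<sigma> u"
    using weak_solution_exists[OF f] memF by (auto simp: weak_solution_def)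
  then have u: "u \<in> ?F" "weak_solution U p \<sigma> u" unfolding u_def by (rule someI2_ex, blast)+
  define v where "v = (SOME v. v \<in> ?F)"
  have v: "v \<in> ?F" unfolding v_def using u(1) by (rule someI[where P = "\<lambda>v. v \<in> ?F"])
  have uW: "u \<in> W1p U p" and vW: "v \<in> W1p U p" using u v memF by auto
  have "(\<lambda>x. (f x - u x) + (-1) * (f x - v x)) \<in> W1p_0 U p"
    using u(1) v memF by (intro W1p_0_lincomb) auto
  moreover have "(\<lambda>x. (f x - u x) + (-1) * (f x - v x)) = (\<lambda>x. v x + (-1) * u x)" by auto
  ultimately have "p_energy_form U p \<sigma> u (\<lambda>x. v x + (-1) * u x) = 0"
    using u(2) unfolding weak_solution_def by metis
  then have "p_energy_form U p \<sigma> u v = energy (wgrad u)"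
    unfolding p_energy_form_lincomb[OF uW vW uW] p_energy_form_self by simp
  moreover have "dn_map U p \<sigma> ?F ?F = p_energy_form U p \<sigma> u v"
    using F by (simp add: dn_map_def u_def v_def Let_def)
  ultimately show ?thesis using u memF by auto
qed

lemma p_energy_form_same_boundary_values:
  assumes u: "weak_solution U p \<sigma> u" and f: "f \<in> W1p U p" and fu: "(\<lambda>x. f x - u x) \<in> W1p_0 U p"
  shows "p_energy_form U p \<sigma> u f = energy (wgrad u)"
proof -
  have uW: "u \<in> W1p U p" using u by (simp add: weak_solution_def)
  have "p_energy_form U p \<sigma> u (\<lambda>x. f x + (-1) * u x) = 0"
    using u fu by (simp add: weak_solution_def)
  then show ?thesis unfolding p_energy_form_lincomb[OF uW f uW] p_energy_form_self by simp
qed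

text \<open>
  Integrate the tangent inequality at \<open>\<nabla>u\<close>; the linear term is the energy form at \<open>u\<close>, which
  takes the same value at \<open>f\<close> and at \<open>u\<close>.
\<close>

lemma energy_weak_solution_le:
  assumes u: "weak_solution U p \<sigma> u" and f: "f \<in> W1p U p" and fu: "(\<lambda>x. f x - u x) \<in> W1p_0 U p"
  shows "energy (wgrad u) \<le> energy (wgrad f)"
proof -
  have uW: "u \<in> W1p U p" using u by (simp add: weak_solution_def)
  let ?G = "wgrad u" and ?F = "wgrad f"
  note L = W1p_Lp(2)[OF uW] W1p_Lp(2)[OF f]
  let ?I = "\<lambda>x. \<sigma> x * norm (?G x) powr (p - 2) * (?G x \<bullet> ?F x)"
  have I: "integrable (lebesgue_on U) ?I" by (rule Lp_flux_integrable(1)[OF p L \<sigma>_measurable \<sigma>_abs])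
  have "(LINT x|lebesgue_on U. p * ?I x - (p - 1) * (\<sigma> x * norm (?G x) powr p)) \<le> energy ?F"
    unfolding energy_def
  proof (rule integral_mono_AE)
    show "integrable (lebesgue_on U) (\<lambda>x. p * ?I x - (p - 1) * (\<sigma> x * norm (?G x) powr p))"
      by (intro Bochner_Integration.integrable_diff integrable_mult_right I energy_integrable L)
    show "integrable (lebesgue_on U) (\<lambda>x. \<sigma> x * norm (?F x) powr p)" by (rule energy_integrable[OF L(2)])
    show "AE x in lebesgue_on U. p * ?I x - (p - 1) * (\<sigma> x * norm (?G x) powr p) \<le> \<sigma> x * norm (?F x) powr p"
      using \<sigma>_lower
    proof eventually_elim
      case (elim x)
      have "\<sigma> x * (p * (norm (?G x) powr (p - 2) * (?G x \<bullet> ?F x)) - (p - 1) * norm (?G x) powr p) \<le> \<sigma> x * norm (?F x) powr p"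
        using elim \<epsilon> by (intro mult_left_mono norm_powr_tangent(1)[OF p]) auto
      then show ?case by (simp add: algebra_simps)
    qed
  qed
  moreover have "(LINT x|lebesgue_on U. p * ?I x - (p - 1) * (\<sigma> x * norm (?G x) powr p))
      = p * p_energy_form U p \<sigma> u f - (p - 1) * energy ?G"
    unfolding p_energy_form_def energy_def using I energy_integrable[OF L(1)] by simp
  ultimately show ?thesis
    unfolding p_energy_form_same_boundary_values[OF u f fu] by (simp add: algebra_simps)
qed

end

context sobolev_domain
begin

lemma unit_conductivity: "conductivity U p (\<lambda>_. 1) 1 1"
  by unfold_locales auto

text \<open>
  For test functions this is integration by parts of the divergence-free flux; the general
  case follows by density.
\<close>

lemma classical_p_harmonic_weak_solution:
  assumes "p_harmonic p v"
  shows "weak_solution U p (\<lambda>_. 1) v"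
proof -
  define F where "F = (\<lambda>i x. norm (grad v x) powr (p - 2) * grad v x $ i)"
  have v: "Ck (Suc 0) v" and F1: "Ck (Suc 0) (F i)" and div0: "(\<Sum>i\<in>UNIV. partial_deriv i (F i) x) = 0" for i x
    using assms unfolding p_harmonic_def F_def by blast+
  note vW = C1_W1p(1)[OF v] and VL = C1_W1p(3)[OF v] and Vae = C1_W1p(4)[OF v]
  have one: "(\<lambda>_. 1::real) \<in> borel_measurable (lebesgue_on U)" "AE x in lebesgue_on U. \<bar>1::real\<bar> \<le> 1" by auto
  have test: "(LINT x|lebesgue_on U. 1 * norm (grad v x) powr (p - 2) * (grad v x \<bullet> grad \<phi> x)) = 0"
    if \<phi>: "\<phi> \<in> test_functions U" for \<phi>
  proof -
    have li: "locally_integrable U (F i)" "locally_integrable U (partial_deriv i (F i))" for i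
    proof -
      have "locally_integrable U (F i)" "locally_integrable U (grad (F i))"
        using C1_W1p(2)[OF F1[of i]] by (auto simp: has_weak_gradient_def)
      then show "locally_integrable U (F i)" "locally_integrable U (partial_deriv i (F i))"
        using locally_integrable_nth[of U "grad (F i)" i] by simp_all
    qed
    have "(LINT x|lebesgue_on U. 1 * norm (grad v x) powr (p - 2) * (grad v x \<bullet> grad \<phi> x))
        = (LINT x|lebesgue_on U. (\<Sum>i\<in>UNIV. F i x * partial_deriv i \<phi> x))"
      by (simp add: F_def inner_vec_def sum_distrib_left mult.assoc)
    also have "\<dots> = (\<Sum>i\<in>UNIV. LINT x|lebesgue_on U. F i x * partial_deriv i \<phi> x)"
      by (intro Bochner_Integration.integral_sum locally_integrable_mult_test_function(2)[OF open_U li(1) \<phi>])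
    also have "\<dots> = (\<Sum>i\<in>UNIV. - (LINT x|lebesgue_on U. partial_deriv i (F i) x * \<phi> x))"
    proof (rule sum.cong[OF refl])
      fix i
      show "(LINT x|lebesgue_on U. F i x * partial_deriv i \<phi> x) = - (LINT x|lebesgue_on U. partial_deriv i (F i) x * \<phi> x)"
        using C1_W1p(2)[OF F1[of i]] \<phi> unfolding has_weak_gradient_def grad_nth by blast
    qed
    also have "\<dots> = - (LINT x|lebesgue_on U. (\<Sum>i\<in>UNIV. partial_deriv i (F i) x * \<phi> x))"
      using Bochner_Integration.integral_sum[of UNIV "lebesgue_on U" "\<lambda>i x. partial_deriv i (F i) x * \<phi> x"]
        locally_integrable_mult_test_function(1)[OF open_U li(2) \<phi>] by (simp add: sum_negf)
    also have "\<dots> = 0" by (simp add: div0 flip: sum_distrib_right)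
    finally show ?thesis .
  qed
  have "p_energy_form U p (\<lambda>_. 1) v z = 0" if z: "z \<in> W1p_0 U p" for z
  proof -
    have zL: "wgrad z \<in> Lp_space U p" using z by (intro W1p_Lp(2)) (simp add: W1p_0_iff)
    let ?I = "\<lambda>H. LINT x|lebesgue_on U. 1 * norm (grad v x) powr (p - 2) * (grad v x \<bullet> H x)"
    have eq: "p_energy_form U p (\<lambda>_. 1) v z = ?I (wgrad z)"
      unfolding p_energy_form_def
    proof (rule integral_cong_AE)
      show "AE x in lebesgue_on U. 1 * norm (wgrad v x) powr (p - 2) * (wgrad v x \<bullet> wgrad z x)
          = 1 * norm (grad v x) powr (p - 2) * (grad v x \<bullet> wgrad z x)"
        using Vae by eventually_elim simp
    qed (use Lp_spaceD(1)[OF zL] Lp_spaceD(1)[OF VL] Lp_spaceD(1)[OF W1p_Lp(2)[OF vW]] in measurable)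
    have "\<bar>?I (wgrad z)\<bar> \<le> 0 + r" if r: "0 < r" for r
    proof -
      \<comment> \<open>Young's inequality splits the error into a multiple of the fixed mass of \<open>\<nabla>v\<close>, made
        small by \<open>e\<close>, and a multiple of the distance from \<open>z\<close> to a test function.\<close>
      define e where "e = r / (2 * (p_mass U p (grad v) + 1))"
      have e: "0 < e" using r p_mass_nonneg[of U p "grad v"] by (simp add: e_def)
      have e1: "e * p_mass U p (grad v) \<le> r / 2"
      proof -
        have "e * p_mass U p (grad v) \<le> e * (p_mass U p (grad v) + 1)" using e by (intro mult_left_mono) auto
        also have "\<dots> = r / 2" using p_mass_nonneg[of U p "grad v"] by (simp add: e_def field_simps)
        finally show ?thesis .
      qed
      obtain \<phi> where \<phi>: "\<phi> \<in> test_functions U"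
        "p_mass U p (\<lambda>x. wgrad z x - grad \<phi> x) < r / 2 / e powr (1 - p)"
        using W1p_0_approx[OF z, of "r / 2 / e powr (1 - p)"] r e by auto
      have \<phi>L: "grad \<phi> \<in> Lp_space U p" by (rule C1_W1p(3)[OF test_function_C1[OF \<phi>(1)]])
      have dL: "(\<lambda>x. wgrad z x - grad \<phi> x) \<in> Lp_space U p" by (rule Lp_diff(1)[OF p0 zL \<phi>L])
      have "?I (\<lambda>x. wgrad z x - grad \<phi> x) = ?I (wgrad z) - ?I (grad \<phi>)"
        using Lp_flux_integrable(1)[OF p VL zL one] Lp_flux_integrable(1)[OF p VL \<phi>L one]
        by (simp add: inner_diff_right right_diff_distrib)
      then have "?I (wgrad z) = ?I (\<lambda>x. wgrad z x - grad \<phi> x)" unfolding test[OF \<phi>(1)] by simp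
      also have "\<bar>\<dots>\<bar> \<le> 1 * (e * p_mass U p (grad v) + e powr (1 - p) * p_mass U p (\<lambda>x. wgrad z x - grad \<phi> x))"
        by (rule Lp_flux_integrable(2)[OF p VL dL one e])
      also have "e powr (1 - p) * p_mass U p (\<lambda>x. wgrad z x - grad \<phi> x) \<le> r / 2"
        using \<phi>(2) e by (simp add: field_simps)
      finally show ?thesis using e1 by simp
    qed
    then have "\<bar>?I (wgrad z)\<bar> \<le> 0" by (rule field_le_epsilon)
    then show ?thesis unfolding eq by simp
  qed
  then show ?thesis using vW by (simp add: weak_solution_def)
qed

end

context conductivity
begin

text \<open>
  The flux of \<open>v\<close>, paired with \<open>\<nabla>u\<close>, has the same integral for every \<open>u\<close> with the boundary
  values of \<open>v\<close>, namely \<open>\<integral>|\<nabla>v|\<^sup>p\<close>. The weighted tangent inequality at \<open>\<nabla>v\<close> therefore bounds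
  the energy of \<open>u\<close> from below in terms of \<open>v\<close> alone.
\<close>

lemma energy_lower_bound_p_harmonic:
  assumes v: "weak_solution U p (\<lambda>_. 1) v" and u: "u \<in> W1p U p" and vu: "(\<lambda>x. v x - u x) \<in> W1p_0 U p"
  shows "(LINT x|lebesgue_on U. (p - (p - 1) * \<sigma> x powr (- 1 / (p - 1))) * norm (wgrad v x) powr p) \<le> energy (wgrad u)"
    and "integrable (lebesgue_on U) (\<lambda>x. (p - (p - 1) * \<sigma> x powr (- 1 / (p - 1))) * norm (wgrad v x) powr p)"
proof -
  interpret one: conductivity U p "\<lambda>_. 1" 1 1 by (rule unit_conductivity)
  have vW: "v \<in> W1p U p" using v by (simp add: weak_solution_def)
  let ?V = "wgrad v" and ?G = "wgrad u"
  note L = W1p_Lp(2)[OF vW] W1p_Lp(2)[OF u]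
  let ?s = "\<lambda>x. \<sigma> x powr (- 1 / (p - 1))"
  let ?I = "\<lambda>x. 1 * norm (?V x) powr (p - 2) * (?V x \<bullet> ?G x)"
  have I: "integrable (lebesgue_on U) ?I"
    by (rule Lp_flux_integrable(1)[OF p L one.\<sigma>_measurable one.\<sigma>_abs])
  have S: "integrable (lebesgue_on U) (\<lambda>x. ?s x * norm (?V x) powr p)"
  proof (rule Bochner_Integration.integrable_bound)
    show "integrable (lebesgue_on U) (\<lambda>x. \<epsilon> powr (- 1 / (p - 1)) * norm (?V x) powr p)"
      using Lp_spaceD(2)[OF L(1)] by simp
    show "AE x in lebesgue_on U. norm (?s x * norm (?V x) powr p) \<le> norm (\<epsilon> powr (- 1 / (p - 1)) * norm (?V x) powr p)"
      using \<sigma>_lower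
    proof eventually_elim
      case (elim x)
      have "?s x \<le> \<epsilon> powr (- 1 / (p - 1))" using elim \<epsilon> p by (intro powr_mono2') auto
      then have "?s x * norm (?V x) powr p \<le> \<epsilon> powr (- 1 / (p - 1)) * norm (?V x) powr p"
        by (rule mult_right_mono) simp
      then show ?case by (simp add: abs_mult)
    qed
  qed (use \<sigma>_measurable Lp_spaceD(1)[OF L(1)] in measurable)
  have "(\<lambda>x. (p - (p - 1) * ?s x) * norm (?V x) powr p) = (\<lambda>x. p * norm (?V x) powr p - (p - 1) * (?s x * norm (?V x) powr p))"
    by (simp add: algebra_simps)
  then show int: "integrable (lebesgue_on U) (\<lambda>x. (p - (p - 1) * ?s x) * norm (?V x) powr p)"
    using S Lp_spaceD(2)[OF L(1)] by simp
  have "p_energy_form U p (\<lambda>_. 1) v (\<lambda>x. v x + (-1) * u x) = 0"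
    using v vu by (simp add: weak_solution_def)
  then have "p_energy_form U p (\<lambda>_. 1) v u = one.energy ?V"
    unfolding one.p_energy_form_lincomb[OF vW vW u] one.p_energy_form_self by simp
  then have vu': "integral\<^sup>L (lebesgue_on U) ?I = (LINT x|lebesgue_on U. norm (?V x) powr p)"
    by (simp add: p_energy_form_def one.energy_def)
  have "(LINT x|lebesgue_on U. p * ?I x - (p - 1) * (?s x * norm (?V x) powr p)) \<le> energy ?G"
    unfolding energy_def
  proof (rule integral_mono_AE)
    show "integrable (lebesgue_on U) (\<lambda>x. p * ?I x - (p - 1) * (?s x * norm (?V x) powr p))"
      by (intro Bochner_Integration.integrable_diff integrable_mult_right I S)
    show "integrable (lebesgue_on U) (\<lambda>x. \<sigma> x * norm (?G x) powr p)" by (rule energy_integrable[OF L(2)])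
    show "AE x in lebesgue_on U. p * ?I x - (p - 1) * (?s x * norm (?V x) powr p) \<le> \<sigma> x * norm (?G x) powr p"
      using \<sigma>_lower
    proof eventually_elim
      case (elim x)
      then have "0 < \<sigma> x" using \<epsilon> by simp
      from norm_powr_weighted_tangent[OF p this, of "?V x" "?G x"] show ?case by (simp only: mult_1)
    qed
  qed
  moreover have "(LINT x|lebesgue_on U. p * ?I x - (p - 1) * (?s x * norm (?V x) powr p))
     = p * integral\<^sup>L (lebesgue_on U) ?I - (p - 1) * (LINT x|lebesgue_on U. ?s x * norm (?V x) powr p)"
    using I S by simp
  moreover have "(LINT x|lebesgue_on U. (p - (p - 1) * ?s x) * norm (?V x) powr p)
     = p * (LINT x|lebesgue_on U. norm (?V x) powr p) - (p - 1) * (LINT x|lebesgue_on U. ?s x * norm (?V x) powr p)"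
    using S Lp_spaceD(2)[OF L(1)] by (simp add: algebra_simps)
  ultimately show "(LINT x|lebesgue_on U. (p - (p - 1) * ?s x) * norm (?V x) powr p) \<le> energy ?G"
    unfolding vu' by simp
qed

end

section \<open>Determination of the convex hull\<close>

context sobolev_domain
begin

lemma inclusion_conductivity:
  assumes D: "open D" "D \<subseteq> U" and s: "s \<in> Linf_plus D"
  obtains m e where "0 \<le> m" "0 < e"
    "conductivity U p (\<lambda>x. 1 + s x * indicator D x) (1 + m) 1"
    "AE x in lebesgue_on U. x \<in> D \<longrightarrow> 1 + e \<le> 1 + s x * indicator D x"
    "AE x in lebesgue_on U. 1 + s x * indicator D x \<le> 1 + m * indicator D x"
proof -
  obtain M e where sm: "s \<in> borel_measurable (lebesgue_on D)" and M: "AE x in lebesgue_on D. \<bar>s x\<bar> \<le> M"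
    and e: "0 < e" "AE x in lebesgue_on D. e < s x"
    using s by (auto simp: Linf_plus_def)
  have Ds: "D \<in> sets lebesgue" using D by auto
  let ?m = "max M 0"
  have "(\<lambda>x. indicator D x *\<^sub>R s x) \<in> borel_measurable lebesgue"
    using sm Ds by (subst (asm) borel_measurable_restrict_space_iff) auto
  then have m: "(\<lambda>x. s x * indicator D x) \<in> borel_measurable (lebesgue_on U)"
    by (intro measurable_restrict_space1) (simp add: mult.commute)
  have ae: "AE x in lebesgue_on U. x \<in> D \<longrightarrow> P x" if "AE x in lebesgue_on D. P x" for P
  proof -
    have "AE x in lebesgue. x \<in> D \<longrightarrow> P x" using that Ds by (simp add: AE_restrict_space_iff)
    then show ?thesis using sets_U by (simp add: AE_restrict_space_iff) (auto elim: eventually_mono)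
  qed
  have lower: "AE x in lebesgue_on U. x \<in> D \<longrightarrow> 1 + e \<le> 1 + s x * indicator D x"
    using ae[OF e(2)] by eventually_elim auto
  have upper: "AE x in lebesgue_on U. 1 + s x * indicator D x \<le> 1 + ?m * indicator D x"
    using ae[OF M] by eventually_elim (auto simp: indicator_def)
  show ?thesis
  proof (rule that[of ?m e])
    show "conductivity U p (\<lambda>x. 1 + s x * indicator D x) (1 + ?m) 1"
    proof unfold_locales
      show "(\<lambda>x. 1 + s x * indicator D x) \<in> borel_measurable (lebesgue_on U)" using m by simp
      show "AE x in lebesgue_on U. 1 + s x * indicator D x \<le> 1 + ?m"
        using upper by eventually_elim (auto simp: indicator_def split: if_splits)
      show "AE x in lebesgue_on U. 1 \<le> 1 + s x * indicator D x"
        using lower by eventually_elim (use e in \<open>auto simp: indicator_def\<close>)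
    qed auto
  qed (use e lower upper in auto)
qed

text \<open>
  The two energy bounds, applied to \<open>wolff_solution\<close> in the direction of a separating
  hyperplane, give the inequality named \<open>key\<close> for every \<open>\<tau> > 0\<close>; its left side is unbounded in
  \<open>\<tau>\<close>.
\<close>

lemma dn_map_eq_imp_subset_closure_hull:
  assumes dim: "2 \<le> CARD('n)"
    and D1: "open D1" "D1 \<subseteq> U" "s1 \<in> Linf_plus D1"
    and D2: "D2 \<noteq> {}" "open D2" "D2 \<subseteq> U" "s2 \<in> Linf_plus D2"
    and eq: "dn_map U p (\<lambda>x. 1 + s1 x * indicator D1 x) = dn_map U p (\<lambda>x. 1 + s2 x * indicator D2 x)"
  shows "D1 \<subseteq> closure (convex hull D2)"
proof (rule ccontr)
  assume "\<not> D1 \<subseteq> closure (convex hull D2)"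
  then obtain x1 where x1: "x1 \<in> D1" "x1 \<notin> closure (convex hull D2)" by blast
  obtain a b where ab: "a \<bullet> x1 < b" "\<forall>x\<in>closure (convex hull D2). b < a \<bullet> x"
    using separating_hyperplane_closed_point[OF convex_closure[OF convex_convex_hull] closed_closure x1(2)] by blast
  have D2h: "D2 \<subseteq> closure (convex hull D2)" by (rule order_trans[OF hull_subset closure_subset])
  have "a \<noteq> 0"
  proof
    assume "a = 0"
    moreover obtain x2 where "x2 \<in> D2" using D2(1) by blast
    then have "b < a \<bullet> x2" using ab(2) D2h by blast
    ultimately show False using ab(1) by simp
  qed
  define \<rho> where "\<rho> = (- 1 / norm a) *\<^sub>R a"
  define t where "t = - b / norm a"
  have \<rho>: "norm \<rho> = 1" using \<open>a \<noteq> 0\<close> by (simp add: \<rho>_def)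
  have x1t: "t < \<rho> \<bullet> x1" using ab(1) \<open>a \<noteq> 0\<close> by (simp add: \<rho>_def t_def divide_strict_right_mono)
  have D2t: "\<rho> \<bullet> x < t" if "x \<in> D2" for x
    using ab(2) D2h that \<open>a \<noteq> 0\<close> by (auto simp: \<rho>_def t_def divide_strict_right_mono)
  obtain \<eta>' :: "real^'n" where "\<eta>' \<noteq> 0" "orthogonal \<rho> \<eta>'"
    using orthogonal_to_vector_exists[of \<rho>] dim by auto
  then obtain \<eta> :: "real^'n" where \<eta>: "norm \<eta> = 1" "\<rho> \<bullet> \<eta> = 0"
    by (intro that[of "(1 / norm \<eta>') *\<^sub>R \<eta>'"]) (auto simp: orthogonal_def)
  \<comment> \<open>Half of the gap is left for a ball around \<open>x1\<close>.\<close>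
  define \<gamma> where "\<gamma> = (\<rho> \<bullet> x1 - t) / 2"
  have \<gamma>: "0 < \<gamma>" using x1t by (simp add: \<gamma>_def)
  have "open (D1 \<inter> {x. t + \<gamma> < \<rho> \<bullet> x})"
    using D1 by (intro open_Int open_halfspace_gt) auto
  moreover have "x1 \<in> D1 \<inter> {x. t + \<gamma> < \<rho> \<bullet> x}" using x1 x1t by (auto simp: \<gamma>_def field_simps)
  ultimately obtain r where r: "0 < r" "ball x1 r \<subseteq> D1 \<inter> {x. t + \<gamma> < \<rho> \<bullet> x}"
    by (meson open_contains_ball)
  let ?B = "ball x1 r"
  obtain m1 e where "0 \<le> m1" and e: "0 < e"
    and cond1: "conductivity U p (\<lambda>x. 1 + s1 x * indicator D1 x) (1 + m1) 1"
    and lower: "AE x in lebesgue_on U. x \<in> D1 \<longrightarrow> 1 + e \<le> 1 + s1 x * indicator D1 x"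
    and "AE x in lebesgue_on U. 1 + s1 x * indicator D1 x \<le> 1 + m1 * indicator D1 x"
    by (rule inclusion_conductivity[OF D1])
  obtain m e2 where m: "0 \<le> m" and "0 < e2"
    and cond2: "conductivity U p (\<lambda>x. 1 + s2 x * indicator D2 x) (1 + m) 1"
    and "AE x in lebesgue_on U. x \<in> D2 \<longrightarrow> 1 + e2 \<le> 1 + s2 x * indicator D2 x"
    and upper: "AE x in lebesgue_on U. 1 + s2 x * indicator D2 x \<le> 1 + m * indicator D2 x"
    by (rule inclusion_conductivity[OF D2(2-4)])
  interpret C1: conductivity U p "\<lambda>x. 1 + s1 x * indicator D1 x" "1 + m1" 1 by (rule cond1)
  interpret C2: conductivity U p "\<lambda>x. 1 + s2 x * indicator D2 x" "1 + m" 1 by (rule cond2)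
  interpret finite_measure "lebesgue_on U" using lmeasurable_U by (rule finite_measure_lebesgue_on)
  obtain c C :: real where c: "0 < c" and wolff: "\<And>\<tau>. 0 < \<tau> \<Longrightarrow> \<exists>v. p_harmonic p v \<and>
      (\<forall>x. c * exp (\<tau> * (\<rho> \<bullet> x)) \<le> norm (grad v x) \<and> norm (grad v x) \<le> C * exp (\<tau> * (\<rho> \<bullet> x)))"
    using wolff_solution[OF p \<rho> \<eta>] by blast
  have C: "0 \<le> C"
  proof -
    obtain v :: "real^'n \<Rightarrow> real" where "\<forall>x. norm (grad v x) \<le> C * exp (1 * (\<rho> \<bullet> x))"
      using wolff[OF zero_less_one] by blast
    then have "norm (grad v 0) \<le> C * exp (1 * (\<rho> \<bullet> 0))" ..
    then have "norm (grad v 0) \<le> C" by simp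
    then show ?thesis by (rule order_trans[OF norm_ge_zero])
  qed
  \<comment> \<open>The gain over the background in the lower energy bound where the conductivity is at least \<open>1 + e\<close>.\<close>
  define \<kappa> where "\<kappa> = (p - 1) * (1 - (1 + e) powr (- 1 / (p - 1)))"
  have \<kappa>: "0 < \<kappa>"
  proof -
    have "(1 + e) powr (- 1 / (p - 1)) < (1 + e) powr 0" using e p by (intro powr_less_mono) auto
    then show ?thesis using e p by (simp add: \<kappa>_def)
  qed
  have Bs: "?B \<in> sets lebesgue" and BU: "?B \<subseteq> U" using r D1 by auto
  have Bpos: "0 < measure lebesgue ?B"
    using r(1) by (simp add: content_ball_pos)
  have key: "\<kappa> * c powr p * measure lebesgue ?B * exp (p * \<tau> * \<gamma>) \<le> m * C powr p * measure lebesgue U"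
    if \<tau>: "0 < \<tau>" for \<tau>
  proof -
    obtain v where v: "p_harmonic p v"
      "\<And>x. c * exp (\<tau> * (\<rho> \<bullet> x)) \<le> norm (grad v x)" "\<And>x. norm (grad v x) \<le> C * exp (\<tau> * (\<rho> \<bullet> x))"
      using wolff[OF \<tau>] by blast
    have v1: "Ck (Suc 0) v" using v(1) by (simp only: p_harmonic_def)
    note vW = C1_W1p(1)[OF v1] and VL = W1p_Lp(2)[OF C1_W1p(1)[OF v1]] and Vae = C1_W1p(4)[OF v1]
    have vs: "weak_solution U p (\<lambda>_. 1) v" by (rule classical_p_harmonic_weak_solution[OF v(1)])
    obtain u1 where u1: "weak_solution U p (\<lambda>x. 1 + s1 x * indicator D1 x) u1" "(\<lambda>x. v x - u1 x) \<in> W1p_0 U p"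
      "dn_map U p (\<lambda>x. 1 + s1 x * indicator D1 x) (boundary_class v) (boundary_class v) = C1.energy (wgrad u1)"
      using C1.dn_map_eq_energy[OF vW] by blast
    obtain u2 where u2: "weak_solution U p (\<lambda>x. 1 + s2 x * indicator D2 x) u2" "(\<lambda>x. v x - u2 x) \<in> W1p_0 U p"
      "dn_map U p (\<lambda>x. 1 + s2 x * indicator D2 x) (boundary_class v) (boundary_class v) = C2.energy (wgrad u2)"
      using C2.dn_map_eq_energy[OF vW] by blast
    have "C1.energy (wgrad u1) = C2.energy (wgrad u2)" using u1(3) u2(3) unfolding eq by simp
    also have "\<dots> \<le> C2.energy (wgrad v)" by (rule C2.energy_weak_solution_le[OF u2(1) vW u2(2)])
    finally have E: "C1.energy (wgrad u1) \<le> C2.energy (wgrad v)" .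
    let ?N = "\<lambda>x. norm (wgrad v x) powr p"
    let ?lo = "\<kappa> * (c * exp (\<tau> * (t + \<gamma>))) powr p" and ?hi = "m * (C * exp (\<tau> * t)) powr p"
    note Ni = Lp_spaceD(2)[OF VL]
    have Bi: "integrable (lebesgue_on U) (\<lambda>x. indicator ?B x :: real)"
    proof (rule integrable_real_indicator)
      show "?B \<in> sets (lebesgue_on U)" using Bs BU sets_U by (simp add: sets_restrict_space_iff)
      show "emeasure (lebesgue_on U) ?B < \<infinity>" 
        by (metis emeasure_finite infinity_ennreal_def less_top)
    qed
    have u1W: "u1 \<in> W1p U p" using u1(1) by (simp add: weak_solution_def)
    have "(LINT x|lebesgue_on U. ?N x + ?lo * indicator ?B x)
        \<le> (LINT x|lebesgue_on U. (p - (p - 1) * (1 + s1 x * indicator D1 x) powr (- 1 / (p - 1))) * ?N x)"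
    proof (rule integral_mono_AE)
      show "integrable (lebesgue_on U) (\<lambda>x. ?N x + ?lo * indicator ?B x)" using Ni Bi by simp
      show "integrable (lebesgue_on U) (\<lambda>x. (p - (p - 1) * (1 + s1 x * indicator D1 x) powr (- 1 / (p - 1))) * ?N x)"
        by (rule C1.energy_lower_bound_p_harmonic(2)[OF vs u1W u1(2)])
      show "AE x in lebesgue_on U. ?N x + ?lo * indicator ?B x
          \<le> (p - (p - 1) * (1 + s1 x * indicator D1 x) powr (- 1 / (p - 1))) * ?N x"
        using Vae lower C1.\<sigma>_lower
      proof eventually_elim
        case (elim x)
        let ?\<sigma> = "1 + s1 x * indicator D1 x"
        show ?case
        proof (cases "x \<in> ?B")
          case True
          then have "x \<in> D1" "t + \<gamma> < \<rho> \<bullet> x" using r(2) by auto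
          have "?\<sigma> powr (- 1 / (p - 1)) \<le> (1 + e) powr (- 1 / (p - 1))"
            using elim(2) \<open>x \<in> D1\<close> e p by (intro powr_mono2') auto
          then have "1 + \<kappa> \<le> p - (p - 1) * ?\<sigma> powr (- 1 / (p - 1))"
            using p mult_left_mono[of "?\<sigma> powr (- 1 / (p - 1))" "(1 + e) powr (- 1 / (p - 1))" "p - 1"]
            by (simp add: \<kappa>_def right_diff_distrib)
          then have "(1 + \<kappa>) * ?N x \<le> (p - (p - 1) * ?\<sigma> powr (- 1 / (p - 1))) * ?N x"
            by (rule mult_right_mono) simp
          moreover have "(c * exp (\<tau> * (t + \<gamma>))) powr p \<le> ?N x"
          proof (rule powr_mono2)
            have "c * exp (\<tau> * (t + \<gamma>)) \<le> c * exp (\<tau> * (\<rho> \<bullet> x))"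
              using c \<tau> \<open>t + \<gamma> < \<rho> \<bullet> x\<close> by simp
            then show "c * exp (\<tau> * (t + \<gamma>)) \<le> norm (wgrad v x)" using v(2)[of x] elim(1) by simp
          qed (use p c in auto)
          then have "?lo \<le> \<kappa> * ?N x" using \<kappa> by (intro mult_left_mono) auto
          ultimately show ?thesis using True by (simp add: distrib_right)
        next
          case False
          have "?\<sigma> powr (- 1 / (p - 1)) \<le> 1 powr (- 1 / (p - 1))"
            using elim(3) p by (intro powr_mono2') auto
          then have "(p - 1) * ?\<sigma> powr (- 1 / (p - 1)) \<le> (p - 1) * 1"
            using p by (intro mult_left_mono) auto
          moreover have "1 \<le> p - y" if "y \<le> (p - 1) * 1" for y using that by simp
          ultimately have "1 \<le> p - (p - 1) * ?\<sigma> powr (- 1 / (p - 1))" by blast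
          then have "1 * ?N x \<le> (p - (p - 1) * ?\<sigma> powr (- 1 / (p - 1))) * ?N x"
            by (rule mult_right_mono) simp
          then show ?thesis using False by simp
        qed
      qed
    qed
    also have "\<dots> \<le> C1.energy (wgrad u1)" by (rule C1.energy_lower_bound_p_harmonic(1)[OF vs u1W u1(2)])
    also note E
    also have "C2.energy (wgrad v) \<le> (LINT x|lebesgue_on U. ?N x + ?hi)"
      unfolding C2.energy_def
    proof (rule integral_mono_AE)
      show "integrable (lebesgue_on U) (\<lambda>x. (1 + s2 x * indicator D2 x) * ?N x)"
        by (rule C2.energy_integrable[OF VL])
      show "integrable (lebesgue_on U) (\<lambda>x. ?N x + ?hi)" using Ni by simp
      show "AE x in lebesgue_on U. (1 + s2 x * indicator D2 x) * ?N x \<le> ?N x + ?hi"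
        using Vae upper
      proof eventually_elim
        case (elim x)
        have "(1 + s2 x * indicator D2 x) * ?N x \<le> (1 + m * indicator D2 x) * ?N x"
          using elim(2) by (rule mult_right_mono) simp
        also have "\<dots> = ?N x + m * (indicator D2 x * ?N x)" by (simp add: algebra_simps)
        also have "indicator D2 x * ?N x \<le> (C * exp (\<tau> * t)) powr p"
        proof (cases "x \<in> D2")
          case True
          have "norm (wgrad v x) \<le> C * exp (\<tau> * (\<rho> \<bullet> x))" using v(3)[of x] elim(1) by simp
          also have "\<dots> \<le> C * exp (\<tau> * t)"
            using C \<tau> D2t[OF True] by (intro mult_left_mono) auto
          finally show ?thesis using True p by (simp add: powr_mono2)
        qed simp
        finally show ?case using m by (simp add: mult_left_mono)
      qed
    qed
    finally have "(LINT x|lebesgue_on U. ?N x + ?lo * indicator ?B x) \<le> (LINT x|lebesgue_on U. ?N x + ?hi)" .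
    moreover have "(LINT x|lebesgue_on U. indicator ?B x) = measure lebesgue ?B"
      using BU Bs by (simp add: measure_restrict_space sets_U Int_absorb2)
    then have "(LINT x|lebesgue_on U. ?N x + ?lo * indicator ?B x) = (LINT x|lebesgue_on U. ?N x) + ?lo * measure lebesgue ?B"
      using Ni Bi by simp
    moreover have "(LINT x|lebesgue_on U. ?N x + ?hi) = (LINT x|lebesgue_on U. ?N x) + ?hi * measure lebesgue U"
      using Ni by (simp add: measure_restrict_space sets_U)
    ultimately have le: "?lo * measure lebesgue ?B \<le> ?hi * measure lebesgue U" by simp
    have ep: "exp y powr p = exp (p * y)" for y by (simp add: powr_def)
    have lo: "?lo = exp (p * (\<tau> * t)) * (\<kappa> * c powr p * exp (p * \<tau> * \<gamma>))"
      using c by (simp add: powr_mult ep distrib_left exp_add mult_ac)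
    have hi: "?hi = exp (p * (\<tau> * t)) * (m * C powr p)"
      using C by (simp add: powr_mult ep mult_ac)
    have "exp (p * (\<tau> * t)) * (\<kappa> * c powr p * measure lebesgue ?B * exp (p * \<tau> * \<gamma>))
        \<le> exp (p * (\<tau> * t)) * (m * C powr p * measure lebesgue U)"
      using le unfolding lo hi by (simp only: mult_ac)
    then show ?thesis by simp
  qed
  define a0 where "a0 = \<kappa> * c powr p * measure lebesgue ?B"
  define b0 where "b0 = m * C powr p * measure lebesgue U"
  have a0: "0 < a0" using \<kappa> c Bpos by (simp add: a0_def)
  have b0: "0 \<le> b0" using m by (simp add: b0_def)
  \<comment> \<open>By \<open>exp y > y\<close>, this value of \<open>\<tau>\<close> already violates the inequality \<open>key\<close>.\<close>
  define \<tau> where "\<tau> = (b0 / a0 + 1) / (p * \<gamma>)"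
  have \<tau>: "0 < \<tau>" unfolding \<tau>_def using a0 b0 p \<gamma> by (intro divide_pos_pos add_nonneg_pos) auto
  have "b0 < a0 * exp (p * \<tau> * \<gamma>)"
  proof -
    have "p * \<tau> * \<gamma> = b0 / a0 + 1" using p \<gamma> by (simp add: \<tau>_def)
    then have "b0 / a0 < exp (p * \<tau> * \<gamma>)" using exp_ge_add_one_self[of "p * \<tau> * \<gamma>"] by simp
    then show ?thesis using a0 by (simp add: field_simps)
  qed
  then show False using key[OF \<tau>] by (simp add: a0_def b0_def)
qed

text \<open>
  An open set in the closure of an open convex set is contained in the convex set itself.
\<close>

lemma dn_map_determines_convex_hull:
  assumes dim: "2 \<le> CARD('n)"
    and D1: "D1 \<noteq> {}" "open D1" "D1 \<subseteq> U" "s1 \<in> Linf_plus D1"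
    and D2: "D2 \<noteq> {}" "open D2" "D2 \<subseteq> U" "s2 \<in> Linf_plus D2"
    and eq: "dn_map U p (\<lambda>x. 1 + s1 x * indicator D1 x) = dn_map U p (\<lambda>x. 1 + s2 x * indicator D2 x)"
  shows "convex hull D1 = convex hull D2"
proof -
  have "convex hull A \<subseteq> convex hull B" if "A \<subseteq> closure (convex hull B)" "open A" "open B" for A B :: "(real^'n) set"
  proof (rule hull_minimal)
    have "A \<subseteq> interior (closure (convex hull B))" using that by (simp add: interior_maximal)
    also have "\<dots> = interior (convex hull B)" by (rule convex_interior_closure) simp
    also have "\<dots> \<subseteq> convex hull B" by (rule interior_subset)
    finally show "A \<subseteq> convex hull B" .
  qed simp
  then show ?thesis
    using dn_map_eq_imp_subset_closure_hull[OF dim D1(2-4) D2 eq]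
      dn_map_eq_imp_subset_closure_hull[OF dim D2(2-4) D1 eq[symmetric]] D1(2) D2(2)
    by (intro equalityI) auto
qed

end

theorem corollary4p4:
  fixes \<Omega> :: "(real^'n::finite) set" and p :: real
  assumes "CARD('n) \<ge> 2" and "1 < p"
    and "open \<Omega>" and "connected \<Omega>" and "\<Omega> \<noteq> {}" and "bounded \<Omega>"
  shows "\<exists>recover :: ((real^'n \<Rightarrow> real) set \<Rightarrow> (real^'n \<Rightarrow> real) set \<Rightarrow> real) \<Rightarrow> (real^'n) set.
           \<forall>D \<sigma>D. D \<noteq> {} \<and> open D \<and> D \<subseteq> \<Omega> \<and> lipschitz_boundary D \<and> \<sigma>D \<in> Linf_plus D \<longrightarrow>
             recover (dn_map \<Omega> p (\<lambda>x. 1 + \<sigma>D x * indicator D x)) = convex hull D"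
proof -
  interpret sobolev_domain \<Omega> p by unfold_locales (use assms in auto)
  let ?P = "\<lambda>\<Lambda> D \<sigma>D. D \<noteq> {} \<and> open D \<and> D \<subseteq> \<Omega> \<and> \<sigma>D \<in> Linf_plus D \<and>
      \<Lambda> = dn_map \<Omega> p (\<lambda>x. 1 + \<sigma>D x * indicator D x)"
  define recover where "recover = (\<lambda>\<Lambda>. convex hull (SOME D. \<exists>\<sigma>D. ?P \<Lambda> D \<sigma>D))"
  have "recover (dn_map \<Omega> p (\<lambda>x. 1 + \<sigma>D x * indicator D x)) = convex hull D"
    if D: "D \<noteq> {}" "open D" "D \<subseteq> \<Omega>" "\<sigma>D \<in> Linf_plus D" for D \<sigma>D
  proof -
    let ?\<Lambda> = "dn_map \<Omega> p (\<lambda>x. 1 + \<sigma>D x * indicator D x)"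
    have "\<exists>D' \<sigma>D'. ?P ?\<Lambda> D' \<sigma>D'" using D by blast
    then have "\<exists>\<sigma>D'. ?P ?\<Lambda> (SOME D'. \<exists>\<sigma>D'. ?P ?\<Lambda> D' \<sigma>D') \<sigma>D'" by (rule someI_ex)
    then obtain D' \<sigma>D' where D': "D' = (SOME D'. \<exists>\<sigma>D'. ?P ?\<Lambda> D' \<sigma>D')" "?P ?\<Lambda> D' \<sigma>D'" by blast
    have "convex hull D = convex hull D'"
      using D D'(2) by (intro dn_map_determines_convex_hull[OF assms(1)]) auto
    then show ?thesis unfolding recover_def D'(1) by simp
  qed
  then show ?thesis by (intro exI[of _ recover]) blast
qed

end
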